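(* Let $\mathbb{K}$ be a commutative ring and $G$ a finite digraph. The ideal $R(G)\triangleleft\mathbb{K}G$ is admissible and there is an isomorphism of graded algebras $$\sigma G\cong\mathbb{K}G/R(G).$$ Moreover, there is an equivalence of categories $$\mathrm{DistMod}_{\mathbb{Z}}(G)\simeq\mathrm{GrRep}(G,R(G))$$ that sends a $\mathbb{Z}$-graded distance module $M$ to the representation $\tilde M$ such that $\tilde M(x)=M(x)$ and $\tilde M((x,y))=M(x,y)$ for each arrow $(x,y)\in G_1$.
   Context: A digraph $G$ has a vertex set $G_0$ and arrow set $G_1\subseteq G_0\times G_0$ with no loops; it is finite if $G_0$ is finite. The path algebra $\mathbb{K}G$ is the $\mathbb{Z}$-graded $\mathbb{K}$-algebra with basis all paths $(x_0,\dots,x_n)$ ($n\ge0$, $(x_i,x_{i+1})\in G_1$), of degree $n$, with product given by concatenation (zero if not concatenable); the trivial path $(x)=e_x$ has degree $0$ and $1=\sum_xe_x$. A path is shortest if it is a shortest path from $x_0$ to $x_n$, otherwise non-shortest. $R(G)$ is the homogeneous ideal of $\mathbb{K}G$ generated by (R1) all differences $(x_0,\dots,x_n)-(y_0,\dots,y_n)$ of two different shortest paths with $x_0=y_0$, $x_n=y_n$; and (R2) all non-shortest paths. Let $J$ be the ideal generated by all paths of positive length. An ideal $I$ of $\mathbb{K}G$ is admissible if $J^n\subseteq I\subseteq J^2$ for some $n$. Distances: $d(x,y)\in\mathbb{Z}_{\ge0}\cup\{\infty\}$ is the infimum of lengths of paths from $x$ to $y$. Write $x\preccurlyeq y\preccurlyeq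 z$ if $d(x,y)+d(y,z)=d(x,z)$. Distance algebra: $\sigma G$ is the $\mathbb{Z}$-graded $\mathbb{K}$-algebra freely generated as a $\mathbb{K}$-module by pairs of vertices $(x,y)$ with $d(x,y)<\infty$, in degree $d(x,y)$, with product $(x,y)\cdot(y',z)=(x,z)$ if $y=y'$ and $x\preccurlyeq y\preccurlyeq z$, and $0$ otherwise; unit $\sum_x(x,x)$. Distance modules: an object $M$ of $\mathrm{DistMod}_{\mathbb{Z}}(G)$ consists of $\mathbb{Z}$-graded $\mathbb{K}$-modules $M(x)$, $x\in G_0$, and morphisms $M(x,y):M(x)\to M(y)$ of degree $d(x,y)$ whenever $d(x,y)<\infty$, such that $M(x,x)=1$ and, whenever $d(x,y),d(y,z)<\infty$, $M(y,z)\circ M(x,y)=M(x,z)$ if $x\preccurlyeq y\preccurlyeq z$ and $=0$ otherwise. Morphisms are families of degree $0$ maps $\varphi(x):M(x)\to N(x)$ commuting with all $M(x,y)$, $N(x,y)$. Graded representations: a graded representation $V$ of $G$ consists of $\mathbb{Z}$-graded $\mathbb{K}$-modules $V(x)$ for vertices $x$ and degree $1$ morphisms $V(\alpha):V(x)\to V(y)$ for arrows $\alpha=(x,y)$; morphisms are families of degree $0$ maps commuting with the $V(\alpha)$. It corresponds to the graded right $\mathbb{K}G$-module $\bigoplus_xV(x)$ with $v\cdot\alpha=V(\alpha)(v)$ if $v\in V(x)$ and $\alpha$ starts at $x$, and $v\cdot\alpha=0$ if $v\in V(x)$ and $\alpha$ does not start at $x$. For a homogeneous ideal $I$, $\mathrm{GrRep}(G,I)$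 is the full subcategory of graded representations whose corresponding module is annihilated by $I$. *)

theory Defs
  imports
    "Graph_Theory.Pair_Digraph"
    "Graph_Theory.Vertex_Walk"
    "HOL-Library.Extended_Nat"
    "HOL-Algebra.Module"
    "HOL-Algebra.QuotRing"
    "HOL-Algebra.Ideal_Product"
begin

no_notation vwalk_join (infixr \<open>\<oplus>\<close> 65)

section \<open>Graded modules and graded algebras\<close>

text \<open>As for the library record \<open>module\<close>, the multiplicative fields are irrelevant for
  modules and are used for algebras only.\<close>

record ('a, 'b) graded_module = "('a, 'b) module" +
  grade :: "int \<Rightarrow> 'b set"

locale graded_module = Module.module K M
  for K :: "('a, 'r) ring_scheme" (structure)
    and M :: "('a, 'b, 'c) graded_module_scheme" (structure) +
  assumes grade_submodule: "submodule (grade M n) K M"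
    and grade_direct_sum:
      "m \<in> carrier M \<Longrightarrow>
        \<exists>!c. (\<forall>n. c n \<in> grade M n) \<and> finite {n. c n \<noteq> \<zero>\<^bsub>M\<^esub>} \<and>
             m = (\<Oplus>\<^bsub>M\<^esub>n\<in>{n. c n \<noteq> \<zero>\<^bsub>M\<^esub>}. c n)"

text \<open>The library locale \<open>algebra\<close> is about commutative algebras.\<close>

locale graded_algebra = graded_module K A + ring A
  for K :: "('a, 'r) ring_scheme" (structure)
    and A :: "('a, 'b, 'c) graded_module_scheme" (structure) +
  assumes smult_mult_left:
      "\<lbrakk>a \<in> carrier K; x \<in> carrier A; y \<in> carrier A\<rbrakk> \<Longrightarrow>
        (a \<odot>\<^bsub>A\<^esub> x) \<otimes>\<^bsub>A\<^esub> y = a \<odot>\<^bsub>A\<^esub> (x \<otimes>\<^bsub>A\<^esub> y)"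
    and smult_mult_right:
      "\<lbrakk>a \<in> carrier K; x \<in> carrier A; y \<in> carrier A\<rbrakk> \<Longrightarrow>
        x \<otimes>\<^bsub>A\<^esub> (a \<odot>\<^bsub>A\<^esub> y) = a \<odot>\<^bsub>A\<^esub> (x \<otimes>\<^bsub>A\<^esub> y)"
    and one_grade: "\<one>\<^bsub>A\<^esub> \<in> grade A 0"
    and mult_grade: "\<lbrakk>x \<in> grade A i; y \<in> grade A j\<rbrakk> \<Longrightarrow> x \<otimes>\<^bsub>A\<^esub> y \<in> grade A (i + j)"

text \<open>Maps are extensional, so that equality of morphisms is equality on the carrier.\<close>

definition graded_hom ::
    "('k, 'r) ring_scheme \<Rightarrow> int \<Rightarrow> ('k, 'm) graded_module \<Rightarrow> ('k, 'n) graded_module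
      \<Rightarrow> ('m \<Rightarrow> 'n) set" where
  "graded_hom K d M N =
    {f \<in> carrier M \<rightarrow>\<^sub>E carrier N.
      (\<forall>x\<in>carrier M. \<forall>y\<in>carrier M. f (x \<oplus>\<^bsub>M\<^esub> y) = f x \<oplus>\<^bsub>N\<^esub> f y) \<and>
      (\<forall>a\<in>carrier K. \<forall>x\<in>carrier M. f (a \<odot>\<^bsub>M\<^esub> x) = a \<odot>\<^bsub>N\<^esub> f x) \<and>
      (\<forall>n. \<forall>x\<in>grade M n. f x \<in> grade N (n + d))}"

definition graded_algebra_isomorphic ::
    "('k, 'r) ring_scheme \<Rightarrow> ('k, 'a) graded_module \<Rightarrow> ('k, 'b) graded_module \<Rightarrow> bool" where
  "graded_algebra_isomorphic K A B \<longleftrightarrow>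
    graded_algebra K A \<and> graded_algebra K B \<and>
    (\<exists>\<phi>\<in>ring_iso A B.
      (\<forall>a\<in>carrier K. \<forall>x\<in>carrier A. \<phi> (a \<odot>\<^bsub>A\<^esub> x) = a \<odot>\<^bsub>B\<^esub> \<phi> x) \<and>
      (\<forall>n. \<phi> ` grade A n = grade B n))"

text \<open>The scalar multiplication on cosets is written in the style of the library's
  \<open>rcoset_mult\<close>.\<close>

definition quotient_algebra ::
    "('k, 'a) graded_module \<Rightarrow> 'a set \<Rightarrow> ('k, 'a set) graded_module" where
  "quotient_algebra A I =
    \<lparr>carrier = carrier (A Quot I), mult = mult (A Quot I), one = one (A Quot I),
     zero = zero (A Quot I), add = add (A Quot I),
     smult = (\<lambda>a X. \<Union>x\<in>X. I +>\<^bsub>A\<^esub> (a \<odot>\<^bsub>A\<^esub> x)),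
     grade = (\<lambda>n. {I +>\<^bsub>A\<^esub> x | x. x \<in> grade A n})\<rparr>"

text \<open>The algebra that is free as a module on the basis \<open>B\<close>; the product of two basis elements
  is the basis element \<open>bmul p q\<close>, or zero if \<open>bmul p q = None\<close>, and the unit is the sum of
  the basis elements in \<open>E\<close>.  Elements are coefficient functions of finite support.\<close>

definition basis_algebra ::
    "('k, 'r) ring_scheme \<Rightarrow> 'b set \<Rightarrow> ('b \<Rightarrow> nat) \<Rightarrow> ('b \<Rightarrow> 'b \<Rightarrow> 'b option) \<Rightarrow> 'b set
      \<Rightarrow> ('k, 'b \<Rightarrow> 'k) graded_module" where
  "basis_algebra K B deg bmul E =
    (let C = {f. (\<forall>b. f b \<in> carrier K) \<and> (\<forall>b. b \<notin> B \<longrightarrow> f b = \<zero>\<^bsub>K\<^esub>) \<and>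
                 finite {b. f b \<noteq> \<zero>\<^bsub>K\<^esub>}}
     in \<lparr>carrier = C,
         mult = (\<lambda>f g r. finsum K (\<lambda>(p, q). f p \<otimes>\<^bsub>K\<^esub> g q)
                   {(p, q). f p \<noteq> \<zero>\<^bsub>K\<^esub> \<and> g q \<noteq> \<zero>\<^bsub>K\<^esub> \<and> bmul p q = Some r}),
         one = (\<lambda>b. if b \<in> E then \<one>\<^bsub>K\<^esub> else \<zero>\<^bsub>K\<^esub>),
         zero = (\<lambda>b. \<zero>\<^bsub>K\<^esub>),
         add = (\<lambda>f g b. f b \<oplus>\<^bsub>K\<^esub> g b),
         smult = (\<lambda>a f b. a \<otimes>\<^bsub>K\<^esub> f b),
         grade = (\<lambda>n. {f \<in> C. \<forall>b. f b \<noteq> \<zero>\<^bsub>K\<^esub> \<longrightarrow> int (deg b) = n})\<rparr>)"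

definition basis_elt :: "('k, 'r) ring_scheme \<Rightarrow> 'b \<Rightarrow> 'b \<Rightarrow> 'k" where
  "basis_elt K p = (\<lambda>q. if q = p then \<one>\<^bsub>K\<^esub> else \<zero>\<^bsub>K\<^esub>)"


section \<open>Paths, distance, and the two algebras\<close>

text \<open>A path is a non-empty vertex list; vertices may repeat, and \<open>vwalk_length\<close> counts
  arrows.\<close>

definition paths :: "'v pair_pre_digraph \<Rightarrow> 'v list set" where
  "paths G = {p. vwalk p (with_proj G)}"

definition gdist :: "'v pair_pre_digraph \<Rightarrow> 'v \<Rightarrow> 'v \<Rightarrow> enat" where
  "gdist G x y = (INF p\<in>{p \<in> paths G. hd p = x \<and> last p = y}. enat (vwalk_length p))"

definition between :: "'v pair_pre_digraph \<Rightarrow> 'v \<Rightarrow> 'v \<Rightarrow> 'v \<Rightarrow> bool" where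
  "between G x y z \<longleftrightarrow> gdist G x y + gdist G y z = gdist G x z"

definition shortest :: "'v pair_pre_digraph \<Rightarrow> 'v list \<Rightarrow> bool" where
  "shortest G p \<longleftrightarrow> p \<in> paths G \<and> enat (vwalk_length p) = gdist G (hd p) (last p)"

definition path_algebra ::
    "('k, 'r) ring_scheme \<Rightarrow> 'v pair_pre_digraph \<Rightarrow> ('k, 'v list \<Rightarrow> 'k) graded_module" where
  "path_algebra K G =
    basis_algebra K (paths G) vwalk_length
      (\<lambda>p q. if joinable p q then Some (vwalk_join p q) else None)
      {[x] | x. x \<in> pverts G}"

definition relation_ideal ::
    "('k, 'r) ring_scheme \<Rightarrow> 'v pair_pre_digraph \<Rightarrow> ('v list \<Rightarrow> 'k) set" where
  "relation_ideal K G =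
    Idl\<^bsub>path_algebra K G\<^esub>
     ({basis_elt K p \<ominus>\<^bsub>path_algebra K G\<^esub> basis_elt K q | p q.
         shortest G p \<and> shortest G q \<and> p \<noteq> q \<and> hd p = hd q \<and> last p = last q} \<union>
      {basis_elt K p | p. p \<in> paths G \<and> \<not> shortest G p})"

definition arrow_ideal ::
    "('k, 'r) ring_scheme \<Rightarrow> 'v pair_pre_digraph \<Rightarrow> ('v list \<Rightarrow> 'k) set" where
  "arrow_ideal K G =
    Idl\<^bsub>path_algebra K G\<^esub> {basis_elt K p | p. p \<in> paths G \<and> vwalk_length p > 0}"

text \<open>Powers of the ideal \<open>J\<close> are taken in the library's structure \<open>ideals_set\<close> of
  ideals with \<open>ideal_prod\<close> as product.\<close>

definition admissible ::
    "('k, 'r) ring_scheme \<Rightarrow> 'v pair_pre_digraph \<Rightarrow> ('v list \<Rightarrow> 'k) set \<Rightarrow> bool" where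
  "admissible K G I \<longleftrightarrow>
    ideal I (path_algebra K G) \<and>
    (\<exists>n::nat.
       arrow_ideal K G [^]\<^bsub>ideals_set (path_algebra K G)\<^esub> n \<subseteq> I \<and>
       I \<subseteq> arrow_ideal K G [^]\<^bsub>ideals_set (path_algebra K G)\<^esub> (2::nat))"

definition finite_dist_pairs :: "'v pair_pre_digraph \<Rightarrow> ('v \<times> 'v) set" where
  "finite_dist_pairs G = {(x, y) \<in> pverts G \<times> pverts G. gdist G x y < \<infinity>}"

definition distance_algebra ::
    "('k, 'r) ring_scheme \<Rightarrow> 'v pair_pre_digraph \<Rightarrow> ('k, 'v \<times> 'v \<Rightarrow> 'k) graded_module" where
  "distance_algebra K G =
    basis_algebra K (finite_dist_pairs G) (\<lambda>(x, y). the_enat (gdist G x y))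
      (\<lambda>(x, y) (y', z). if y = y' \<and> between G x y z then Some (x, z) else None)
      {(x, x) | x. x \<in> pverts G}"


section \<open>Categories\<close>

record ('o, 'a) category =
  Obj :: "'o set"
  Arr :: "'o \<Rightarrow> 'o \<Rightarrow> 'a set"
  Ident :: "'o \<Rightarrow> 'a"
  Cmp :: "'o \<Rightarrow> 'o \<Rightarrow> 'o \<Rightarrow> 'a \<Rightarrow> 'a \<Rightarrow> 'a"

text \<open>\<open>Cmp C X Y Z g f\<close> is the composite of \<open>f : X \<rightarrow> Y\<close> and \<open>g : Y \<rightarrow> Z\<close>.\<close>

locale category =
  fixes C :: "('o, 'a) category"
  assumes Ident_Arr: "X \<in> Obj C \<Longrightarrow> Ident C X \<in> Arr C X X"
    and Cmp_Arr:
      "\<lbrakk>X \<in> Obj C; Y \<in> Obj C; Z \<in> Obj C; f \<in> Arr C X Y; g \<in> Arr C Y Z\<rbrakk>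
        \<Longrightarrow> Cmp C X Y Z g f \<in> Arr C X Z"
    and Cmp_Ident_right:
      "\<lbrakk>X \<in> Obj C; Y \<in> Obj C; f \<in> Arr C X Y\<rbrakk> \<Longrightarrow> Cmp C X X Y f (Ident C X) = f"
    and Cmp_Ident_left:
      "\<lbrakk>X \<in> Obj C; Y \<in> Obj C; f \<in> Arr C X Y\<rbrakk> \<Longrightarrow> Cmp C X Y Y (Ident C Y) f = f"
    and Cmp_assoc:
      "\<lbrakk>W \<in> Obj C; X \<in> Obj C; Y \<in> Obj C; Z \<in> Obj C;
        f \<in> Arr C W X; g \<in> Arr C X Y; h \<in> Arr C Y Z\<rbrakk>
        \<Longrightarrow> Cmp C W Y Z h (Cmp C W X Y g f) = Cmp C W X Z (Cmp C X Y Z h g) f"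

definition full_subcategory ::
    "('o, 'a) category \<Rightarrow> ('o \<Rightarrow> bool) \<Rightarrow> ('o, 'a) category" where
  "full_subcategory C P = C\<lparr>Obj := {X \<in> Obj C. P X}\<rparr>"

definition is_isomorphism :: "('o, 'a) category \<Rightarrow> 'o \<Rightarrow> 'o \<Rightarrow> 'a \<Rightarrow> bool" where
  "is_isomorphism C X Y f \<longleftrightarrow>
    f \<in> Arr C X Y \<and>
    (\<exists>g\<in>Arr C Y X. Cmp C X Y X g f = Ident C X \<and> Cmp C Y X Y f g = Ident C Y)"

record ('o1, 'a1, 'o2, 'a2) cat_functor =
  on_obj :: "'o1 \<Rightarrow> 'o2"
  on_arr :: "'o1 \<Rightarrow> 'o1 \<Rightarrow> 'a1 \<Rightarrow> 'a2"

locale cat_functor = C: category C + D: category D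
  for C :: "('o1, 'a1) category" and D :: "('o2, 'a2) category" +
  fixes F :: "('o1, 'a1, 'o2, 'a2) cat_functor"
  assumes on_obj_Obj: "X \<in> Obj C \<Longrightarrow> on_obj F X \<in> Obj D"
    and on_arr_Arr:
      "\<lbrakk>X \<in> Obj C; Y \<in> Obj C; f \<in> Arr C X Y\<rbrakk>
        \<Longrightarrow> on_arr F X Y f \<in> Arr D (on_obj F X) (on_obj F Y)"
    and on_arr_Ident: "X \<in> Obj C \<Longrightarrow> on_arr F X X (Ident C X) = Ident D (on_obj F X)"
    and on_arr_Cmp:
      "\<lbrakk>X \<in> Obj C; Y \<in> Obj C; Z \<in> Obj C; f \<in> Arr C X Y; g \<in> Arr C Y Z\<rbrakk>
        \<Longrightarrow> on_arr F X Z (Cmp C X Y Z g f) =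
            Cmp D (on_obj F X) (on_obj F Y) (on_obj F Z) (on_arr F Y Z g) (on_arr F X Y f)"

definition id_functor :: "('o, 'a, 'o, 'a) cat_functor" where
  "id_functor = \<lparr>on_obj = (\<lambda>X. X), on_arr = (\<lambda>X Y f. f)\<rparr>"

definition comp_functor ::
    "('o2, 'a2, 'o3, 'a3) cat_functor \<Rightarrow> ('o1, 'a1, 'o2, 'a2) cat_functor
      \<Rightarrow> ('o1, 'a1, 'o3, 'a3) cat_functor" where
  "comp_functor H F =
    \<lparr>on_obj = (\<lambda>X. on_obj H (on_obj F X)),
     on_arr = (\<lambda>X Y f. on_arr H (on_obj F X) (on_obj F Y) (on_arr F X Y f))\<rparr>"

definition naturally_isomorphic ::
    "('o1, 'a1) category \<Rightarrow> ('o2, 'a2) category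
      \<Rightarrow> ('o1, 'a1, 'o2, 'a2) cat_functor \<Rightarrow> ('o1, 'a1, 'o2, 'a2) cat_functor \<Rightarrow> bool" where
  "naturally_isomorphic C D F H \<longleftrightarrow>
    (\<exists>\<tau>. (\<forall>X\<in>Obj C. is_isomorphism D (on_obj F X) (on_obj H X) (\<tau> X)) \<and>
         (\<forall>X\<in>Obj C. \<forall>Y\<in>Obj C. \<forall>f\<in>Arr C X Y.
            Cmp D (on_obj F X) (on_obj F Y) (on_obj H Y) (\<tau> Y) (on_arr F X Y f) =
            Cmp D (on_obj F X) (on_obj H X) (on_obj H Y) (on_arr H X Y f) (\<tau> X)))"

definition category_equivalence ::
    "('o1, 'a1) category \<Rightarrow> ('o2, 'a2) category \<Rightarrow> ('o1, 'a1, 'o2, 'a2) cat_functor \<Rightarrow> bool"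
  where
  "category_equivalence C D F \<longleftrightarrow>
    cat_functor C D F \<and>
    (\<exists>H. cat_functor D C H \<and>
         naturally_isomorphic C C (comp_functor H F) id_functor \<and>
         naturally_isomorphic D D (comp_functor F H) id_functor)"


section \<open>Distance modules and graded representations\<close>

text \<open>Common data of both kinds of objects: a graded module for each vertex, and a map
  \<open>vmap M (x, y)\<close> for each pair in a set \<open>P\<close> of pairs, which is \<open>finite_dist_pairs G\<close> for
  distance modules and the set of arrows for representations.  Families are extensional.\<close>

record ('v, 'k, 'm) vertex_family =
  vmod :: "'v \<Rightarrow> ('k, 'm) graded_module"
  vmap :: "'v \<times> 'v \<Rightarrow> 'm \<Rightarrow> 'm"

definition family_homs ::
    "('k, 'r) ring_scheme \<Rightarrow> 'v pair_pre_digraph \<Rightarrow> ('v \<times> 'v) set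
      \<Rightarrow> ('v, 'k, 'm) vertex_family \<Rightarrow> ('v, 'k, 'm) vertex_family \<Rightarrow> ('v \<Rightarrow> 'm \<Rightarrow> 'm) set" where
  "family_homs K G P M N =
    {\<phi> \<in> (\<Pi>\<^sub>E x\<in>pverts G. graded_hom K 0 (vmod M x) (vmod N x)).
      \<forall>(x, y)\<in>P. \<forall>m\<in>carrier (vmod M x). vmap N (x, y) (\<phi> x m) = \<phi> y (vmap M (x, y) m)}"

definition family_category ::
    "('k, 'r) ring_scheme \<Rightarrow> 'v pair_pre_digraph \<Rightarrow> ('v \<times> 'v) set
      \<Rightarrow> ('v, 'k, 'm) vertex_family set
      \<Rightarrow> (('v, 'k, 'm) vertex_family, 'v \<Rightarrow> 'm \<Rightarrow> 'm) category" where
  "family_category K G P Ob =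
    \<lparr>Obj = Ob,
     Arr = family_homs K G P,
     Ident = (\<lambda>M. \<lambda>x\<in>pverts G. \<lambda>m\<in>carrier (vmod M x). m),
     Cmp = (\<lambda>L M N \<psi> \<phi>. \<lambda>x\<in>pverts G. compose (carrier (vmod L x)) (\<psi> x) (\<phi> x))\<rparr>"

definition distance_module ::
    "('k, 'r) ring_scheme \<Rightarrow> 'v pair_pre_digraph \<Rightarrow> ('v, 'k, 'm) vertex_family \<Rightarrow> bool" where
  "distance_module K G M \<longleftrightarrow>
    vmod M \<in> extensional (pverts G) \<and> vmap M \<in> extensional (finite_dist_pairs G) \<and>
    (\<forall>x\<in>pverts G. graded_module K (vmod M x)) \<and>
    (\<forall>(x, y)\<in>finite_dist_pairs G.
       vmap M (x, y) \<in> graded_hom K (int (the_enat (gdist G x y))) (vmod M x) (vmod M y)) \<and>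
    (\<forall>x\<in>pverts G. \<forall>m\<in>carrier (vmod M x). vmap M (x, x) m = m) \<and>
    (\<forall>x y z. (x, y) \<in> finite_dist_pairs G \<longrightarrow> (y, z) \<in> finite_dist_pairs G \<longrightarrow>
       (\<forall>m\<in>carrier (vmod M x).
          vmap M (y, z) (vmap M (x, y) m) =
            (if between G x y z then vmap M (x, z) m else \<zero>\<^bsub>vmod M z\<^esub>)))"

definition DistMod ::
    "('k, 'r) ring_scheme \<Rightarrow> 'v pair_pre_digraph
      \<Rightarrow> (('v, 'k, 'm) vertex_family, 'v \<Rightarrow> 'm \<Rightarrow> 'm) category" where
  "DistMod K G = family_category K G (finite_dist_pairs G) {M. distance_module K G M}"

definition graded_rep ::
    "('k, 'r) ring_scheme \<Rightarrow> 'v pair_pre_digraph \<Rightarrow> ('v, 'k, 'm) vertex_family \<Rightarrow> bool" where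
  "graded_rep K G V \<longleftrightarrow>
    vmod V \<in> extensional (pverts G) \<and> vmap V \<in> extensional (parcs G) \<and>
    (\<forall>x\<in>pverts G. graded_module K (vmod V x)) \<and>
    (\<forall>(x, y)\<in>parcs G. vmap V (x, y) \<in> graded_hom K 1 (vmod V x) (vmod V y))"

text \<open>The right module over the path algebra corresponding to a representation \<open>V\<close> is the
  direct sum of the \<open>V(x)\<close> over the (finitely many) vertices, i.e. their product.  The path
  \<open>p = (x\<^sub>0, \<dots>, x\<^sub>n)\<close> sends the component of \<open>v\<close> at \<open>x\<^sub>0\<close> along the maps of its
  successive arrows into the component at \<open>x\<^sub>n\<close>, and kills all other components.\<close>

definition rep_module_carrier ::
    "'v pair_pre_digraph \<Rightarrow> ('v, 'k, 'm) vertex_family \<Rightarrow> ('v \<Rightarrow> 'm) set" where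
  "rep_module_carrier G V = (\<Pi>\<^sub>E x\<in>pverts G. carrier (vmod V x))"

definition path_map :: "('v, 'k, 'm) vertex_family \<Rightarrow> 'v list \<Rightarrow> 'm \<Rightarrow> 'm" where
  "path_map V p m = fold (vmap V) (vwalk_arcs p) m"

definition rep_act ::
    "('k, 'r) ring_scheme \<Rightarrow> 'v pair_pre_digraph \<Rightarrow> ('v, 'k, 'm) vertex_family
      \<Rightarrow> ('v \<Rightarrow> 'm) \<Rightarrow> ('v list \<Rightarrow> 'k) \<Rightarrow> 'v \<Rightarrow> 'm" where
  "rep_act K G V v a =
    (\<lambda>y\<in>pverts G. \<Oplus>\<^bsub>vmod V y\<^esub>p\<in>{p. a p \<noteq> \<zero>\<^bsub>K\<^esub> \<and> last p = y}.
        a p \<odot>\<^bsub>vmod V y\<^esub> path_map V p (v (hd p)))"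

definition annihilated_by ::
    "('k, 'r) ring_scheme \<Rightarrow> 'v pair_pre_digraph \<Rightarrow> ('v list \<Rightarrow> 'k) set
      \<Rightarrow> ('v, 'k, 'm) vertex_family \<Rightarrow> bool" where
  "annihilated_by K G I V \<longleftrightarrow>
    (\<forall>v\<in>rep_module_carrier G V. \<forall>a\<in>I. rep_act K G V v a = (\<lambda>y\<in>pverts G. \<zero>\<^bsub>vmod V y\<^esub>))"

definition GrRep ::
    "('k, 'r) ring_scheme \<Rightarrow> 'v pair_pre_digraph \<Rightarrow> ('v list \<Rightarrow> 'k) set
      \<Rightarrow> (('v, 'k, 'm) vertex_family, 'v \<Rightarrow> 'm \<Rightarrow> 'm) category" where
  "GrRep K G I =
    full_subcategory (family_category K G (parcs G) {V. graded_rep K G V}) (annihilated_by K G I)"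

end

theory Submission
  imports Defs
begin

text \<open>Sending a shortest path to its pair of end points, and every other path to zero, extends
  linearly to a surjective homomorphism \<open>\<pi>\<close> of graded algebras from the path algebra to the distance
  algebra: a concatenation \<open>p q\<close> is shortest iff \<open>p\<close> and \<open>q\<close> are shortest and the junction lies
  between the end points.  Choosing a shortest path for each pair gives a linear section \<open>\<sigma>\<close>, and
  checking on basis elements that \<open>a - \<sigma> (\<pi> a)\<close> is in the relation ideal for all \<open>a\<close> shows that
  this ideal is the kernel of \<open>\<pi>\<close>.  It contains all long paths, because the lengths of shortest
  paths in a finite digraph are bounded.  A distance module restricts to a representation on which
  \<open>a\<close> and \<open>\<sigma> (\<pi> a)\<close> act in the same way, so the kernel of \<open>\<pi>\<close> acts by zero; conversely, in an
  annihilated representation the maps along shortest paths depend on the end points only and form a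
  distance module.  These two constructions are strictly inverse to each other.\<close>


section \<open>Shortest paths\<close>

text \<open>Both algebras are instances of one construction: a free module over an arbitrary
  commutative ring whose basis carries a partial product. Identities are reduced to monomials by
  induction on the finite support. Describing \<open>R\<close> as a kernel gives more than the
  isomorphism. \<open>R\<close> is generated as a two-sided ideal, so checking annihilation on
  generators would require the action of the path algebra to be multiplicative; through the kernel,
  additivity of the action is enough. The grading of the quotient is not built from a decomposition
  of \<open>R\<close> into homogeneous parts: since \<open>\<pi>\<close> and \<open>\<sigma>\<close>
  preserve degrees, it is transported from the distance algebra. The inclusion of \<open>R\<close>
  in the square of \<open>J\<close> rests on the absence of loops: trivial paths and arrows are
  shortest and determined by their end points, so only paths of length at least two occur in the
  generating relations. Both functors keep the vertex modules and the morphisms, so everything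
  categorical reduces to comparing the structure maps.\<close>

lemma singleton_mem_paths [simp]: "[x] \<in> paths G \<longleftrightarrow> x \<in> pverts G"
  by (auto simp: paths_def vwalk_def)

lemma Nil_notin_paths [simp]: "[] \<notin> paths G"
  by (simp add: paths_def vwalk_def)

lemma paths_not_Nil: "p \<in> paths G \<Longrightarrow> p \<noteq> []"
  by (auto simp: paths_def vwalk_def)

lemma hd_mem_pverts: "p \<in> paths G \<Longrightarrow> hd p \<in> pverts G"
  and last_mem_pverts: "p \<in> paths G \<Longrightarrow> last p \<in> pverts G"
  by (auto simp: paths_def vwalk_def)

lemma vwalk_join_mem_paths:
  "p \<in> paths G \<Longrightarrow> q \<in> paths G \<Longrightarrow> joinable p q \<Longrightarrow> vwalk_join p q \<in> paths G"
  by (auto simp: paths_def intro: vwalk_joinI_vwalk)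

lemma joinable_paths_iff:
  "p \<in> paths G \<Longrightarrow> q \<in> paths G \<Longrightarrow> joinable p q \<longleftrightarrow> last p = hd q"
  by (auto simp: joinable_def)

lemma gdist_le: "p \<in> paths G \<Longrightarrow> gdist G (hd p) (last p) \<le> enat (vwalk_length p)"
  unfolding gdist_def by (rule INF_lower) auto

lemma gdist_ge: "p \<in> paths G \<Longrightarrow> shortest G q \<Longrightarrow> hd p = hd q \<Longrightarrow> last p = last q \<Longrightarrow>
    vwalk_length q \<le> vwalk_length p"
  using gdist_le[of p G] by (metis enat_ord_simps(1) shortest_def)

lemma ex_shortest:
  assumes "gdist G x y < \<infinity>"
  obtains p where "shortest G p" "hd p = x" "last p = y"
proof -
  let ?S = "(\<lambda>p. enat (vwalk_length p)) ` {p \<in> paths G. hd p = x \<and> last p = y}"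
  \<comment> \<open>The infimum of the empty set is infinite, so a finite distance supplies some
    path.\<close>
  have "?S \<noteq> {}"
  proof
    assume "?S = {}"
    then have "gdist G x y = Inf {}" unfolding gdist_def by (rule arg_cong)
    then show False using assms by (simp add: Inf_enat_def)
  qed
  \<comment> \<open>In \<open>enat\<close> the infimum of a non-empty set is its least element,
    hence attained.\<close>
  then have "Inf ?S \<in> ?S"
    by (auto simp: Inf_enat_def simp del: vwalk_length_simp intro: LeastI)
  then show ?thesis
    using that by (auto simp: gdist_def shortest_def simp del: vwalk_length_simp)
qed

lemma gdist_hd_last_finite: "p \<in> paths G \<Longrightarrow> gdist G (hd p) (last p) < \<infinity>"
  using gdist_le[of p G] by (auto dest: enat_ile simp del: vwalk_length_simp)

lemma finite_dist_pairs_iff: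
  "(x, y) \<in> finite_dist_pairs G \<longleftrightarrow> (\<exists>p. shortest G p \<and> hd p = x \<and> last p = y)"
proof
  assume "(x, y) \<in> finite_dist_pairs G"
  then show "\<exists>p. shortest G p \<and> hd p = x \<and> last p = y"
    by (metis (no_types, lifting) ex_shortest finite_dist_pairs_def mem_Collect_eq case_prodD)
next
  assume "\<exists>p. shortest G p \<and> hd p = x \<and> last p = y"
  then show "(x, y) \<in> finite_dist_pairs G"
    unfolding finite_dist_pairs_def shortest_def
    using gdist_hd_last_finite hd_mem_pverts last_mem_pverts by fastforce
qed

lemma shortest_paths: "shortest G p \<Longrightarrow> p \<in> paths G"
  by (simp add: shortest_def)

lemma path_finite_dist_pairs: "p \<in> paths G \<Longrightarrow> (hd p, last p) \<in> finite_dist_pairs G"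
  unfolding finite_dist_pairs_def
  using gdist_hd_last_finite hd_mem_pverts last_mem_pverts by fastforce

lemma shortest_length: "shortest G p \<Longrightarrow> the_enat (gdist G (hd p) (last p)) = vwalk_length p"
  unfolding shortest_def by (metis the_enat.simps)

lemma finite_dist_pairs_enat:
  "(x, y) \<in> finite_dist_pairs G \<Longrightarrow> enat (the_enat (gdist G x y)) = gdist G x y"
  by (auto simp: finite_dist_pairs_def)

lemma shortest_singleton: "x \<in> pverts G \<Longrightarrow> shortest G [x]"
  using gdist_le[of "[x]" G] by (simp add: shortest_def flip: zero_enat_def)

lemma gdist_self: "x \<in> pverts G \<Longrightarrow> gdist G x x = 0"
  using shortest_singleton[of x G] by (simp add: shortest_def zero_enat_def)

text \<open>Shortest paths from \<open>x\<close> to \<open>y\<close> and from \<open>y\<close> to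
  \<open>z\<close> concatenate to a path that competes in the infimum for \<open>x\<close> and
  \<open>z\<close>.\<close>

lemma gdist_triangle:
  assumes "(x, y) \<in> finite_dist_pairs G" "(y, z) \<in> finite_dist_pairs G"
  shows "gdist G x z \<le> gdist G x y + gdist G y z"
proof -
  obtain p q where p: "shortest G p" "hd p = x" "last p = y" and q: "shortest G q" "hd q = y" "last q = z"
    using assms by (metis finite_dist_pairs_iff)
  have j: "joinable p q"
    using p q shortest_paths[of G p] shortest_paths[of G q] by (auto simp: joinable_def)
  have "gdist G (hd (vwalk_join p q)) (last (vwalk_join p q)) \<le> enat (vwalk_length (vwalk_join p q))"
    by (rule gdist_le) (use p q j in \<open>auto intro: vwalk_join_mem_paths shortest_paths\<close>)
  also have "\<dots> = enat (vwalk_length p) + enat (vwalk_length q)"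
    using j by (metis plus_enat_simps(1) vwalk_join_vwalk_length)
  finally show ?thesis
    using p q j
    by (simp add: shortest_def vwalk_join_hd vwalk_join_last del: vwalk_length_simp plus_enat_simps)
qed

lemma finite_dist_pairs_trans:
  assumes "(x, y) \<in> finite_dist_pairs G" "(y, z) \<in> finite_dist_pairs G"
  shows "(x, z) \<in> finite_dist_pairs G"
  using gdist_triangle[OF assms] assms
  by (auto simp: finite_dist_pairs_def dest: enat_ile)

text \<open>By the triangle inequality, each side says that the three successive distances add up to
  the distance from \<open>x\<close> to \<open>w\<close>. This is the associativity of the distance
  algebra.\<close>

lemma between_assoc:
  assumes "(x, y) \<in> finite_dist_pairs G" "(y, z) \<in> finite_dist_pairs G" "(z, w) \<in> finite_dist_pairs G"
  shows "between G x y z \<and> between G x z w \<longleftrightarrow> between G y z w \<and> between G x y w"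
proof -
  have fin: "(x, z) \<in> finite_dist_pairs G" "(y, w) \<in> finite_dist_pairs G" "(x, w) \<in> finite_dist_pairs G"
    using assms finite_dist_pairs_trans by metis+
  obtain xy yz zw xz yw xw where d: "gdist G x y = enat xy" "gdist G y z = enat yz" "gdist G z w = enat zw"
    "gdist G x z = enat xz" "gdist G y w = enat yw" "gdist G x w = enat xw"
    using assms fin finite_dist_pairs_enat by metis
  show ?thesis
    using gdist_triangle[OF assms(1,2)] gdist_triangle[OF assms(2,3)]
      gdist_triangle[OF fin(1) assms(3)] gdist_triangle[OF assms(1) fin(2)]
    by (auto simp: between_def d)
qed

text \<open>With \<open>a\<close>, \<open>b\<close>, \<open>c\<close> the distances between the ends
  of \<open>p\<close>, of \<open>q\<close> and of the joined path, the length of the latter is at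
  least \<open>a + b\<close>, which is at least \<open>c\<close>. It equals \<open>c\<close> iff
  both inequalities are equalities.\<close>

lemma shortest_vwalk_join_iff:
  assumes "p \<in> paths G" "q \<in> paths G" "joinable p q"
  shows "shortest G (vwalk_join p q) \<longleftrightarrow>
    shortest G p \<and> shortest G q \<and> between G (hd p) (last p) (last q)"
proof -
  have eq: "last p = hd q" using assms by (simp add: joinable_def)
  obtain a b where a: "gdist G (hd p) (last p) = enat a" and b: "gdist G (hd q) (last q) = enat b"
    using gdist_hd_last_finite assms(1,2) by (metis less_infinityE)
  have le: "a \<le> vwalk_length p" "b \<le> vwalk_length q"
    using gdist_le[OF assms(1)] gdist_le[OF assms(2)] a b by (simp_all del: vwalk_length_simp)
  have "gdist G (hd p) (last q) \<le> enat (a + b)"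
    using gdist_triangle[OF path_finite_dist_pairs[OF assms(1)]] path_finite_dist_pairs[OF assms(2)] a b eq
    by fastforce
  then obtain c where c: "gdist G (hd p) (last q) = enat c" "c \<le> a + b"
    by (metis enat_ile enat_ord_simps(1))
  have "shortest G (vwalk_join p q) \<longleftrightarrow> vwalk_length p + vwalk_length q = c"
    using assms c by (simp add: shortest_def vwalk_join_hd vwalk_join_last vwalk_join_mem_paths
        del: vwalk_length_simp)
  moreover have "shortest G p \<longleftrightarrow> vwalk_length p = a" "shortest G q \<longleftrightarrow> vwalk_length q = b"
    using assms a b by (simp_all add: shortest_def del: vwalk_length_simp)
  moreover have "between G (hd p) (last p) (last q) \<longleftrightarrow> a + b = c"
    using a b c eq by (simp add: between_def)
  ultimately show ?thesis
    using \<open>c \<le> a + b\<close> le by linarith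
qed

lemma paths_Cons: "x # y # xs \<in> paths G \<Longrightarrow> (x, y) \<in> parcs G \<and> y # xs \<in> paths G"
  by (auto simp: paths_def vwalk_def)

lemma path_length_0:
  assumes "p \<in> paths G" "vwalk_length p = 0"
  shows "p = [hd p]"
  using assms(2) paths_not_Nil[OF assms(1)] by (cases p) auto

text \<open>Together with \<open>path_length_0\<close>: a path of length at most one is determined
  by its end points, so two different shortest paths with the same ends are longer.\<close>

lemma path_length_1:
  assumes "p \<in> paths G" "vwalk_length p = 1"
  shows "p = [hd p, last p]"
proof -
  obtain x ys where "p = x # ys" using paths_not_Nil[OF assms(1)] by (cases p) auto
  with assms(2) show ?thesis by (cases ys) auto
qed

text \<open>Splitting off the first arrow gives the factorisation that places paths of length at
  least two in the square of the arrow ideal.\<close>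

lemma path_split_first:
  assumes "p \<in> paths G" "vwalk_length p > 0"
  obtains q where "vwalk_join [hd p, hd q] q = p" "q \<in> paths G" "[hd p, hd q] \<in> paths G"
    "joinable [hd p, hd q] q" "last q = last p" "vwalk_length p = Suc (vwalk_length q)"
proof -
  obtain x ys where "p = x # ys" using paths_not_Nil[OF assms(1)] by (cases p) auto
  then obtain y xs where p: "p = x # y # xs" using assms(2) by (cases ys) auto
  with assms show ?thesis
    by (intro that[of "y # xs"]) (auto simp: paths_def vwalk_def vwalk_join_def)
qed

section \<open>Distances in a finite digraph without loops\<close>

context pair_digraph
begin

lemma arc_mem_paths: "(x, y) \<in> parcs G \<Longrightarrow> [x, y] \<in> paths G"
  by (auto simp: paths_def vwalk_def dest: in_arcsD1 in_arcsD2)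

text \<open>The arrow bounds the distance by one, and a path of length zero would make it a loop.
  Hence the structure map of a distance module along an arrow has degree one.\<close>

lemma gdist_arc: assumes "(x, y) \<in> parcs G" shows "gdist G x y = 1"
proof -
  obtain p where p: "shortest G p" "hd p = x" "last p = y"
    using path_finite_dist_pairs[OF arc_mem_paths[OF assms]] by (auto simp: finite_dist_pairs_iff)
  have "vwalk_length p \<noteq> 0"
    using path_length_0[of p] p shortest_paths no_loops'[OF assms] by (metis last.simps)
  then have "vwalk_length p = 1"
    using gdist_ge[OF arc_mem_paths[OF assms] p(1)] p by simp
  then show ?thesis
    using p by (simp add: shortest_def one_enat_def del: vwalk_length_simp)
qed

lemma shortest_arc: "(x, y) \<in> parcs G \<Longrightarrow> shortest G [x, y]"
  by (simp add: shortest_def arc_mem_paths gdist_arc one_enat_def)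

lemma parcs_subset_finite_dist_pairs: "parcs G \<subseteq> finite_dist_pairs G"
  using arc_mem_paths path_finite_dist_pairs by fastforce

text \<open>Its contrapositive is what is used: relations of the second kind only involve paths of
  length at least two.\<close>

lemma shortest_of_length_le_1:
  assumes "p \<in> paths G" "vwalk_length p \<le> 1"
  shows "shortest G p"
proof (cases "vwalk_length p = 0")
  case True
  then show ?thesis
    using shortest_singleton path_length_0[OF assms(1)] hd_mem_pverts[OF assms(1)] by metis
next
  case False
  then have "p = [hd p, last p]" using path_length_1[OF assms(1)] assms(2) by linarith
  then have "[hd p, last p] \<in> paths G" using assms by simp
  then show ?thesis
    using shortest_arc paths_Cons \<open>p = _\<close> by metis
qed

lemma finite_finite_dist_pairs: "finite (finite_dist_pairs G)"
  by (rule finite_subset[of _ "pverts G \<times> pverts G"]) (auto simp: finite_dist_pairs_def)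

text \<open>Each such length is the distance of one of finitely many pairs. Any strict bound will
  serve as the exponent in admissibility.\<close>

lemma shortest_length_bound: "\<exists>n. \<forall>p. shortest G p \<longrightarrow> vwalk_length p < n"
proof -
  let ?D = "(\<lambda>(x, y). the_enat (gdist G x y)) ` finite_dist_pairs G"
  have "vwalk_length p < Suc (Max ?D)" if "shortest G p" for p
  proof -
    have "vwalk_length p \<in> ?D"
      using shortest_length[OF that] path_finite_dist_pairs[OF shortest_paths[OF that]]
      by (metis (mono_tags, lifting) case_prod_conv imageI)
    then show ?thesis
      using finite_finite_dist_pairs by (simp add: less_Suc_eq_le del: vwalk_length_simp)
  qed
  then show ?thesis by blast
qed

end


section \<open>Algebras with a basis\<close>

text \<open>A term with its coefficient as a single function, so that products and inductions can be
  stated without \<open>smult\<close>. The coefficient may be zero.\<close>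

definition monomial :: "('k, 'r) ring_scheme \<Rightarrow> 'k \<Rightarrow> 'b \<Rightarrow> 'b \<Rightarrow> 'k" where
  "monomial K a p = (\<lambda>q. if q = p then a else \<zero>\<^bsub>K\<^esub>)"

lemma basis_elt_eq_monomial: "basis_elt K p = monomial K \<one>\<^bsub>K\<^esub> p"
  by (simp add: basis_elt_def monomial_def)

lemma monomial_same [simp]: "monomial K a p p = a"
  by (simp add: monomial_def)

abbreviation support :: "('k, 'r) ring_scheme \<Rightarrow> ('b \<Rightarrow> 'k) \<Rightarrow> 'b set" where
  "support K f \<equiv> {b. f b \<noteq> \<zero>\<^bsub>K\<^esub>}"

definition free_carrier :: "('k, 'r) ring_scheme \<Rightarrow> 'b set \<Rightarrow> ('b \<Rightarrow> 'k) set" where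
  "free_carrier K B = {f. (\<forall>b. f b \<in> carrier K) \<and> support K f \<subseteq> B \<and> finite (support K f)}"

lemma basis_algebra_sel:
  "carrier (basis_algebra K B deg bmul E) = free_carrier K B"
  "mult (basis_algebra K B deg bmul E) = (\<lambda>f g r. finsum K (\<lambda>(p, q). f p \<otimes>\<^bsub>K\<^esub> g q)
       {(p, q). f p \<noteq> \<zero>\<^bsub>K\<^esub> \<and> g q \<noteq> \<zero>\<^bsub>K\<^esub> \<and> bmul p q = Some r})"
  "one (basis_algebra K B deg bmul E) = (\<lambda>b. if b \<in> E then \<one>\<^bsub>K\<^esub> else \<zero>\<^bsub>K\<^esub>)"
  "zero (basis_algebra K B deg bmul E) = (\<lambda>b. \<zero>\<^bsub>K\<^esub>)"
  "add (basis_algebra K B deg bmul E) = (\<lambda>f g b. f b \<oplus>\<^bsub>K\<^esub> g b)"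
  "smult (basis_algebra K B deg bmul E) = (\<lambda>a f b. a \<otimes>\<^bsub>K\<^esub> f b)"
  "grade (basis_algebra K B deg bmul E) n =
    {f \<in> free_carrier K B. \<forall>b. f b \<noteq> \<zero>\<^bsub>K\<^esub> \<longrightarrow> int (deg b) = n}"
  by (auto simp: basis_algebra_def free_carrier_def Let_def)

text \<open>The sums defining products and actions run over supports, which change from one element
  to the next; this puts them on a common finite index set.\<close>

lemma (in abelian_monoid) finsum_superset:
  assumes "finite S" "T \<subseteq> S" "f \<in> T \<rightarrow> carrier G" "\<And>i. i \<in> S - T \<Longrightarrow> f i = \<zero>"
  shows "finsum G f T = finsum G f S"
proof (rule add.finprod_mono_neutral_cong_left)
  show "f \<in> S \<rightarrow> carrier G"
  proof
    fix x assume "x \<in> S"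
    then show "f x \<in> carrier G"
      using assms(3) assms(4)[of x] by (cases "x \<in> T") auto
  qed
qed (use assms in auto)

text \<open>Collects what concerns the module structure and distributivity;
  \<open>based_algebra\<close> adds the laws of the product. The section \<open>\<sigma>\<close>,
  which is only linear, lives at this level.\<close>

locale based_module = cring K for K :: "('k, 'r) ring_scheme" (structure) +
  fixes B :: "'b set" and deg :: "'b \<Rightarrow> nat" and bmul :: "'b \<Rightarrow> 'b \<Rightarrow> 'b option" and E :: "'b set"
begin

abbreviation A where "A \<equiv> basis_algebra K B deg bmul E"
abbreviation mono where "mono \<equiv> monomial K"

lemma carrier_iff:
  "f \<in> carrier A \<longleftrightarrow> (\<forall>b. f b \<in> carrier K) \<and> support K f \<subseteq> B \<and> finite (support K f)"
  by (simp add: basis_algebra_sel free_carrier_def)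

lemma carrier_coeff: "f \<in> carrier A \<Longrightarrow> f b \<in> carrier K"
  and carrier_support: "f \<in> carrier A \<Longrightarrow> support K f \<subseteq> B"
  and carrier_finite: "f \<in> carrier A \<Longrightarrow> finite (support K f)"
  by (auto simp: carrier_iff)

lemma carrierI:
  assumes "\<And>b. f b \<in> carrier K" "finite S" "S \<subseteq> B" "\<And>b. b \<notin> S \<Longrightarrow> f b = \<zero>"
  shows "f \<in> carrier A"
  using assms by (auto simp: carrier_iff intro: finite_subset[of _ S])

lemma add_eq: "f \<oplus>\<^bsub>A\<^esub> g = (\<lambda>b. f b \<oplus> g b)"
  and zero_eq: "\<zero>\<^bsub>A\<^esub> = (\<lambda>b. \<zero>)"
  and smult_eq: "a \<odot>\<^bsub>A\<^esub> f = (\<lambda>b. a \<otimes> f b)"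
  by (simp_all add: basis_algebra_sel)

lemma add_apply: "(f \<oplus>\<^bsub>A\<^esub> g) b = f b \<oplus> g b"
  and zero_apply: "\<zero>\<^bsub>A\<^esub> b = \<zero>"
  and smult_apply: "(a \<odot>\<^bsub>A\<^esub> f) b = a \<otimes> f b"
  by (simp_all add: basis_algebra_sel)

lemmas coeff_simps = add_apply zero_apply smult_apply

lemma add_carrier: "f \<in> carrier A \<Longrightarrow> g \<in> carrier A \<Longrightarrow> f \<oplus>\<^bsub>A\<^esub> g \<in> carrier A"
  by (rule carrierI[of _ "support K f \<union> support K g"]) (auto simp: add_eq carrier_iff)

lemma smult_carrier: "a \<in> carrier K \<Longrightarrow> f \<in> carrier A \<Longrightarrow> a \<odot>\<^bsub>A\<^esub> f \<in> carrier A"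
  by (rule carrierI[of _ "support K f"]) (auto simp: smult_eq carrier_iff)

lemma zero_carrier: "\<zero>\<^bsub>A\<^esub> \<in> carrier A"
  by (rule carrierI[of _ "{}"]) (auto simp: zero_eq)

lemma monomial_carrier: "a \<in> carrier K \<Longrightarrow> p \<in> B \<Longrightarrow> mono a p \<in> carrier A"
  by (rule carrierI[of _ "{p}"]) (auto simp: monomial_def)

lemma support_monomial: "mono a p q \<noteq> \<zero> \<Longrightarrow> q = p"
  by (auto simp: monomial_def split: if_splits)

lemma smult_monomial: "a \<in> carrier K \<Longrightarrow> a \<odot>\<^bsub>A\<^esub> mono b p = mono (a \<otimes> b) p"
  by (auto simp: smult_eq monomial_def)

lemma abelian_group_A: "abelian_group A"
proof (rule abelian_groupI)
  fix f assume f: "f \<in> carrier A"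
  have "(\<lambda>b. \<ominus> f b) \<in> carrier A"
    by (rule carrierI[of _ "support K f"]) (use f in \<open>auto simp: carrier_iff\<close>)
  moreover have "(\<lambda>b. \<ominus> f b) \<oplus>\<^bsub>A\<^esub> f = \<zero>\<^bsub>A\<^esub>"
    using f by (auto simp: add_eq zero_eq carrier_coeff l_neg)
  ultimately show "\<exists>g\<in>carrier A. g \<oplus>\<^bsub>A\<^esub> f = \<zero>\<^bsub>A\<^esub>" by blast
qed (auto simp: add_carrier zero_carrier fun_eq_iff carrier_coeff a_ac coeff_simps)

lemma module_A: "Module.module K A"
  by (rule moduleI)
    (auto simp: cring_axioms abelian_group_A smult_carrier fun_eq_iff carrier_coeff coeff_simps
      l_distr r_distr m_assoc)

sublocale Alg: Module.module K A
  by (rule module_A)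

lemma a_inv_eq: "f \<in> carrier A \<Longrightarrow> \<ominus>\<^bsub>A\<^esub> f = (\<lambda>b. \<ominus> f b)"
proof -
  assume f: "f \<in> carrier A"
  have "(\<lambda>b. \<ominus> f b) \<in> carrier A"
    by (rule carrierI[of _ "support K f"]) (use f in \<open>auto simp: carrier_iff\<close>)
  then show ?thesis
    using f by (intro Alg.minus_equality) (auto simp: add_eq zero_eq carrier_coeff l_neg)
qed

text \<open>Induction on the finite support, deleting one coefficient at a time. It reduces additive
  statements to monomials.\<close>

lemma basis_induct [consumes 1, case_names zero add]:
  assumes "f \<in> carrier A" "P \<zero>\<^bsub>A\<^esub>"
    and step: "\<And>a p f. a \<in> carrier K \<Longrightarrow> p \<in> B \<Longrightarrow> f \<in> carrier A \<Longrightarrow> P f \<Longrightarrow> P (mono a p \<oplus>\<^bsub>A\<^esub> f)"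
  shows "P f"
proof -
  have "P f" if "finite S" "f \<in> carrier A" "support K f = S" for S f
    using that
  proof (induction S arbitrary: f rule: finite_induct)
    case empty
    then have "f = \<zero>\<^bsub>A\<^esub>" by (auto simp: zero_eq)
    then show ?case using assms(2) by simp
  next
    case (insert p S)
    let ?g = "f(p := \<zero>)"
    have "support K ?g = S" using insert.hyps insert.prems(2) by auto
    moreover have g: "?g \<in> carrier A"
      by (rule carrierI[of _ "support K f"]) (use insert.prems in \<open>auto simp: carrier_iff\<close>)
    ultimately have "P ?g" by (rule insert.IH[rotated])
    moreover have "f p \<in> carrier K" "p \<in> B"
      using insert.prems by (auto simp: carrier_iff)
    ultimately have "P (mono (f p) p \<oplus>\<^bsub>A\<^esub> ?g)"
      using g by (intro step)
    also have "mono (f p) p \<oplus>\<^bsub>A\<^esub> ?g = f"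
      using carrier_coeff[OF insert.prems(1)] by (auto simp: monomial_def add_apply)
    finally show ?case .
  qed
  then show ?thesis using assms(1) carrier_finite by blast
qed

lemma finsum_coeff:
  assumes "finite S" "F \<in> S \<rightarrow> carrier A"
  shows "(finsum A F S) b = (\<Oplus>i\<in>S. F i b)"
  using assms
proof (induction S rule: finite_induct)
  case empty
  then show ?case by (simp add: zero_eq)
next
  case (insert i S)
  then have "(\<lambda>i. F i b) \<in> S \<rightarrow> carrier K" "F i b \<in> carrier K"
    by (auto simp: Pi_iff carrier_coeff)
  with insert show ?case by (simp add: add_eq Pi_iff)
qed

lemma grade_iff: "f \<in> grade A n \<longleftrightarrow> f \<in> carrier A \<and> (\<forall>b. f b \<noteq> \<zero> \<longrightarrow> int (deg b) = n)"
  by (simp add: basis_algebra_sel)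

section \<open>The grading by degrees of basis elements\<close>

lemma graded_module_A: "graded_module K A"
proof (rule graded_module.intro[OF module_A graded_module_axioms.intro])
  fix n show "submodule (grade A n) K A"
  proof (rule Alg.submoduleI)
    show "grade A n \<subseteq> carrier A" by (auto simp: grade_iff)
    show "\<zero>\<^bsub>A\<^esub> \<in> grade A n" using zero_carrier by (simp add: grade_iff zero_eq)
    show "\<ominus>\<^bsub>A\<^esub> f \<in> grade A n" if "f \<in> grade A n" for f
    proof -
      have "int (deg b) = n" if "\<ominus> f b \<noteq> \<zero>" for b
        using that \<open>f \<in> grade A n\<close> by (cases "f b = \<zero>") (auto simp: grade_iff)
      then show ?thesis
        using that Alg.a_inv_closed[of f] by (simp add: grade_iff a_inv_eq)
    qed
    show "f \<oplus>\<^bsub>A\<^esub> g \<in> grade A n" if "f \<in> grade A n" "g \<in> grade A n" for f g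
    proof -
      have "int (deg b) = n" if "f b \<oplus> g b \<noteq> \<zero>" for b
        using that \<open>f \<in> grade A n\<close> \<open>g \<in> grade A n\<close> by (cases "f b = \<zero>") (auto simp: grade_iff carrier_coeff)
      then show ?thesis
        using that add_carrier[of f g] by (simp add: grade_iff add_apply)
    qed
    show "a \<odot>\<^bsub>A\<^esub> f \<in> grade A n" if "a \<in> carrier K" "f \<in> grade A n" for a f
    proof -
      have "int (deg b) = n" if "a \<otimes> f b \<noteq> \<zero>" for b
        using that \<open>a \<in> carrier K\<close> \<open>f \<in> grade A n\<close> by (cases "f b = \<zero>") (auto simp: grade_iff)
      then show ?thesis
        using that smult_carrier[of a f] by (simp add: grade_iff smult_apply)
    qed
  qed
next
  fix f assume f: "f \<in> carrier A"
  \<comment> \<open>The candidate component of degree \<open>n\<close>: the part of \<open>f\<close>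
    on basis elements of that degree.\<close>
  define c0 where "c0 n = (\<lambda>b. if int (deg b) = n then f b else \<zero>)" for n
  have c0: "c0 n \<in> grade A n" for n
  proof -
    have "c0 n \<in> carrier A"
      by (rule carrierI[of _ "support K f"]) (use f in \<open>auto simp: carrier_iff c0_def\<close>)
    then show ?thesis by (auto simp: grade_iff c0_def)
  qed
  have fin: "finite {n. c0 n \<noteq> \<zero>\<^bsub>A\<^esub>}"
  proof (rule finite_subset)
    show "finite ((\<lambda>b. int (deg b)) ` support K f)" using carrier_finite[OF f] by simp
    show "{n. c0 n \<noteq> \<zero>\<^bsub>A\<^esub>} \<subseteq> (\<lambda>b. int (deg b)) ` support K f"
      by (auto simp: c0_def zero_eq fun_eq_iff split: if_splits)
  qed
  \<comment> \<open>In any decomposition, only the component of degree \<open>deg b\<close> can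
    contribute at \<open>b\<close>. This yields both existence and uniqueness.\<close>
  have coeff: "(\<Oplus>\<^bsub>A\<^esub>n\<in>{n. c n \<noteq> \<zero>\<^bsub>A\<^esub>}. c n) b = c (int (deg b)) b"
    if c: "\<forall>n. c n \<in> grade A n" "finite {n. c n \<noteq> \<zero>\<^bsub>A\<^esub>}" for c b
  proof -
    have carr: "c n b \<in> carrier K" for n using c(1) by (auto simp: grade_iff carrier_coeff)
    \<comment> \<open>The degree of \<open>b\<close> is inserted because \<open>c\<close> may vanish
      there and then leave it out of the index set.\<close>
    let ?S = "insert (int (deg b)) {n. c n \<noteq> \<zero>\<^bsub>A\<^esub>}"
    have "(\<Oplus>\<^bsub>A\<^esub>n\<in>{n. c n \<noteq> \<zero>\<^bsub>A\<^esub>}. c n) b = (\<Oplus>n\<in>{n. c n \<noteq> \<zero>\<^bsub>A\<^esub>}. c n b)"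
      using c by (intro finsum_coeff) (auto simp: grade_iff)
    also have "\<dots> = (\<Oplus>n\<in>?S. c n b)"
      using c carr by (intro finsum_superset) (auto simp: zero_eq)
    also have "\<dots> = (\<Oplus>n\<in>{int (deg b)}. c n b)"
      using c carr by (intro finsum_superset[symmetric]) (auto simp: grade_iff)
    also have "\<dots> = c (int (deg b)) b" using carr by simp
    finally show ?thesis .
  qed
  show "\<exists>!c. (\<forall>n. c n \<in> grade A n) \<and> finite {n. c n \<noteq> \<zero>\<^bsub>A\<^esub>} \<and>
      f = (\<Oplus>\<^bsub>A\<^esub>n\<in>{n. c n \<noteq> \<zero>\<^bsub>A\<^esub>}. c n)"
  proof (rule ex1I[of _ c0])
    have "f = (\<Oplus>\<^bsub>A\<^esub>n\<in>{n. c0 n \<noteq> \<zero>\<^bsub>A\<^esub>}. c0 n)"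
      using coeff[of c0] c0 fin by (auto simp: fun_eq_iff c0_def)
    then show "(\<forall>n. c0 n \<in> grade A n) \<and> finite {n. c0 n \<noteq> \<zero>\<^bsub>A\<^esub>} \<and>
      f = (\<Oplus>\<^bsub>A\<^esub>n\<in>{n. c0 n \<noteq> \<zero>\<^bsub>A\<^esub>}. c0 n)" using c0 fin by blast
  next
    fix c assume c: "(\<forall>n. c n \<in> grade A n) \<and> finite {n. c n \<noteq> \<zero>\<^bsub>A\<^esub>} \<and>
      f = (\<Oplus>\<^bsub>A\<^esub>n\<in>{n. c n \<noteq> \<zero>\<^bsub>A\<^esub>}. c n)"
    then have fb: "f b = c (int (deg b)) b" for b
      using coeff[of c b] by simp
    show "c = c0"
    proof (intro ext)
      fix n b
      show "c n b = c0 n b"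
        using c fb by (cases "int (deg b) = n") (auto simp: c0_def grade_iff)
    qed
  qed
qed

text \<open>The support of a sum can be smaller than the union of the supports, so comparing
  products needs one rectangle \<open>P \<times> Q\<close> for all of them.\<close>

lemma mult_superset:
  assumes f: "f \<in> carrier A" and g: "g \<in> carrier A"
    and P: "finite P" "support K f \<subseteq> P" and Q: "finite Q" "support K g \<subseteq> Q"
  shows "(f \<otimes>\<^bsub>A\<^esub> g) r = finsum K (\<lambda>(p, q). f p \<otimes> g q) {(p, q) \<in> P \<times> Q. bmul p q = Some r}"
  unfolding basis_algebra_sel
proof (rule finsum_superset)
  show "finite {(p, q) \<in> P \<times> Q. bmul p q = Some r}"
    by (rule finite_subset[of _ "P \<times> Q"]) (use P Q in auto)
qed (use f g P Q in \<open>auto simp: carrier_coeff\<close>)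

lemma mult_add_left:
  assumes "f \<in> carrier A" "g \<in> carrier A" "h \<in> carrier A"
  shows "(f \<oplus>\<^bsub>A\<^esub> g) \<otimes>\<^bsub>A\<^esub> h = f \<otimes>\<^bsub>A\<^esub> h \<oplus>\<^bsub>A\<^esub> g \<otimes>\<^bsub>A\<^esub> h"
proof
  fix r
  let ?P = "support K f \<union> support K g" and ?Q = "support K h"
  let ?S = "{(p, q) \<in> ?P \<times> ?Q. bmul p q = Some r}"
  have fin: "finite ?P" "finite ?Q" using assms by (auto simp: carrier_finite)
  have "((f \<oplus>\<^bsub>A\<^esub> g) \<otimes>\<^bsub>A\<^esub> h) r = finsum K (\<lambda>(p, q). (f \<oplus>\<^bsub>A\<^esub> g) p \<otimes> h q) ?S"
    by (rule mult_superset) (use assms fin in \<open>auto simp: add_carrier add_apply carrier_coeff\<close>)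
  also have "\<dots> = finsum K (\<lambda>x. (\<lambda>(p, q). f p \<otimes> h q) x \<oplus> (\<lambda>(p, q). g p \<otimes> h q) x) ?S"
    by (rule finsum_cong')
      (use assms in \<open>auto simp: carrier_coeff l_distr add_apply\<close>)
  also have "\<dots> = finsum K (\<lambda>(p, q). f p \<otimes> h q) ?S \<oplus> finsum K (\<lambda>(p, q). g p \<otimes> h q) ?S"
    by (rule finsum_addf) (use assms in \<open>auto simp: carrier_coeff\<close>)
  also have "\<dots> = (f \<otimes>\<^bsub>A\<^esub> h) r \<oplus> (g \<otimes>\<^bsub>A\<^esub> h) r"
    using assms fin by (intro arg_cong2[of _ _ _ _ "(\<oplus>)"] mult_superset[symmetric]) auto
  finally show "((f \<oplus>\<^bsub>A\<^esub> g) \<otimes>\<^bsub>A\<^esub> h) r = (f \<otimes>\<^bsub>A\<^esub> h \<oplus>\<^bsub>A\<^esub> g \<otimes>\<^bsub>A\<^esub> h) r"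
    by (simp only: add_apply)
qed

lemma mult_add_right:
  assumes "f \<in> carrier A" "g \<in> carrier A" "h \<in> carrier A"
  shows "h \<otimes>\<^bsub>A\<^esub> (f \<oplus>\<^bsub>A\<^esub> g) = h \<otimes>\<^bsub>A\<^esub> f \<oplus>\<^bsub>A\<^esub> h \<otimes>\<^bsub>A\<^esub> g"
proof
  fix r
  let ?P = "support K f \<union> support K g" and ?Q = "support K h"
  let ?S = "{(q, p) \<in> ?Q \<times> ?P. bmul q p = Some r}"
  have fin: "finite ?P" "finite ?Q" using assms by (auto simp: carrier_finite)
  have "(h \<otimes>\<^bsub>A\<^esub> (f \<oplus>\<^bsub>A\<^esub> g)) r = finsum K (\<lambda>(q, p). h q \<otimes> (f \<oplus>\<^bsub>A\<^esub> g) p) ?S"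
    by (rule mult_superset) (use assms fin in \<open>auto simp: add_carrier add_apply carrier_coeff\<close>)
  also have "\<dots> = finsum K (\<lambda>x. (\<lambda>(q, p). h q \<otimes> f p) x \<oplus> (\<lambda>(q, p). h q \<otimes> g p) x) ?S"
    by (rule finsum_cong')
      (use assms in \<open>auto simp: carrier_coeff r_distr add_apply\<close>)
  also have "\<dots> = finsum K (\<lambda>(q, p). h q \<otimes> f p) ?S \<oplus> finsum K (\<lambda>(q, p). h q \<otimes> g p) ?S"
    by (rule finsum_addf) (use assms in \<open>auto simp: carrier_coeff\<close>)
  also have "\<dots> = (h \<otimes>\<^bsub>A\<^esub> f) r \<oplus> (h \<otimes>\<^bsub>A\<^esub> g) r"
    using assms fin by (intro arg_cong2[of _ _ _ _ "(\<oplus>)"] mult_superset[symmetric]) auto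
  finally show "(h \<otimes>\<^bsub>A\<^esub> (f \<oplus>\<^bsub>A\<^esub> g)) r = (h \<otimes>\<^bsub>A\<^esub> f \<oplus>\<^bsub>A\<^esub> h \<otimes>\<^bsub>A\<^esub> g) r"
    by (simp only: add_apply)
qed

lemma mult_zero_left: "\<zero>\<^bsub>A\<^esub> \<otimes>\<^bsub>A\<^esub> f = \<zero>\<^bsub>A\<^esub>"
  and mult_zero_right: "f \<otimes>\<^bsub>A\<^esub> \<zero>\<^bsub>A\<^esub> = \<zero>\<^bsub>A\<^esub>"
  by (simp_all add: basis_algebra_sel)

lemma monomial_mult:
  assumes "a \<in> carrier K" "b \<in> carrier K" "p \<in> B" "q \<in> B"
  shows "mono a p \<otimes>\<^bsub>A\<^esub> mono b q =
    (case bmul p q of None \<Rightarrow> \<zero>\<^bsub>A\<^esub> | Some r \<Rightarrow> mono (a \<otimes> b) r)"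
proof
  fix r
  have "(mono a p \<otimes>\<^bsub>A\<^esub> mono b q) r =
      finsum K (\<lambda>(p', q'). mono a p p' \<otimes> mono b q q') {(p', q') \<in> {p} \<times> {q}. bmul p' q' = Some r}"
    by (rule mult_superset) (use assms in \<open>auto simp: monomial_carrier dest: support_monomial\<close>)
  also have "{(p', q') \<in> {p} \<times> {q}. bmul p' q' = Some r} = (if bmul p q = Some r then {(p, q)} else {})"
    by auto
  finally show "(mono a p \<otimes>\<^bsub>A\<^esub> mono b q) r =
      (case bmul p q of None \<Rightarrow> \<zero>\<^bsub>A\<^esub> | Some r \<Rightarrow> mono (a \<otimes> b) r) r"
    using assms by (auto simp: zero_eq monomial_def split: option.splits)
qed

end

text \<open>\<open>None\<close> stands for a zero product, so the equation of the two
  \<open>Option.bind\<close> terms also compares vanishing products. The unit laws say that exactly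
  one summand of the unit survives next to each basis element.\<close>

locale based_algebra = based_module +
  assumes bmul_closed: "p \<in> B \<Longrightarrow> q \<in> B \<Longrightarrow> bmul p q = Some r \<Longrightarrow> r \<in> B"
    and bmul_assoc: "p \<in> B \<Longrightarrow> q \<in> B \<Longrightarrow> r \<in> B \<Longrightarrow>
      Option.bind (bmul p q) (\<lambda>s. bmul s r) = Option.bind (bmul q r) (\<lambda>s. bmul p s)"
    and deg_bmul: "p \<in> B \<Longrightarrow> q \<in> B \<Longrightarrow> bmul p q = Some r \<Longrightarrow> deg r = deg p + deg q"
    and units_closed: "E \<subseteq> B" and units_finite: "finite E" and deg_unit: "e \<in> E \<Longrightarrow> deg e = 0"
    and bmul_unit_left: "q \<in> B \<Longrightarrow> \<exists>e\<in>E. bmul e q = Some q \<and> (\<forall>e'\<in>E - {e}. bmul e' q = None)"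
    and bmul_unit_right: "q \<in> B \<Longrightarrow> \<exists>e\<in>E. bmul q e = Some q \<and> (\<forall>e'\<in>E - {e}. bmul q e' = None)"
begin

lemma monomial_mult_carrier:
  "a \<in> carrier K \<Longrightarrow> b \<in> carrier K \<Longrightarrow> p \<in> B \<Longrightarrow> q \<in> B \<Longrightarrow> mono a p \<otimes>\<^bsub>A\<^esub> mono b q \<in> carrier A"
  by (auto simp: monomial_mult zero_carrier intro: bmul_closed monomial_carrier split: option.splits)

lemma mult_carrier:
  assumes "f \<in> carrier A" "g \<in> carrier A"
  shows "f \<otimes>\<^bsub>A\<^esub> g \<in> carrier A"
  using assms(1)
proof (induction rule: basis_induct)
  case zero
  then show ?case by (simp add: mult_zero_left zero_carrier)
next
  case (add a p f)
  have "mono a p \<otimes>\<^bsub>A\<^esub> g \<in> carrier A"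
    using assms(2)
  proof (induction rule: basis_induct)
    case zero
    then show ?case by (simp add: mult_zero_right zero_carrier)
  next
    case (add b q g)
    then show ?case
      using \<open>a \<in> carrier K\<close> \<open>p \<in> B\<close>
      by (simp add: mult_add_right monomial_carrier monomial_mult_carrier add_carrier)
  qed
  then show ?case
    using add assms(2) by (simp add: mult_add_left monomial_carrier add_carrier)
qed

text \<open>Trilinearity reduces the law to monomials, where it is \<open>bmul_assoc\<close>. The
  steps \<open>mono3\<close>, \<open>mono2\<close> and \<open>mono1\<close> pass from monomials to
  general elements one argument at a time, from the right.\<close>

lemma mult_assoc_A:
  assumes "f \<in> carrier A" "g \<in> carrier A" "h \<in> carrier A"
  shows "(f \<otimes>\<^bsub>A\<^esub> g) \<otimes>\<^bsub>A\<^esub> h = f \<otimes>\<^bsub>A\<^esub> (g \<otimes>\<^bsub>A\<^esub> h)"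
proof -
  have mono3: "(mono a p \<otimes>\<^bsub>A\<^esub> mono b q) \<otimes>\<^bsub>A\<^esub> mono c r = mono a p \<otimes>\<^bsub>A\<^esub> (mono b q \<otimes>\<^bsub>A\<^esub> mono c r)"
    if "a \<in> carrier K" "b \<in> carrier K" "c \<in> carrier K" "p \<in> B" "q \<in> B" "r \<in> B" for a b c p q r
  proof -
    have closed: "s \<in> B" if "bmul p q = Some s \<or> bmul q r = Some s" for s
      using that bmul_closed \<open>p \<in> B\<close> \<open>q \<in> B\<close> \<open>r \<in> B\<close> by blast
    have assoc: "Option.bind (bmul p q) (\<lambda>s. bmul s r) = Option.bind (bmul q r) (\<lambda>s. bmul p s)"
      using that by (intro bmul_assoc)
    show ?thesis
    proof (cases "bmul p q")
      case None
      then show ?thesis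
        using that assoc closed
        by (cases "bmul q r") (simp_all add: monomial_mult mult_zero_left mult_zero_right)
    next
      case (Some s)
      then show ?thesis
        using that assoc closed
        by (cases "bmul q r") (simp_all add: monomial_mult mult_zero_left mult_zero_right m_assoc
              split: option.split)
    qed
  qed
  have mono2: "(mono a p \<otimes>\<^bsub>A\<^esub> mono b q) \<otimes>\<^bsub>A\<^esub> h = mono a p \<otimes>\<^bsub>A\<^esub> (mono b q \<otimes>\<^bsub>A\<^esub> h)"
    if "a \<in> carrier K" "b \<in> carrier K" "p \<in> B" "q \<in> B" for a b p q
    using assms(3)
    by (induction rule: basis_induct)
      (use that in \<open>simp_all add: mult_zero_right mult_add_right monomial_carrier mult_carrier mono3\<close>)
  have mono1: "(mono a p \<otimes>\<^bsub>A\<^esub> g) \<otimes>\<^bsub>A\<^esub> h = mono a p \<otimes>\<^bsub>A\<^esub> (g \<otimes>\<^bsub>A\<^esub> h)"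
    if "a \<in> carrier K" "p \<in> B" for a p
    using assms(2)
    by (induction rule: basis_induct)
      (use that assms(3) in \<open>simp_all add: mult_zero_left mult_zero_right mult_add_left mult_add_right
        monomial_carrier mult_carrier mono2\<close>)
  show ?thesis
    using assms(1)
    by (induction rule: basis_induct)
      (use assms(2,3) in \<open>simp_all add: mult_zero_left mult_add_left monomial_carrier mult_carrier mono1\<close>)
qed

lemma one_carrier: "\<one>\<^bsub>A\<^esub> \<in> carrier A"
  by (rule carrierI[of _ E]) (use units_closed units_finite in \<open>auto simp: basis_algebra_sel\<close>)

text \<open>Only an inclusion: over the zero ring the support is empty.\<close>

lemma one_support: "support K \<one>\<^bsub>A\<^esub> \<subseteq> E"
  by (auto simp: basis_algebra_sel)

lemma one_mult:
  assumes "f \<in> carrier A"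
  shows "\<one>\<^bsub>A\<^esub> \<otimes>\<^bsub>A\<^esub> f = f"
proof -
  have "\<one>\<^bsub>A\<^esub> \<otimes>\<^bsub>A\<^esub> mono b q = mono b q" if b: "b \<in> carrier K" and q: "q \<in> B" for b q
  proof
    fix r
    obtain e where e: "e \<in> E" "bmul e q = Some q" "\<forall>e'\<in>E - {e}. bmul e' q = None"
      using bmul_unit_left[OF q] by blast
    have "(\<one>\<^bsub>A\<^esub> \<otimes>\<^bsub>A\<^esub> mono b q) r =
        finsum K (\<lambda>(p', q'). \<one>\<^bsub>A\<^esub> p' \<otimes> mono b q q') {(p', q') \<in> E \<times> {q}. bmul p' q' = Some r}"
      by (rule mult_superset) (use b q one_carrier one_support units_finite in
          \<open>auto simp: monomial_carrier dest: support_monomial\<close>)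
    \<comment> \<open>Of all the units only \<open>e\<close> composes with \<open>q\<close>, so at
      most one pair is left.\<close>
    also have "{(p', q') \<in> E \<times> {q}. bmul p' q' = Some r} = (if r = q then {(e, q)} else {})"
      using e by auto (metis DiffI option.distinct(1) option.inject singletonD)+
    finally show "(\<one>\<^bsub>A\<^esub> \<otimes>\<^bsub>A\<^esub> mono b q) r = mono b q r"
      using b e by (auto simp: monomial_def basis_algebra_sel)
  qed
  note mono = this
  show ?thesis
    using assms
    by (induction rule: basis_induct)
      (simp_all add: mono mult_zero_right mult_add_right monomial_carrier one_carrier)
qed

lemma mult_one:
  assumes "f \<in> carrier A"
  shows "f \<otimes>\<^bsub>A\<^esub> \<one>\<^bsub>A\<^esub> = f"
proof -
  have "mono b q \<otimes>\<^bsub>A\<^esub> \<one>\<^bsub>A\<^esub> = mono b q" if b: "b \<in> carrier K" and q: "q \<in> B" for b q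
  proof
    fix r
    obtain e where e: "e \<in> E" "bmul q e = Some q" "\<forall>e'\<in>E - {e}. bmul q e' = None"
      using bmul_unit_right[OF q] by blast
    have "(mono b q \<otimes>\<^bsub>A\<^esub> \<one>\<^bsub>A\<^esub>) r =
        finsum K (\<lambda>(q', p'). mono b q q' \<otimes> \<one>\<^bsub>A\<^esub> p') {(q', p') \<in> {q} \<times> E. bmul q' p' = Some r}"
      by (rule mult_superset) (use b q one_carrier one_support units_finite in
          \<open>auto simp: monomial_carrier dest: support_monomial\<close>)
    also have "{(q', p') \<in> {q} \<times> E. bmul q' p' = Some r} = (if r = q then {(q, e)} else {})"
      using e by auto (metis DiffI option.distinct(1) option.inject singletonD)+
    finally show "(mono b q \<otimes>\<^bsub>A\<^esub> \<one>\<^bsub>A\<^esub>) r = mono b q r"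
      using b e by (auto simp: monomial_def basis_algebra_sel)
  qed
  note mono = this
  show ?thesis
    using assms
    by (induction rule: basis_induct)
      (simp_all add: mono mult_zero_left mult_add_left monomial_carrier one_carrier)
qed

lemma ring_A: "ring A"
  by (rule ringI[OF abelian_group_A])
    (auto intro!: monoidI simp: mult_carrier one_carrier mult_assoc_A one_mult mult_one
      mult_add_left mult_add_right)

lemma smult_mult_A:
  assumes "a \<in> carrier K" "f \<in> carrier A" "g \<in> carrier A"
  shows "(a \<odot>\<^bsub>A\<^esub> f) \<otimes>\<^bsub>A\<^esub> g = a \<odot>\<^bsub>A\<^esub> (f \<otimes>\<^bsub>A\<^esub> g)"
    and "f \<otimes>\<^bsub>A\<^esub> (a \<odot>\<^bsub>A\<^esub> g) = a \<odot>\<^bsub>A\<^esub> (f \<otimes>\<^bsub>A\<^esub> g)"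
proof -
  let ?S = "\<lambda>r. {(p, q) \<in> support K f \<times> support K g. bmul p q = Some r}"
  have fin: "finite (support K f)" "finite (support K g)" using assms by (auto simp: carrier_finite)
  have finS: "finite (?S r)" for r
    by (rule finite_subset[of _ "support K f \<times> support K g"]) (use fin in auto)
  have fg: "(a \<odot>\<^bsub>A\<^esub> (f \<otimes>\<^bsub>A\<^esub> g)) r = finsum K (\<lambda>x. a \<otimes> (\<lambda>(p, q). f p \<otimes> g q) x) (?S r)" for r
    using assms fin finS[of r]
    by (simp add: smult_eq mult_superset[of f g "support K f" "support K g"])
      (rule finsum_rdistr, auto simp: carrier_coeff)
  show "(a \<odot>\<^bsub>A\<^esub> f) \<otimes>\<^bsub>A\<^esub> g = a \<odot>\<^bsub>A\<^esub> (f \<otimes>\<^bsub>A\<^esub> g)"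
  proof
    fix r
    have "((a \<odot>\<^bsub>A\<^esub> f) \<otimes>\<^bsub>A\<^esub> g) r = finsum K (\<lambda>(p, q). (a \<odot>\<^bsub>A\<^esub> f) p \<otimes> g q) (?S r)"
      by (rule mult_superset) (use assms fin in \<open>auto simp: smult_carrier smult_apply\<close>)
    also have "\<dots> = finsum K (\<lambda>x. a \<otimes> (\<lambda>(p, q). f p \<otimes> g q) x) (?S r)"
      by (rule finsum_cong') (use assms in \<open>auto simp: carrier_coeff m_assoc smult_apply\<close>)
    finally show "((a \<odot>\<^bsub>A\<^esub> f) \<otimes>\<^bsub>A\<^esub> g) r = (a \<odot>\<^bsub>A\<^esub> (f \<otimes>\<^bsub>A\<^esub> g)) r" by (simp only: fg)
  qed
  show "f \<otimes>\<^bsub>A\<^esub> (a \<odot>\<^bsub>A\<^esub> g) = a \<odot>\<^bsub>A\<^esub> (f \<otimes>\<^bsub>A\<^esub> g)"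
  proof
    fix r
    have "(f \<otimes>\<^bsub>A\<^esub> (a \<odot>\<^bsub>A\<^esub> g)) r = finsum K (\<lambda>(p, q). f p \<otimes> (a \<odot>\<^bsub>A\<^esub> g) q) (?S r)"
      by (rule mult_superset) (use assms fin in \<open>auto simp: smult_carrier smult_apply\<close>)
    also have "\<dots> = finsum K (\<lambda>x. a \<otimes> (\<lambda>(p, q). f p \<otimes> g q) x) (?S r)"
      by (rule finsum_cong') (use assms in \<open>auto simp: carrier_coeff m_lcomm smult_apply\<close>)
    finally show "(f \<otimes>\<^bsub>A\<^esub> (a \<odot>\<^bsub>A\<^esub> g)) r = (a \<odot>\<^bsub>A\<^esub> (f \<otimes>\<^bsub>A\<^esub> g)) r" by (simp only: fg)
  qed
qed

text \<open>Traces a non-zero coefficient back to basis elements of the factors. Additivity of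
  degrees and of the length filtration are both read off from it.\<close>

lemma mult_coeff_nonzero:
  assumes "f \<in> carrier A" "g \<in> carrier A" "(f \<otimes>\<^bsub>A\<^esub> g) r \<noteq> \<zero>"
  obtains p q where "p \<in> B" "q \<in> B" "f p \<noteq> \<zero>" "g q \<noteq> \<zero>" "bmul p q = Some r"
proof -
  have "{(p, q). f p \<noteq> \<zero> \<and> g q \<noteq> \<zero> \<and> bmul p q = Some r} \<noteq> {}" (is "?S \<noteq> {}")
  proof
    assume "?S = {}"
    then have "(f \<otimes>\<^bsub>A\<^esub> g) r = finsum K (\<lambda>(p, q). f p \<otimes> g q) {}"
      by (simp only: basis_algebra_sel)
    then show False using assms(3) by simp
  qed
  then show ?thesis using that assms(1,2) by (auto dest!: carrier_support)
qed

lemma graded_algebra_A: "graded_algebra K A"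
proof -
  interpret graded_module K A by (rule graded_module_A)
  interpret R: ring A by (rule ring_A)
  show ?thesis
  proof
    show "\<one>\<^bsub>A\<^esub> \<in> grade A 0"
      using one_carrier by (auto simp: grade_iff) (auto simp: basis_algebra_sel deg_unit split: if_splits)
    show "f \<otimes>\<^bsub>A\<^esub> g \<in> grade A (i + j)" if "f \<in> grade A i" "g \<in> grade A j" for f g i j
    proof -
      have fg: "f \<in> carrier A" "g \<in> carrier A" using that by (auto simp: grade_iff)
      have "int (deg r) = i + j" if "(f \<otimes>\<^bsub>A\<^esub> g) r \<noteq> \<zero>" for r
        using that \<open>f \<in> grade A i\<close> \<open>g \<in> grade A j\<close>
        by (rule_tac mult_coeff_nonzero[OF fg that]) (auto simp: grade_iff deg_bmul)
      then show ?thesis using mult_carrier[OF fg] by (simp add: grade_iff)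
    qed
  qed (auto simp: smult_mult_A)
qed

end


section \<open>Quotients of graded algebras\<close>

lemma (in ring_hom_ring) hom_finsum_closed:
  assumes "finite T" "F \<in> T \<rightarrow> carrier R"
  shows "h (\<Oplus>\<^bsub>R\<^esub>i\<in>T. F i) = (\<Oplus>\<^bsub>S\<^esub>i\<in>T. h (F i))"
  using assms by (induction T rule: finite_induct) (simp_all add: Pi_def)

text \<open>Every axiom is pulled back along \<open>\<phi>\<close>. For the quotient this provides
  the unique decomposition of cosets into homogeneous parts, inherited from the distance
  algebra.\<close>

lemma graded_algebra_transport:
  fixes D :: "('k, 'a) graded_module" and Q :: "('k, 'b) graded_module"
  assumes D: "graded_algebra K D" and Q: "ring Q" and iso: "\<phi> \<in> ring_iso D Q"
    and smult: "\<And>a x. a \<in> carrier K \<Longrightarrow> x \<in> carrier D \<Longrightarrow> \<phi> (a \<odot>\<^bsub>D\<^esub> x) = a \<odot>\<^bsub>Q\<^esub> \<phi> x"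
    and grade: "\<And>n. \<phi> ` grade D n = grade Q n"
  shows "graded_algebra K Q"
proof -
  interpret D: graded_algebra K D by (rule D)
  interpret Q: ring Q by (rule Q)
  interpret h: ring_hom_ring D Q \<phi>
    by (rule ring_hom_ringI2) (use D.ring_axioms Q iso in \<open>auto simp: ring_iso_def\<close>)
  have inj: "inj_on \<phi> (carrier D)" and carr: "\<And>y. y \<in> carrier Q \<Longrightarrow> \<exists>x\<in>carrier D. y = \<phi> x"
    using iso by (auto simp: ring_iso_def bij_betw_def)
  have sub: "grade D n \<subseteq> carrier D" for n
    using D.grade_submodule[of n] subgroup.subset by (fastforce simp: submodule_def)
  have gr: "y \<in> grade Q n \<Longrightarrow> \<exists>x\<in>grade D n. y = \<phi> x" for y n
    using grade[of n] by auto
  have gI: "\<phi> x \<in> grade Q n" if "x \<in> grade D n" for x n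
    using that grade[of n] by blast
  have mod: "Module.module K Q"
  proof (rule moduleI)
    show "cring K" by (rule D.R.cring_axioms)
    show "abelian_group Q" by (rule Q.abelian_group_axioms)
    fix a x assume a: "a \<in> carrier K" and x: "x \<in> carrier Q"
    obtain x' where x': "x' \<in> carrier D" "x = \<phi> x'" using carr x by blast
    show "a \<odot>\<^bsub>Q\<^esub> x \<in> carrier Q" using a x' by (simp flip: smult)
    fix b assume b: "b \<in> carrier K"
    show "(a \<oplus>\<^bsub>K\<^esub> b) \<odot>\<^bsub>Q\<^esub> x = a \<odot>\<^bsub>Q\<^esub> x \<oplus>\<^bsub>Q\<^esub> b \<odot>\<^bsub>Q\<^esub> x"
      using a b x' by (simp add: D.smult_l_distr flip: smult)
    show "a \<otimes>\<^bsub>K\<^esub> b \<odot>\<^bsub>Q\<^esub> x = a \<odot>\<^bsub>Q\<^esub> (b \<odot>\<^bsub>Q\<^esub> x)"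
      using a b x' by (simp add: D.smult_assoc1 flip: smult)
  next
    fix x assume "x \<in> carrier Q"
    then obtain x' where "x' \<in> carrier D" "x = \<phi> x'" using carr by blast
    then show "\<one>\<^bsub>K\<^esub> \<odot>\<^bsub>Q\<^esub> x = x" by (simp flip: smult)
  next
    fix a x y assume a: "a \<in> carrier K" and xy: "x \<in> carrier Q" "y \<in> carrier Q"
    obtain x' y' where "x' \<in> carrier D" "x = \<phi> x'" "y' \<in> carrier D" "y = \<phi> y'"
      using carr xy by blast
    then show "a \<odot>\<^bsub>Q\<^esub> (x \<oplus>\<^bsub>Q\<^esub> y) = a \<odot>\<^bsub>Q\<^esub> x \<oplus>\<^bsub>Q\<^esub> a \<odot>\<^bsub>Q\<^esub> y"
      using a by (simp add: D.smult_r_distr flip: smult h.hom_add)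
  qed
  interpret Q: Module.module K Q by (rule mod)
  have "graded_module K Q"
  proof (rule graded_module.intro[OF mod graded_module_axioms.intro])
    fix n
    interpret N: submodule "grade D n" K D by (rule D.grade_submodule)
    show "submodule (grade Q n) K Q"
    proof (rule Q.submoduleI)
      show "grade Q n \<subseteq> carrier Q" unfolding grade[symmetric] using sub[of n] by auto
      have "\<phi> \<zero>\<^bsub>D\<^esub> \<in> grade Q n" using N.one_closed by (intro gI) simp
      then show "\<zero>\<^bsub>Q\<^esub> \<in> grade Q n" by simp
      show "\<ominus>\<^bsub>Q\<^esub> x \<in> grade Q n" if x: "x \<in> grade Q n" for x
      proof -
        obtain x' where x': "x' \<in> grade D n" "x = \<phi> x'" using gr[OF x] by blast
        have "\<phi> (\<ominus>\<^bsub>D\<^esub> x') \<in> grade Q n"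
          using N.m_inv_closed[OF x'(1)] by (intro gI) (simp add: a_inv_def)
        then show ?thesis using h.hom_a_inv[of x'] x' sub[of n] by (simp add: subset_eq)
      qed
      show "x \<oplus>\<^bsub>Q\<^esub> y \<in> grade Q n" if xy: "x \<in> grade Q n" "y \<in> grade Q n" for x y
      proof -
        obtain x' y' where x': "x' \<in> grade D n" "x = \<phi> x'" "y' \<in> grade D n" "y = \<phi> y'"
          using gr[OF xy(1)] gr[OF xy(2)] by blast
        have "\<phi> (x' \<oplus>\<^bsub>D\<^esub> y') \<in> grade Q n"
          using N.m_closed[of x' y'] x' by (intro gI) simp
        then show ?thesis using h.hom_add[of x' y'] x' sub[of n] by (simp add: subset_eq)
      qed
      show "a \<odot>\<^bsub>Q\<^esub> x \<in> grade Q n" if "a \<in> carrier K" "x \<in> grade Q n" for a x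
      proof -
        obtain x' where x': "x' \<in> grade D n" "x = \<phi> x'" using gr[OF \<open>x \<in> grade Q n\<close>] by blast
        have "\<phi> (a \<odot>\<^bsub>D\<^esub> x') \<in> grade Q n"
          using N.smult_closed[OF \<open>a \<in> carrier K\<close> x'(1)] by (rule gI)
        then show ?thesis
          using x' sub[of n] smult[of a x'] \<open>a \<in> carrier K\<close> by (simp add: subset_eq)
      qed
    qed
  next
    fix m assume "m \<in> carrier Q"
    then obtain x where x: "x \<in> carrier D" "m = \<phi> x" using carr by blast
    \<comment> \<open>The index set of a decomposition consists of its non-zero components, so
      injectivity is needed for \<open>\<phi>\<close> to preserve it.\<close>
    have zero_iff: "\<phi> y = \<zero>\<^bsub>Q\<^esub> \<longleftrightarrow> y = \<zero>\<^bsub>D\<^esub>" if "y \<in> carrier D" for y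
      using inj_onD[OF inj, of y "\<zero>\<^bsub>D\<^esub>"] that by auto
    have decomp: "((\<forall>n. \<phi> (c n) \<in> grade Q n) \<and> finite {n. \<phi> (c n) \<noteq> \<zero>\<^bsub>Q\<^esub>} \<and>
          m = (\<Oplus>\<^bsub>Q\<^esub>n\<in>{n. \<phi> (c n) \<noteq> \<zero>\<^bsub>Q\<^esub>}. \<phi> (c n))) \<longleftrightarrow>
        finite {n. c n \<noteq> \<zero>\<^bsub>D\<^esub>} \<and> x = (\<Oplus>\<^bsub>D\<^esub>n\<in>{n. c n \<noteq> \<zero>\<^bsub>D\<^esub>}. c n)"
      if c: "\<forall>n. c n \<in> grade D n" for c
    proof -
      have cc: "c n \<in> carrier D" for n using c sub by blast
      have S: "{n. \<phi> (c n) \<noteq> \<zero>\<^bsub>Q\<^esub>} = {n. c n \<noteq> \<zero>\<^bsub>D\<^esub>}" using zero_iff[OF cc] by simp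
      have "(\<Oplus>\<^bsub>Q\<^esub>n\<in>{n. c n \<noteq> \<zero>\<^bsub>D\<^esub>}. \<phi> (c n)) = \<phi> (\<Oplus>\<^bsub>D\<^esub>n\<in>{n. c n \<noteq> \<zero>\<^bsub>D\<^esub>}. c n)"
        if "finite {n. c n \<noteq> \<zero>\<^bsub>D\<^esub>}"
        using that cc by (intro h.hom_finsum_closed[symmetric]) auto
      moreover have "(\<Oplus>\<^bsub>D\<^esub>n\<in>{n. c n \<noteq> \<zero>\<^bsub>D\<^esub>}. c n) \<in> carrier D"
        using cc by (intro D.finsum_closed) auto
      moreover have "\<phi> (c n) \<in> grade Q n" for n using c by (intro gI) simp
      ultimately show ?thesis using x inj_onD[OF inj] S by auto
    qed
    obtain c where c: "\<forall>n. c n \<in> grade D n" "finite {n. c n \<noteq> \<zero>\<^bsub>D\<^esub>}"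
        "x = (\<Oplus>\<^bsub>D\<^esub>n\<in>{n. c n \<noteq> \<zero>\<^bsub>D\<^esub>}. c n)"
      using D.grade_direct_sum[OF x(1)] by blast
    show "\<exists>!c. (\<forall>n. c n \<in> grade Q n) \<and> finite {n. c n \<noteq> \<zero>\<^bsub>Q\<^esub>} \<and>
        m = (\<Oplus>\<^bsub>Q\<^esub>n\<in>{n. c n \<noteq> \<zero>\<^bsub>Q\<^esub>}. c n)"
    proof (rule ex1I[of _ "\<lambda>n. \<phi> (c n)"])
      show "(\<forall>n. \<phi> (c n) \<in> grade Q n) \<and> finite {n. \<phi> (c n) \<noteq> \<zero>\<^bsub>Q\<^esub>} \<and>
          m = (\<Oplus>\<^bsub>Q\<^esub>n\<in>{n. \<phi> (c n) \<noteq> \<zero>\<^bsub>Q\<^esub>}. \<phi> (c n))"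
        using decomp[OF c(1)] c by blast
    next
      fix c' assume c': "(\<forall>n. c' n \<in> grade Q n) \<and> finite {n. c' n \<noteq> \<zero>\<^bsub>Q\<^esub>} \<and>
          m = (\<Oplus>\<^bsub>Q\<^esub>n\<in>{n. c' n \<noteq> \<zero>\<^bsub>Q\<^esub>}. c' n)"
      \<comment> \<open>A competing decomposition is lifted componentwise to \<open>D\<close>, where
        uniqueness is known.\<close>
      have "\<forall>n. \<exists>x. x \<in> grade D n \<and> c' n = \<phi> x"
        using gr[of "c' _"] c' by blast
      then obtain d where "\<forall>n. d n \<in> grade D n \<and> c' n = \<phi> (d n)"
        by (rule choice[THEN exE])
      then have d: "\<forall>n. d n \<in> grade D n" "c' = (\<lambda>n. \<phi> (d n))"
        by auto
      then have "finite {n. d n \<noteq> \<zero>\<^bsub>D\<^esub>} \<and> x = (\<Oplus>\<^bsub>D\<^esub>n\<in>{n. d n \<noteq> \<zero>\<^bsub>D\<^esub>}. d n)"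
        using decomp[OF d(1)] c' by simp
      then have "d = c"
        using D.grade_direct_sum[OF x(1)] c d(1) by blast
      then show "c' = (\<lambda>n. \<phi> (c n))" using d(2) by simp
    qed
  qed
  then interpret Q: graded_module K Q .
  show ?thesis
  proof
    fix a x y assume a: "a \<in> carrier K" and xy: "x \<in> carrier Q" "y \<in> carrier Q"
    obtain x' y' where x': "x' \<in> carrier D" "x = \<phi> x'" "y' \<in> carrier D" "y = \<phi> y'"
      using carr xy by meson
    show "a \<odot>\<^bsub>Q\<^esub> x \<otimes>\<^bsub>Q\<^esub> y = a \<odot>\<^bsub>Q\<^esub> (x \<otimes>\<^bsub>Q\<^esub> y)"
      using x' a by (simp add: D.smult_mult_left flip: smult h.hom_mult)
    show "x \<otimes>\<^bsub>Q\<^esub> (a \<odot>\<^bsub>Q\<^esub> y) = a \<odot>\<^bsub>Q\<^esub> (x \<otimes>\<^bsub>Q\<^esub> y)"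
      using x' a by (simp add: D.smult_mult_right flip: smult h.hom_mult)
  next
    have "\<phi> \<one>\<^bsub>D\<^esub> \<in> grade Q 0" using D.one_grade by (rule gI)
    then show "\<one>\<^bsub>Q\<^esub> \<in> grade Q 0" by simp
  next
    fix x y i j assume xy: "x \<in> grade Q i" "y \<in> grade Q j"
    obtain x' y' where x': "x' \<in> grade D i" "x = \<phi> x'" "y' \<in> grade D j" "y = \<phi> y'"
      using gr[OF xy(1)] gr[OF xy(2)] by blast
    have "\<phi> (x' \<otimes>\<^bsub>D\<^esub> y') \<in> grade Q (i + j)"
      using D.mult_grade[OF x'(1,3)] by (rule gI)
    then show "x \<otimes>\<^bsub>Q\<^esub> y \<in> grade Q (i + j)"
      using h.hom_mult[of x' y'] x' sub[of i] sub[of j] by (simp add: subset_eq)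
  qed
qed

lemma quotient_algebra_sel:
  "carrier (quotient_algebra A I) = carrier (A Quot I)"
  "mult (quotient_algebra A I) = mult (A Quot I)"
  "one (quotient_algebra A I) = one (A Quot I)"
  "zero (quotient_algebra A I) = zero (A Quot I)"
  "add (quotient_algebra A I) = add (A Quot I)"
  "smult (quotient_algebra A I) a X = (\<Union>x\<in>X. I +>\<^bsub>A\<^esub> (a \<odot>\<^bsub>A\<^esub> x))"
  "grade (quotient_algebra A I) n = (\<lambda>x. I +>\<^bsub>A\<^esub> x) ` grade A n"
  by (auto simp: quotient_algebra_def)

text \<open>\<open>quotient_algebra\<close> is a larger record than \<open>A Quot I\<close> with the
  same ring operations, so the axioms are carried over field by field.\<close>

lemma ring_quotient_algebra:
  assumes "ideal I A"
  shows "ring (quotient_algebra A I)"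
proof -
  interpret R: ring "A Quot I" using assms by (rule ideal.quotient_is_ring)
  have "\<exists>y\<in>carrier (A Quot I). y \<oplus>\<^bsub>A Quot I\<^esub> x = \<zero>\<^bsub>A Quot I\<^esub>" if "x \<in> carrier (A Quot I)" for x
    using R.l_neg[OF that] R.a_inv_closed[OF that] by blast
  then show ?thesis
    by (intro ringI abelian_groupI monoidI)
      (simp_all add: quotient_algebra_sel R.a_ac R.m_assoc R.l_distr R.r_distr)
qed

lemma graded_algebra_isomorphic_quotient:
  fixes A :: "('k, 'a) graded_module" and D :: "('k, 'b) graded_module"
  assumes A: "graded_algebra K A" and D: "graded_algebra K D" and hom: "ring_hom_ring A D \<pi>"
    and smult: "\<And>a x. a \<in> carrier K \<Longrightarrow> x \<in> carrier A \<Longrightarrow> \<pi> (a \<odot>\<^bsub>A\<^esub> x) = a \<odot>\<^bsub>D\<^esub> \<pi> x"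
    and surj: "\<pi> ` carrier A = carrier D"
    and grade: "\<And>n. \<pi> ` grade A n = grade D n"
  shows "graded_algebra_isomorphic K D (quotient_algebra A (a_kernel A D \<pi>))"
proof -
  interpret A: graded_algebra K A by (rule A)
  interpret D: graded_algebra K D by (rule D)
  interpret h: ring_hom_ring A D \<pi> by (rule hom)
  let ?I = "a_kernel A D \<pi>" and ?Q = "quotient_algebra A (a_kernel A D \<pi>)"
  let ?\<psi> = "\<lambda>X. the_elem (\<pi> ` X)"
  \<comment> \<open>The isomorphism theorem gives the map \<open>?\<psi>\<close> from the quotient
    to \<open>D\<close>; the wanted isomorphism is its inverse.\<close>
  define \<phi> where "\<phi> = inv_into (carrier (A Quot ?I)) ?\<psi>"
  have \<psi>: "?\<psi> \<in> ring_iso (A Quot ?I) D" by (rule h.FactRing_iso_set[OF surj])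
  have I: "ideal ?I A" by (rule h.kernel_is_ideal)
  have coset: "?I +>\<^bsub>A\<^esub> x \<in> carrier (A Quot ?I)" if "x \<in> carrier A" for x
    using that by (auto simp: FactRing_simps A_RCOSETS_def')
  have \<phi>\<pi>: "\<phi> (\<pi> x) = ?I +>\<^bsub>A\<^esub> x" if "x \<in> carrier A" for x
    unfolding \<phi>_def
    by (rule inv_into_f_eq) (use \<psi> coset that in \<open>auto simp: ring_iso_def bij_betw_def\<close>)
  have "\<phi> \<in> ring_iso D (A Quot ?I)"
    unfolding \<phi>_def by (rule ring_iso_set_sym[OF ideal.quotient_is_ring[OF I] \<psi>])
  then have iso: "\<phi> \<in> ring_iso D ?Q"
    by (simp add: ring_iso_def ring_hom_def quotient_algebra_sel)
  have sm: "\<phi> (a \<odot>\<^bsub>D\<^esub> y) = a \<odot>\<^bsub>?Q\<^esub> \<phi> y" if a: "a \<in> carrier K" and y: "y \<in> carrier D" for a y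
  proof -
    obtain x where x: "x \<in> carrier A" "y = \<pi> x" using y surj by blast
    \<comment> \<open>The scalar multiple of a coset is a union over all representatives. They have
      the same image under \<open>\<pi>\<close>, so they all contribute the same coset.\<close>
    have "?I +>\<^bsub>A\<^esub> (a \<odot>\<^bsub>A\<^esub> x') = ?I +>\<^bsub>A\<^esub> (a \<odot>\<^bsub>A\<^esub> x)" if x': "x' \<in> ?I +>\<^bsub>A\<^esub> x" for x'
    proof -
      have "x' \<in> carrier A" using x' x(1) abelian_subgroup.a_elemrcos_carrier[OF h.abelian_subgroup_a_kernel]
        by blast
      moreover have "\<pi> x' = \<pi> x" using h.rcos_imp_homeq[OF x(1) x'] .
      ultimately show ?thesis
        using \<phi>\<pi>[of "a \<odot>\<^bsub>A\<^esub> x'"] \<phi>\<pi>[of "a \<odot>\<^bsub>A\<^esub> x"] smult a x(1) by simp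
    qed
    moreover have "x \<in> ?I +>\<^bsub>A\<^esub> x" using h.homeq_imp_rcos[OF x(1) x(1)] by simp
    ultimately have "(\<Union>x'\<in>?I +>\<^bsub>A\<^esub> x. ?I +>\<^bsub>A\<^esub> (a \<odot>\<^bsub>A\<^esub> x')) = ?I +>\<^bsub>A\<^esub> (a \<odot>\<^bsub>A\<^esub> x)"
      by blast
    then show ?thesis
      using x a by (simp add: quotient_algebra_sel \<phi>\<pi> flip: smult)
  qed
  have sub: "grade A n \<subseteq> carrier A" for n
    using A.grade_submodule[of n] subgroup.subset by (fastforce simp: submodule_def)
  have gr: "\<phi> ` grade D n = grade ?Q n" for n
    unfolding quotient_algebra_sel grade[symmetric] image_image
    using sub[of n] by (intro image_cong) (auto simp: \<phi>\<pi>)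
  have "graded_algebra K ?Q"
    by (rule graded_algebra_transport[OF D ring_quotient_algebra[OF I] iso sm gr])
  then show ?thesis
    unfolding graded_algebra_isomorphic_def using D iso sm gr by blast
qed


section \<open>Linear extension of partial maps between bases\<close>

text \<open>The linear extension of \<open>t\<close>, with \<open>None\<close> standing for zero:
  coefficients are summed along the fibres of \<open>t\<close>.\<close>

definition basis_map ::
    "('k, 'r) ring_scheme \<Rightarrow> ('b \<Rightarrow> 'c option) \<Rightarrow> ('b \<Rightarrow> 'k) \<Rightarrow> 'c \<Rightarrow> 'k" where
  "basis_map K t f = (\<lambda>r. finsum K f {p. f p \<noteq> \<zero>\<^bsub>K\<^esub> \<and> t p = Some r})"

locale based_module_hom =
  S: based_module K B deg bmul E + T: based_module K B' deg' bmul' E'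
  for K :: "('k, 'r) ring_scheme" (structure)
    and B :: "'b set" and deg bmul E and B' :: "'c set" and deg' bmul' E' +
  fixes t :: "'b \<Rightarrow> 'c option"
  assumes t_closed: "p \<in> B \<Longrightarrow> t p = Some r \<Longrightarrow> r \<in> B'"
begin

abbreviation \<tau> where "\<tau> \<equiv> basis_map K t"

lemma superset:
  assumes "f \<in> carrier S.A" "finite P" "support K f \<subseteq> P"
  shows "\<tau> f r = finsum K f {p \<in> P. t p = Some r}"
  unfolding basis_map_def
  by (rule S.finsum_superset) (use assms in \<open>auto simp: S.carrier_coeff\<close>)

lemma map_zero: "\<tau> \<zero>\<^bsub>S.A\<^esub> = \<zero>\<^bsub>T.A\<^esub>"
  by (auto simp: basis_map_def S.zero_apply T.zero_apply)

lemma map_add: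
  assumes "f \<in> carrier S.A" "g \<in> carrier S.A"
  shows "\<tau> (f \<oplus>\<^bsub>S.A\<^esub> g) = \<tau> f \<oplus>\<^bsub>T.A\<^esub> \<tau> g"
proof
  fix r
  let ?P = "support K f \<union> support K g"
  have fin: "finite ?P" using assms by (simp add: S.carrier_finite)
  have "\<tau> (f \<oplus>\<^bsub>S.A\<^esub> g) r = finsum K (f \<oplus>\<^bsub>S.A\<^esub> g) {p \<in> ?P. t p = Some r}"
    by (rule superset) (use assms fin in \<open>auto simp: S.add_carrier S.add_apply\<close>)
  also have "\<dots> = finsum K f {p \<in> ?P. t p = Some r} \<oplus> finsum K g {p \<in> ?P. t p = Some r}"
    unfolding S.add_eq by (rule S.finsum_addf) (use assms in \<open>auto simp: S.carrier_coeff\<close>)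
  also have "\<dots> = \<tau> f r \<oplus> \<tau> g r"
    using assms fin superset[of f ?P r] superset[of g ?P r] by simp
  finally show "\<tau> (f \<oplus>\<^bsub>S.A\<^esub> g) r = (\<tau> f \<oplus>\<^bsub>T.A\<^esub> \<tau> g) r" by (simp only: T.add_apply)
qed

lemma map_smult:
  assumes "a \<in> carrier K" "f \<in> carrier S.A"
  shows "\<tau> (a \<odot>\<^bsub>S.A\<^esub> f) = a \<odot>\<^bsub>T.A\<^esub> \<tau> f"
proof
  fix r
  let ?P = "support K f"
  have fin: "finite ?P" using assms by (simp add: S.carrier_finite)
  have "\<tau> (a \<odot>\<^bsub>S.A\<^esub> f) r = finsum K (a \<odot>\<^bsub>S.A\<^esub> f) {p \<in> ?P. t p = Some r}"
    by (rule superset) (use assms fin in \<open>auto simp: S.smult_carrier S.smult_apply\<close>)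
  also have "\<dots> = a \<otimes> finsum K f {p \<in> ?P. t p = Some r}"
    unfolding S.smult_eq
    by (rule S.finsum_rdistr[symmetric]) (use assms fin in \<open>auto simp: S.carrier_coeff\<close>)
  also have "\<dots> = a \<otimes> \<tau> f r" using assms fin superset[of f ?P r] by simp
  finally show "\<tau> (a \<odot>\<^bsub>S.A\<^esub> f) r = (a \<odot>\<^bsub>T.A\<^esub> \<tau> f) r" by (simp only: T.smult_apply)
qed

lemma map_monomial:
  assumes "a \<in> carrier K" "p \<in> B"
  shows "\<tau> (monomial K a p) = (case t p of None \<Rightarrow> \<zero>\<^bsub>T.A\<^esub> | Some r \<Rightarrow> monomial K a r)"
proof
  fix r
  have "\<tau> (monomial K a p) r = finsum K (monomial K a p) {q \<in> {p}. t q = Some r}"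
    by (rule superset) (use assms in \<open>auto simp: S.monomial_carrier dest: S.support_monomial\<close>)
  also have "{q \<in> {p}. t q = Some r} = (if t p = Some r then {p} else {})" by auto
  finally show "\<tau> (monomial K a p) r = (case t p of None \<Rightarrow> \<zero>\<^bsub>T.A\<^esub> | Some r \<Rightarrow> monomial K a r) r"
    using assms by (auto simp: monomial_def T.zero_apply split: option.split)
qed

lemma map_monomial_carrier:
  "a \<in> carrier K \<Longrightarrow> p \<in> B \<Longrightarrow> \<tau> (monomial K a p) \<in> carrier T.A"
  by (auto simp: map_monomial T.zero_carrier intro: T.monomial_carrier t_closed split: option.split)

lemma map_carrier:
  assumes "f \<in> carrier S.A"
  shows "\<tau> f \<in> carrier T.A"
  using assms
  by (induction rule: S.basis_induct)
    (simp_all add: map_zero T.zero_carrier map_add S.monomial_carrier map_monomial_carrier T.add_carrier)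

lemma map_coeff_nonzero:
  assumes "\<tau> f r \<noteq> \<zero>"
  obtains p where "f p \<noteq> \<zero>" "t p = Some r"
proof -
  have "{p. f p \<noteq> \<zero> \<and> t p = Some r} \<noteq> {}" (is "?S \<noteq> {}")
  proof
    assume "?S = {}"
    then have "\<tau> f r = finsum K f {}" by (simp only: basis_map_def)
    then show False using assms by simp
  qed
  then show ?thesis using that by blast
qed

lemma map_grade:
  assumes deg: "\<And>p r. p \<in> B \<Longrightarrow> t p = Some r \<Longrightarrow> deg' r = deg p" and f: "f \<in> grade S.A n"
  shows "\<tau> f \<in> grade T.A n"
proof -
  have fc: "f \<in> carrier S.A" using f by (simp add: S.grade_iff)
  have "int (deg' r) = n" if nz: "\<tau> f r \<noteq> \<zero>" for r
  proof -
    obtain p where p: "f p \<noteq> \<zero>" "t p = Some r" using map_coeff_nonzero[OF nz] .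
    moreover have "p \<in> B" using S.carrier_support[OF fc] p(1) by blast
    ultimately show ?thesis using f deg[of p r] by (simp add: S.grade_iff)
  qed
  then show ?thesis using map_carrier[OF fc] by (simp add: T.grade_iff)
qed

end

text \<open>\<open>t_bmul\<close> is multiplicativity on basis elements, zero products included. By
  \<open>t_units\<close> the fibre over each unit contains exactly one unit, so the sum of units is
  preserved.\<close>

locale based_algebra_hom =
  based_module_hom K B deg bmul E B' deg' bmul' E' t +
  S: based_algebra K B deg bmul E + T: based_algebra K B' deg' bmul' E'
  for K :: "('k, 'r) ring_scheme" (structure)
    and B :: "'b set" and deg bmul E and B' :: "'c set" and deg' bmul' E' t +
  assumes t_bmul: "p \<in> B \<Longrightarrow> q \<in> B \<Longrightarrow>
      Option.bind (bmul p q) t = Option.bind (t p) (\<lambda>p'. Option.bind (t q) (bmul' p'))"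
    and t_units: "bij_betw t E (Some ` E')"
begin

lemma map_mult_monomial:
  assumes "a \<in> carrier K" "b \<in> carrier K" "p \<in> B" "q \<in> B"
  shows "\<tau> (monomial K a p \<otimes>\<^bsub>S.A\<^esub> monomial K b q) = \<tau> (monomial K a p) \<otimes>\<^bsub>T.A\<^esub> \<tau> (monomial K b q)"
proof -
  have lhs: "\<tau> (monomial K a p \<otimes>\<^bsub>S.A\<^esub> monomial K b q) =
      (case Option.bind (bmul p q) t of None \<Rightarrow> \<zero>\<^bsub>T.A\<^esub> | Some r \<Rightarrow> monomial K (a \<otimes> b) r)"
  proof (cases "bmul p q")
    case (Some s)
    then have "s \<in> B" using S.bmul_closed assms by blast
    then show ?thesis using Some assms by (simp add: S.monomial_mult map_monomial)
  qed (use assms in \<open>simp add: S.monomial_mult map_zero\<close>)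
  have rhs: "\<tau> (monomial K a p) \<otimes>\<^bsub>T.A\<^esub> \<tau> (monomial K b q) =
      (case Option.bind (t p) (\<lambda>p'. Option.bind (t q) (bmul' p')) of
         None \<Rightarrow> \<zero>\<^bsub>T.A\<^esub> | Some r \<Rightarrow> monomial K (a \<otimes> b) r)"
  proof (cases "t p")
    case None
    then show ?thesis using assms by (simp add: map_monomial T.mult_zero_left)
  next
    case p: (Some p')
    then have p': "p' \<in> B'" using t_closed assms by blast
    show ?thesis
    proof (cases "t q")
      case None
      then show ?thesis using p assms by (simp add: map_monomial T.mult_zero_right)
    next
      case q: (Some q')
      then have "q' \<in> B'" using t_closed assms by blast
      then show ?thesis using p p' q assms by (simp add: map_monomial T.monomial_mult)
    qed
  qed
  show ?thesis unfolding lhs rhs using t_bmul assms by simp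
qed

lemma map_mult:
  assumes "f \<in> carrier S.A" "g \<in> carrier S.A"
  shows "\<tau> (f \<otimes>\<^bsub>S.A\<^esub> g) = \<tau> f \<otimes>\<^bsub>T.A\<^esub> \<tau> g"
proof -
  have mono: "\<tau> (monomial K a p \<otimes>\<^bsub>S.A\<^esub> g) = \<tau> (monomial K a p) \<otimes>\<^bsub>T.A\<^esub> \<tau> g"
    if "a \<in> carrier K" "p \<in> B" for a p
    using assms(2)
    by (induction rule: S.basis_induct)
      (use that in \<open>simp_all add: S.mult_zero_right T.mult_zero_right map_zero S.mult_add_right
        T.mult_add_right map_add S.mult_carrier S.monomial_carrier map_carrier map_mult_monomial\<close>)
  show ?thesis
    using assms(1)
    by (induction rule: S.basis_induct)
      (use assms(2) in \<open>simp_all add: S.mult_zero_left T.mult_zero_left map_zero S.mult_add_left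
        T.mult_add_left map_add S.mult_carrier S.monomial_carrier map_carrier mono\<close>)
qed

lemma map_one: "\<tau> \<one>\<^bsub>S.A\<^esub> = \<one>\<^bsub>T.A\<^esub>"
proof
  fix r
  have "\<tau> \<one>\<^bsub>S.A\<^esub> r = finsum K \<one>\<^bsub>S.A\<^esub> {p \<in> E. t p = Some r}"
    by (rule superset) (use S.one_carrier S.one_support S.units_finite in auto)
  also have "\<dots> = \<one>\<^bsub>T.A\<^esub> r"
  proof (cases "r \<in> E'")
    case True
    then obtain e where e: "e \<in> E" "t e = Some r" using t_units unfolding bij_betw_def by force
    then have "{p \<in> E. t p = Some r} = {e}"
      using t_units by (auto simp: bij_betw_def inj_on_def)
    then show ?thesis using e True by (simp add: basis_algebra_sel)
  next
    case False
    then have "{p \<in> E. t p = Some r} = {}" using t_units unfolding bij_betw_def by force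
    then show ?thesis using False by (simp only: S.finsum_empty) (simp add: basis_algebra_sel)
  qed
  finally show "\<tau> \<one>\<^bsub>S.A\<^esub> r = \<one>\<^bsub>T.A\<^esub> r" .
qed

lemma ring_hom_map: "ring_hom_ring S.A T.A \<tau>"
  by (rule ring_hom_ringI[OF S.ring_A T.ring_A]) (auto simp: map_carrier map_mult map_add map_one)

end

section \<open>The path algebra and the distance algebra\<close>

locale digraph_algebras = cring K + pair_digraph G
  for K :: "('k, 'r) ring_scheme" (structure) and G :: "'v pair_pre_digraph"
begin

lemma based_algebra_paths:
  "based_algebra K (paths G) vwalk_length
    (\<lambda>p q. if joinable p q then Some (vwalk_join p q) else None) {[x] | x. x \<in> pverts G}"
proof
  fix p q r :: "'v list" assume pqr: "p \<in> paths G" "q \<in> paths G" "r \<in> paths G"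
  then have "p \<noteq> []" "q \<noteq> []" "r \<noteq> []" by (auto simp: paths_not_Nil)
  then show "Option.bind (if joinable p q then Some (vwalk_join p q) else None)
        (\<lambda>s. if joinable s r then Some (vwalk_join s r) else None) =
      Option.bind (if joinable q r then Some (vwalk_join q r) else None)
        (\<lambda>s. if joinable p s then Some (vwalk_join p s) else None)"
    by (simp add: joinable_simps vwalk_join_assoc)
next
  have "{[x] | x. x \<in> pverts G} = (\<lambda>x. [x]) ` pverts G" by auto
  then show "finite {[x] | x. x \<in> pverts G}" using pair_finite_verts by simp
next
  fix q assume q: "q \<in> paths G"
  show "\<exists>e\<in>{[x] | x. x \<in> pverts G}.
      (if joinable e q then Some (vwalk_join e q) else None) = Some q \<and>
      (\<forall>e'\<in>{[x] | x. x \<in> pverts G} - {e}. (if joinable e' q then Some (vwalk_join e' q) else None) = None)"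
    using paths_not_Nil[OF q] hd_mem_pverts[OF q]
    by (intro bexI[of _ "[hd q]"]) (auto simp: vwalk_join_def joinable_def)
  show "\<exists>e\<in>{[x] | x. x \<in> pverts G}.
      (if joinable q e then Some (vwalk_join q e) else None) = Some q \<and>
      (\<forall>e'\<in>{[x] | x. x \<in> pverts G} - {e}. (if joinable q e' then Some (vwalk_join q e') else None) = None)"
    using paths_not_Nil[OF q] last_mem_pverts[OF q]
    by (intro bexI[of _ "[last q]"]) (auto simp: vwalk_join_def joinable_def)
qed (auto simp: vwalk_join_mem_paths simp del: vwalk_length_simp split: if_splits, simp)

text \<open>Associativity is \<open>between_assoc\<close>, and additivity of degrees is betweenness
  itself, read in the natural numbers because all distances involved are finite.\<close>

lemma based_algebra_dist_pairs:
  "based_algebra K (finite_dist_pairs G) (\<lambda>(x, y). the_enat (gdist G x y))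
    (\<lambda>(x, y) (y', z). if y = y' \<and> between G x y z then Some (x, z) else None)
    {(x, x) | x. x \<in> pverts G}" (is "based_algebra K _ _ ?bmul ?E")
proof
  fix p q r assume pq: "p \<in> finite_dist_pairs G" "q \<in> finite_dist_pairs G"
  {
    assume "?bmul p q = Some r"
    with pq show "r \<in> finite_dist_pairs G"
      by (cases p; cases q) (auto split: if_splits intro: finite_dist_pairs_trans)
  next
    assume "?bmul p q = Some r"
    then obtain x y z where xyz: "p = (x, y)" "q = (y, z)" "r = (x, z)" "between G x y z"
      by (auto split: if_splits prod.splits)
    then have "enat (the_enat (gdist G x z)) = enat (the_enat (gdist G x y) + the_enat (gdist G y z))"
      using pq finite_dist_pairs_trans[of x y G z]
      by (simp add: finite_dist_pairs_enat between_def flip: plus_enat_simps(1))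
    then show "(case r of (x, y) \<Rightarrow> the_enat (gdist G x y)) =
        (case p of (x, y) \<Rightarrow> the_enat (gdist G x y)) + (case q of (x, y) \<Rightarrow> the_enat (gdist G x y))"
      using xyz by simp
  next
    assume "r \<in> finite_dist_pairs G"
    with pq show "Option.bind (?bmul p q) (\<lambda>s. ?bmul s r) = Option.bind (?bmul q r) (\<lambda>s. ?bmul p s)"
      using between_assoc[of "fst p" "snd p" G "snd q" "snd r"]
      by (cases p; cases q; cases r) auto
  }
next
  have "?E = (\<lambda>x. (x, x)) ` pverts G" by auto
  then show "finite ?E" using pair_finite_verts by simp
  show "?E \<subseteq> finite_dist_pairs G" by (auto simp: finite_dist_pairs_def gdist_self zero_enat_def)
  show "(case e of (x, y) \<Rightarrow> the_enat (gdist G x y)) = 0" if "e \<in> ?E" for e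
    using that by (auto simp: gdist_self zero_enat_def)
next
  fix q assume q: "q \<in> finite_dist_pairs G"
  obtain x y where xy: "q = (x, y)" "x \<in> pverts G" "y \<in> pverts G"
    using q by (auto simp: finite_dist_pairs_def)
  show "\<exists>e\<in>?E. ?bmul e q = Some q \<and> (\<forall>e'\<in>?E - {e}. ?bmul e' q = None)"
    using xy by (intro bexI[of _ "(x, x)"]) (auto simp: between_def gdist_self split: if_splits)
  show "\<exists>e\<in>?E. ?bmul q e = Some q \<and> (\<forall>e'\<in>?E - {e}. ?bmul q e' = None)"
    using xy by (intro bexI[of _ "(y, y)"]) (auto simp: between_def gdist_self split: if_splits)
qed

sublocale P: based_algebra K "paths G" vwalk_length
    "\<lambda>p q. if joinable p q then Some (vwalk_join p q) else None" "{[x] | x. x \<in> pverts G}"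
  rewrites "basis_algebra K (paths G) vwalk_length
      (\<lambda>p q. if joinable p q then Some (vwalk_join p q) else None) {[x] | x. x \<in> pverts G} =
    path_algebra K G"
  using based_algebra_paths by (simp_all add: path_algebra_def)

sublocale D: based_algebra K "finite_dist_pairs G" "\<lambda>(x, y). the_enat (gdist G x y)"
    "\<lambda>(x, y) (y', z). if y = y' \<and> between G x y z then Some (x, z) else None"
    "{(x, x) | x. x \<in> pverts G}"
  rewrites "basis_algebra K (finite_dist_pairs G) (\<lambda>(x, y). the_enat (gdist G x y))
      (\<lambda>(x, y) (y', z). if y = y' \<and> between G x y z then Some (x, z) else None)
      {(x, x) | x. x \<in> pverts G} = distance_algebra K G"
  using based_algebra_dist_pairs by (simp_all add: distance_algebra_def)

end


section \<open>The relation ideal as a kernel\<close>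

text \<open>An arbitrary but fixed choice, meaningful for pairs at finite distance only.\<close>

definition geodesic :: "'v pair_pre_digraph \<Rightarrow> 'v \<Rightarrow> 'v \<Rightarrow> 'v list" where
  "geodesic G x y = (SOME p. shortest G p \<and> hd p = x \<and> last p = y)"

lemma geodesic:
  assumes "(x, y) \<in> finite_dist_pairs G"
  shows "shortest G (geodesic G x y)" "hd (geodesic G x y) = x" "last (geodesic G x y) = y"
proof -
  have "shortest G (geodesic G x y) \<and> hd (geodesic G x y) = x \<and> last (geodesic G x y) = y"
    using assms unfolding finite_dist_pairs_iff geodesic_def by (rule someI_ex)
  then show "shortest G (geodesic G x y)" "hd (geodesic G x y) = x" "last (geodesic G x y) = y"
    by auto
qed

context digraph_algebras
begin

sublocale PR: ring "path_algebra K G" by (rule P.ring_A)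

definition ends :: "'v list \<Rightarrow> ('v \<times> 'v) option" where
  "ends p = (if shortest G p then Some (hd p, last p) else None)"

text \<open>For joinable paths this is \<open>shortest_vwalk_join_iff\<close>. Otherwise the middle
  vertices differ and both sides are \<open>None\<close>.\<close>

lemma ends_vwalk_join:
  assumes "p \<in> paths G" "q \<in> paths G"
  shows "Option.bind (if joinable p q then Some (vwalk_join p q) else None) ends =
    Option.bind (ends p) (\<lambda>p'. Option.bind (ends q)
      ((\<lambda>(x, y) (y', z). if y = y' \<and> between G x y z then Some (x, z) else None) p'))"
proof (cases "joinable p q")
  case True
  then show ?thesis
    using assms shortest_vwalk_join_iff[OF assms True]
    by (auto simp: ends_def vwalk_join_hd vwalk_join_last joinable_def)
next
  case False
  then have "last p \<noteq> hd q" using assms by (auto simp: joinable_paths_iff)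
  with False show ?thesis by (simp add: ends_def)
qed

sublocale \<pi>: based_algebra_hom K "paths G" vwalk_length
    "\<lambda>p q. if joinable p q then Some (vwalk_join p q) else None" "{[x] | x. x \<in> pverts G}"
    "finite_dist_pairs G" "\<lambda>(x, y). the_enat (gdist G x y)"
    "\<lambda>(x, y) (y', z). if y = y' \<and> between G x y z then Some (x, z) else None"
    "{(x, x) | x. x \<in> pverts G}" ends
  rewrites "basis_algebra K (paths G) vwalk_length
      (\<lambda>p q. if joinable p q then Some (vwalk_join p q) else None) {[x] | x. x \<in> pverts G} =
    path_algebra K G"
    and "basis_algebra K (finite_dist_pairs G) (\<lambda>(x, y). the_enat (gdist G x y))
      (\<lambda>(x, y) (y', z). if y = y' \<and> between G x y z then Some (x, z) else None)
      {(x, x) | x. x \<in> pverts G} = distance_algebra K G"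
proof -
  show "based_algebra_hom K (paths G) vwalk_length
      (\<lambda>p q. if joinable p q then Some (vwalk_join p q) else None) {[x] | x. x \<in> pverts G}
      (finite_dist_pairs G) (\<lambda>(x, y). the_enat (gdist G x y))
      (\<lambda>(x, y) (y', z). if y = y' \<and> between G x y z then Some (x, z) else None)
      {(x, x) | x. x \<in> pverts G} ends"
  proof (intro based_algebra_hom.intro based_module_hom.intro based_module_hom_axioms.intro
      based_algebra_hom_axioms.intro P.based_module_axioms D.based_module_axioms
      based_algebra_paths based_algebra_dist_pairs)
    show "r \<in> finite_dist_pairs G" if "p \<in> paths G" "ends p = Some r" for p r
      using that path_finite_dist_pairs by (auto simp: ends_def split: if_splits)
    show "bij_betw ends {[x] | x. x \<in> pverts G} (Some ` {(x, x) | x. x \<in> pverts G})"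
      unfolding bij_betw_def
    proof
      show "inj_on ends {[x] | x. x \<in> pverts G}"
        by (auto simp: inj_on_def ends_def shortest_singleton)
      have eqs: "{[x] | x. x \<in> pverts G} = (\<lambda>x. [x]) ` pverts G"
        "{(x, x) | x. x \<in> pverts G} = (\<lambda>x. (x, x)) ` pverts G" by auto
      show "ends ` {[x] | x. x \<in> pverts G} = Some ` {(x, x) | x. x \<in> pverts G}"
        unfolding eqs image_image by (rule image_cong) (auto simp: ends_def shortest_singleton)
    qed
  qed (rule ends_vwalk_join)
qed (simp_all add: path_algebra_def distance_algebra_def)

text \<open>Its linear extension \<open>\<sigma>\<close> is not multiplicative in general: joining
  two chosen paths need not give the chosen one, and gives a non-zero product even when the junction
  is not between the ends.\<close>

definition geod :: "'v \<times> 'v \<Rightarrow> 'v list option" where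
  "geod = (\<lambda>(x, y). Some (geodesic G x y))"

sublocale \<sigma>: based_module_hom K "finite_dist_pairs G" "\<lambda>(x, y). the_enat (gdist G x y)"
    "\<lambda>(x, y) (y', z). if y = y' \<and> between G x y z then Some (x, z) else None"
    "{(x, x) | x. x \<in> pverts G}" "paths G" vwalk_length
    "\<lambda>p q. if joinable p q then Some (vwalk_join p q) else None" "{[x] | x. x \<in> pverts G}"
    geod
  rewrites "basis_algebra K (paths G) vwalk_length
      (\<lambda>p q. if joinable p q then Some (vwalk_join p q) else None) {[x] | x. x \<in> pverts G} =
    path_algebra K G"
    and "basis_algebra K (finite_dist_pairs G) (\<lambda>(x, y). the_enat (gdist G x y))
      (\<lambda>(x, y) (y', z). if y = y' \<and> between G x y z then Some (x, z) else None)
      {(x, x) | x. x \<in> pverts G} = distance_algebra K G"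
proof -
  show "based_module_hom K (finite_dist_pairs G) (paths G) geod"
    by (intro based_module_hom.intro based_module_hom_axioms.intro P.based_module_axioms)
      (auto simp: geod_def dest: geodesic shortest_paths)
qed (simp_all add: path_algebra_def distance_algebra_def)

lemma \<sigma>_monomial:
  "a \<in> carrier K \<Longrightarrow> (x, y) \<in> finite_dist_pairs G \<Longrightarrow>
    \<sigma>.\<tau> (monomial K a (x, y)) = monomial K a (geodesic G x y)"
  using \<sigma>.map_monomial[of a "(x, y)"] by (simp add: geod_def)

lemma \<pi>_monomial:
  "a \<in> carrier K \<Longrightarrow> p \<in> paths G \<Longrightarrow> \<pi>.\<tau> (monomial K a p) =
    (if shortest G p then monomial K a (hd p, last p) else \<zero>\<^bsub>distance_algebra K G\<^esub>)"
  using \<pi>.map_monomial[of a p] by (simp add: ends_def)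

lemma ends_eq_Some_iff: "ends p = Some (x, y) \<longleftrightarrow> shortest G p \<and> x = hd p \<and> y = last p"
  by (auto simp: ends_def)

text \<open>On a basis pair, the chosen path is shortest and has these end points. This gives
  surjectivity of \<open>\<pi>\<close>, in every degree.\<close>

lemma \<pi>_\<sigma>:
  assumes "f \<in> carrier (distance_algebra K G)"
  shows "\<pi>.\<tau> (\<sigma>.\<tau> f) = f"
  using assms
proof (induction rule: D.basis_induct)
  case zero
  then show ?case by (simp add: \<pi>.map_zero \<sigma>.map_zero)
next
  case (add a p f)
  obtain x y where p: "p = (x, y)" by (cases p)
  have "\<sigma>.\<tau> (monomial K a p) = monomial K a (geodesic G x y)"
    using add p by (simp add: \<sigma>_monomial)
  then have "\<pi>.\<tau> (\<sigma>.\<tau> (monomial K a p)) = monomial K a p"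
    using add p geodesic[of x y G]
    by (simp add: \<pi>_monomial shortest_paths)
  then show ?case
    using add by (simp add: \<pi>.map_add \<sigma>.map_add D.monomial_carrier \<sigma>.map_carrier)
qed

section \<open>Membership in the relation ideal\<close>

abbreviation R where "R \<equiv> relation_ideal K G"

lemma generators_carrier:
  "{basis_elt K p \<ominus>\<^bsub>path_algebra K G\<^esub> basis_elt K q | p q.
      shortest G p \<and> shortest G q \<and> p \<noteq> q \<and> hd p = hd q \<and> last p = last q} \<union>
    {basis_elt K p | p. p \<in> paths G \<and> \<not> shortest G p} \<subseteq> carrier (path_algebra K G)"
  by (auto simp: basis_elt_eq_monomial P.monomial_carrier shortest_paths)

lemma relation_ideal_ideal: "ideal R (path_algebra K G)"
  unfolding relation_ideal_def by (rule PR.genideal_ideal[OF generators_carrier])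

text \<open>An \<open>ideal\<close> is one of rings; closure under scalars follows because
  \<open>a\<close> acts as left multiplication by the scalar multiple of the unit.\<close>

lemma ideal_smult_closed:
  assumes "ideal I (path_algebra K G)" "a \<in> carrier K" "x \<in> I"
  shows "a \<odot>\<^bsub>path_algebra K G\<^esub> x \<in> I"
proof -
  have x: "x \<in> carrier (path_algebra K G)" using assms(1,3) by (rule ideal.Icarr)
  then have "a \<odot>\<^bsub>path_algebra K G\<^esub> x =
      (a \<odot>\<^bsub>path_algebra K G\<^esub> \<one>\<^bsub>path_algebra K G\<^esub>) \<otimes>\<^bsub>path_algebra K G\<^esub> x"
    using assms(2) by (simp add: P.smult_mult_A)
  then show ?thesis
    using ideal.I_l_closed[OF assms(1,3)] P.smult_carrier[OF assms(2) PR.one_closed] by simp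
qed

text \<open>Adds the case of equal paths to the generators, since a path may be the chosen one for
  its end points.\<close>

lemma shortest_diff_in_relation_ideal:
  assumes "shortest G p" "shortest G q" "hd p = hd q" "last p = last q"
  shows "basis_elt K p \<ominus>\<^bsub>path_algebra K G\<^esub> basis_elt K q \<in> R"
proof (cases "p = q")
  case True
  then have "basis_elt K p \<ominus>\<^bsub>path_algebra K G\<^esub> basis_elt K q = \<zero>\<^bsub>path_algebra K G\<^esub>"
    using assms by (simp add: basis_elt_eq_monomial P.monomial_carrier shortest_paths
        P.Alg.M.minus_eq P.Alg.M.r_neg)
  then show ?thesis
    using relation_ideal_ideal by (simp add: additive_subgroup.zero_closed ideal.axioms(1))
next
  case False
  then show ?thesis
    using PR.genideal_self[OF generators_carrier] assms unfolding relation_ideal_def by blast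
qed

lemma non_shortest_in_relation_ideal:
  "p \<in> paths G \<Longrightarrow> \<not> shortest G p \<Longrightarrow> basis_elt K p \<in> R"
  using PR.genideal_self[OF generators_carrier] unfolding relation_ideal_def by blast

lemma monomial_eq_smult: "a \<in> carrier K \<Longrightarrow> monomial K a p = a \<odot>\<^bsub>path_algebra K G\<^esub> basis_elt K p"
  by (simp add: basis_elt_eq_monomial P.smult_monomial)

lemma diff_section_in_relation_ideal:
  assumes "f \<in> carrier (path_algebra K G)"
  shows "f \<ominus>\<^bsub>path_algebra K G\<^esub> \<sigma>.\<tau> (\<pi>.\<tau> f) \<in> R"
  using assms
proof (induction rule: P.basis_induct)
  case zero
  have "\<zero>\<^bsub>path_algebra K G\<^esub> \<in> R"
    using relation_ideal_ideal by (simp add: additive_subgroup.zero_closed ideal.axioms(1))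
  then show ?case by (simp add: \<pi>.map_zero \<sigma>.map_zero P.Alg.M.minus_eq)
next
  case (add a p f)
  interpret R: ideal R "path_algebra K G" by (rule relation_ideal_ideal)
  let ?m = "monomial K a p"
  have m: "?m \<in> carrier (path_algebra K G)" using add by (simp add: P.monomial_carrier)
  have "?m \<ominus>\<^bsub>path_algebra K G\<^esub> \<sigma>.\<tau> (\<pi>.\<tau> ?m) \<in> R"
  proof (cases "shortest G p")
    case True
    let ?q = "geodesic G (hd p) (last p)"
    have ends: "(hd p, last p) \<in> finite_dist_pairs G"
      using add by (simp add: path_finite_dist_pairs)
    have "\<sigma>.\<tau> (\<pi>.\<tau> ?m) = monomial K a ?q"
      using add True ends by (simp add: \<pi>_monomial \<sigma>_monomial)
    moreover have "basis_elt K p \<in> carrier (path_algebra K G)"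
        "basis_elt K ?q \<in> carrier (path_algebra K G)"
      using add(2) geodesic(1)[OF ends]
      by (simp_all add: basis_elt_eq_monomial P.monomial_carrier shortest_paths)
    \<comment> \<open>For a shortest path the defect is a scalar multiple of a relation of the first
      kind, comparing it with the chosen path.\<close>
    ultimately have "?m \<ominus>\<^bsub>path_algebra K G\<^esub> \<sigma>.\<tau> (\<pi>.\<tau> ?m) =
        a \<odot>\<^bsub>path_algebra K G\<^esub> (basis_elt K p \<ominus>\<^bsub>path_algebra K G\<^esub> basis_elt K ?q)"
      using add(1)
      by (simp add: monomial_eq_smult P.Alg.M.minus_eq P.Alg.smult_r_distr P.Alg.smult_r_minus)
    then show ?thesis
      using ideal_smult_closed[OF relation_ideal_ideal add(1)]
        shortest_diff_in_relation_ideal[of p ?q] True geodesic[OF ends] by simp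
  next
    case False
    \<comment> \<open>For a non-shortest path \<open>\<pi>\<close> vanishes, so the defect is the
      term itself, a multiple of a relation of the second kind.\<close>
    then have "?m \<ominus>\<^bsub>path_algebra K G\<^esub> \<sigma>.\<tau> (\<pi>.\<tau> ?m) = ?m"
      using add m by (simp add: \<pi>_monomial \<sigma>.map_zero P.Alg.M.minus_eq)
    then show ?thesis
      using ideal_smult_closed[OF relation_ideal_ideal add(1)]
        non_shortest_in_relation_ideal[OF add(2) False] monomial_eq_smult[OF add(1)] by simp
  qed
  moreover have "(?m \<oplus>\<^bsub>path_algebra K G\<^esub> f) \<ominus>\<^bsub>path_algebra K G\<^esub> \<sigma>.\<tau> (\<pi>.\<tau> (?m \<oplus>\<^bsub>path_algebra K G\<^esub> f)) =
      (?m \<ominus>\<^bsub>path_algebra K G\<^esub> \<sigma>.\<tau> (\<pi>.\<tau> ?m)) \<oplus>\<^bsub>path_algebra K G\<^esub>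
      (f \<ominus>\<^bsub>path_algebra K G\<^esub> \<sigma>.\<tau> (\<pi>.\<tau> f))"
    using add m
    by (simp add: \<pi>.map_add \<sigma>.map_add \<pi>.map_carrier \<sigma>.map_carrier P.Alg.M.minus_eq P.Alg.M.minus_add P.Alg.M.a_ac)
  ultimately show ?case using add(4) by simp
qed

text \<open>One inclusion holds by minimality of the generated ideal, as \<open>\<pi>\<close> kills
  both kinds of generators; the other is \<open>diff_section_in_relation_ideal\<close> with
  \<open>\<pi> f = 0\<close>.\<close>

lemma relation_ideal_eq_kernel:
  "R = a_kernel (path_algebra K G) (distance_algebra K G) \<pi>.\<tau>"
proof
  interpret h: ring_hom_ring "path_algebra K G" "distance_algebra K G" \<pi>.\<tau>
    by (rule \<pi>.ring_hom_map)
  show "R \<subseteq> a_kernel (path_algebra K G) (distance_algebra K G) \<pi>.\<tau>"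
    unfolding relation_ideal_def
  proof (rule PR.genideal_minimal[OF h.kernel_is_ideal], safe)
    fix p q assume pq: "shortest G p" "shortest G q" "hd p = hd q" "last p = last q"
    have e: "basis_elt K p \<in> carrier (path_algebra K G)" "basis_elt K q \<in> carrier (path_algebra K G)"
      using pq by (simp_all add: basis_elt_eq_monomial P.monomial_carrier shortest_paths)
    have eq: "\<pi>.\<tau> (basis_elt K p) = \<pi>.\<tau> (basis_elt K q)"
      using pq by (simp add: basis_elt_eq_monomial \<pi>_monomial shortest_paths)
    have "\<pi>.\<tau> (basis_elt K p \<ominus>\<^bsub>path_algebra K G\<^esub> basis_elt K q) =
        \<pi>.\<tau> (basis_elt K p) \<oplus>\<^bsub>distance_algebra K G\<^esub> \<ominus>\<^bsub>distance_algebra K G\<^esub> \<pi>.\<tau> (basis_elt K q)"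
      unfolding P.Alg.M.minus_eq
      h.hom_add[OF e(1) P.Alg.M.a_inv_closed[OF e(2)]] h.hom_a_inv[OF e(2)] by (rule refl)
    also have "\<dots> = \<zero>\<^bsub>distance_algebra K G\<^esub>"
      unfolding eq by (rule D.Alg.M.r_neg[OF h.hom_closed[OF e(2)]])
    finally show "basis_elt K p \<ominus>\<^bsub>path_algebra K G\<^esub> basis_elt K q
        \<in> a_kernel (path_algebra K G) (distance_algebra K G) \<pi>.\<tau>"
      unfolding a_kernel_def' using P.Alg.M.minus_closed[OF e] by blast
  next
    fix p assume p: "p \<in> paths G" "\<not> shortest G p"
    then show "basis_elt K p \<in> a_kernel (path_algebra K G) (distance_algebra K G) \<pi>.\<tau>"
      unfolding a_kernel_def' basis_elt_eq_monomial
      using P.monomial_carrier[of \<one> p] \<pi>_monomial[of \<one> p] by auto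
  qed
  show "a_kernel (path_algebra K G) (distance_algebra K G) \<pi>.\<tau> \<subseteq> R"
  proof
    fix f assume "f \<in> a_kernel (path_algebra K G) (distance_algebra K G) \<pi>.\<tau>"
    then have f: "f \<in> carrier (path_algebra K G)" "\<pi>.\<tau> f = \<zero>\<^bsub>distance_algebra K G\<^esub>"
      unfolding a_kernel_def' by auto
    have "f \<ominus>\<^bsub>path_algebra K G\<^esub> \<sigma>.\<tau> (\<pi>.\<tau> f) = f"
      unfolding f(2) \<sigma>.map_zero P.Alg.M.minus_eq using f(1) by simp
    then show "f \<in> R"
      using diff_section_in_relation_ideal[OF f(1)] by (simp only:)
  qed
qed

theorem distance_algebra_isomorphic_quotient:
  "graded_algebra_isomorphic K (distance_algebra K G) (quotient_algebra (path_algebra K G) R)"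
  unfolding relation_ideal_eq_kernel
proof (rule graded_algebra_isomorphic_quotient[OF P.graded_algebra_A D.graded_algebra_A \<pi>.ring_hom_map])
  show "\<pi>.\<tau> (a \<odot>\<^bsub>path_algebra K G\<^esub> x) = a \<odot>\<^bsub>distance_algebra K G\<^esub> \<pi>.\<tau> x"
    if "a \<in> carrier K" "x \<in> carrier (path_algebra K G)" for a x
    using that by (rule \<pi>.map_smult)
  show "\<pi>.\<tau> ` carrier (path_algebra K G) = carrier (distance_algebra K G)"
  proof
    show "carrier (distance_algebra K G) \<subseteq> \<pi>.\<tau> ` carrier (path_algebra K G)"
      by (metis \<pi>_\<sigma> \<sigma>.map_carrier imageI subsetI)
  qed (auto simp: \<pi>.map_carrier)
  show "\<pi>.\<tau> ` grade (path_algebra K G) n = grade (distance_algebra K G) n" for n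
  proof
    have "\<pi>.\<tau> f \<in> grade (distance_algebra K G) n" if "f \<in> grade (path_algebra K G) n" for f
      by (rule \<pi>.map_grade[OF _ that])
        (auto simp: ends_eq_Some_iff shortest_length simp del: vwalk_length_simp)
    then show "\<pi>.\<tau> ` grade (path_algebra K G) n \<subseteq> grade (distance_algebra K G) n" by blast
    have "f \<in> \<pi>.\<tau> ` grade (path_algebra K G) n" if f: "f \<in> grade (distance_algebra K G) n" for f
    proof -
      \<comment> \<open>The chosen path has the distance as its length, so \<open>\<sigma>\<close>
        provides a homogeneous preimage of the same degree.\<close>
      have "\<sigma>.\<tau> f \<in> grade (path_algebra K G) n"
      proof (rule \<sigma>.map_grade[OF _ f])
        fix p r assume pr: "p \<in> finite_dist_pairs G" "geod p = Some r"
        obtain x y where p: "p = (x, y)" by (cases p)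
        show "vwalk_length r = (case p of (x, y) \<Rightarrow> the_enat (gdist G x y))"
          using pr p geodesic[of x y G] shortest_length[of G "geodesic G x y"]
          by (auto simp: geod_def simp del: vwalk_length_simp)
      qed
      moreover have "f \<in> carrier (distance_algebra K G)" using f by (simp add: D.grade_iff)
      ultimately show ?thesis using \<pi>_\<sigma> by (metis imageI)
    qed
    then show "grade (distance_algebra K G) n \<subseteq> \<pi>.\<tau> ` grade (path_algebra K G) n" by blast
  qed
qed

section \<open>Admissibility\<close>

text \<open>The length filtration: a condition on coefficients that bounds the powers of
  \<open>J\<close> from above, where membership in a power itself is given by generation.\<close>

definition long_ideal :: "nat \<Rightarrow> ('v list \<Rightarrow> 'k) set" where
  "long_ideal n = {f \<in> carrier (path_algebra K G). \<forall>p. f p \<noteq> \<zero> \<longrightarrow> n \<le> vwalk_length p}"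

text \<open>Lengths add under concatenation. With one index zero this is absorption by the ideal;
  with \<open>n = 1\<close> it is the induction step for powers of \<open>J\<close>.\<close>

lemma long_ideal_mult:
  assumes "f \<in> long_ideal m" "g \<in> long_ideal n"
  shows "f \<otimes>\<^bsub>path_algebra K G\<^esub> g \<in> long_ideal (m + n)"
proof -
  have fg: "f \<in> carrier (path_algebra K G)" "g \<in> carrier (path_algebra K G)"
    using assms by (auto simp: long_ideal_def)
  have "m + n \<le> vwalk_length r" if nz: "(f \<otimes>\<^bsub>path_algebra K G\<^esub> g) r \<noteq> \<zero>" for r
  proof -
    obtain p q where pq: "p \<in> paths G" "q \<in> paths G" "f p \<noteq> \<zero>" "g q \<noteq> \<zero>"
        "(if joinable p q then Some (vwalk_join p q) else None) = Some r"
      using P.mult_coeff_nonzero[OF fg nz] .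
    then have "vwalk_length r = vwalk_length p + vwalk_length q"
      by (auto simp del: vwalk_length_simp split: if_splits)
    moreover have "m \<le> vwalk_length p" "n \<le> vwalk_length q"
      using assms pq by (auto simp: long_ideal_def simp del: vwalk_length_simp)
    ultimately show ?thesis by linarith
  qed
  then show ?thesis using fg by (simp add: long_ideal_def P.mult_carrier del: vwalk_length_simp)
qed

lemma long_ideal_0: "long_ideal 0 = carrier (path_algebra K G)"
  by (simp add: long_ideal_def)

lemma long_ideal_add:
  assumes "f \<in> long_ideal n" "g \<in> long_ideal n"
  shows "f \<oplus>\<^bsub>path_algebra K G\<^esub> g \<in> long_ideal n"
proof -
  have "n \<le> vwalk_length p" if "f p \<oplus> g p \<noteq> \<zero>" for p
    using that assms
    by (cases "f p = \<zero>") (auto simp: long_ideal_def P.carrier_coeff simp del: vwalk_length_simp)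
  then show ?thesis
    using assms P.add_carrier[of f g]
    by (simp add: long_ideal_def P.add_apply del: vwalk_length_simp)
qed

lemma long_ideal_ideal: "ideal (long_ideal n) (path_algebra K G)"
proof (rule idealI[OF P.ring_A])
  show "subgroup (long_ideal n) (add_monoid (path_algebra K G))"
  proof (rule P.Alg.M.add.subgroupI)
    show "long_ideal n \<subseteq> carrier (path_algebra K G)" by (auto simp: long_ideal_def)
    have "\<zero>\<^bsub>path_algebra K G\<^esub> \<in> long_ideal n" by (auto simp: long_ideal_def P.zero_apply)
    then show "long_ideal n \<noteq> {}" by blast
    show "\<ominus>\<^bsub>path_algebra K G\<^esub> f \<in> long_ideal n" if "f \<in> long_ideal n" for f
    proof -
      have "n \<le> vwalk_length p" if "\<ominus> f p \<noteq> \<zero>" for p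
        using that \<open>f \<in> long_ideal n\<close>
        by (cases "f p = \<zero>") (auto simp: long_ideal_def simp del: vwalk_length_simp)
      then show ?thesis
        using that P.Alg.M.a_inv_closed[of f]
        by (simp add: long_ideal_def P.a_inv_eq del: vwalk_length_simp)
    qed
  qed (rule long_ideal_add)
  show "x \<otimes>\<^bsub>path_algebra K G\<^esub> f \<in> long_ideal n" "f \<otimes>\<^bsub>path_algebra K G\<^esub> x \<in> long_ideal n"
    if "f \<in> long_ideal n" "x \<in> carrier (path_algebra K G)" for f x
    using that long_ideal_mult[of x 0 f n] long_ideal_mult[of f n x 0] by (auto simp: long_ideal_0)
qed

lemma arrow_generators_carrier:
  "{basis_elt K p | p. p \<in> paths G \<and> vwalk_length p > 0} \<subseteq> carrier (path_algebra K G)"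
  by (auto simp: basis_elt_eq_monomial P.monomial_carrier)

abbreviation J where "J \<equiv> arrow_ideal K G"

lemma arrow_ideal_ideal: "ideal J (path_algebra K G)"
  unfolding arrow_ideal_def by (rule PR.genideal_ideal[OF arrow_generators_carrier])

lemma basis_elt_in_arrow_ideal:
  "p \<in> paths G \<Longrightarrow> vwalk_length p > 0 \<Longrightarrow> basis_elt K p \<in> J"
  using PR.genideal_self[OF arrow_generators_carrier] unfolding arrow_ideal_def by blast

lemma arrow_ideal_subset_long: "J \<subseteq> long_ideal 1"
  unfolding arrow_ideal_def
proof (rule PR.genideal_minimal[OF long_ideal_ideal], safe)
  fix p assume p: "p \<in> paths G" "vwalk_length p > 0"
  have "1 \<le> vwalk_length q" if "monomial K \<one> p q \<noteq> \<zero>" for q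
    using P.support_monomial[OF that] p(2) by simp
  then show "basis_elt K p \<in> long_ideal 1"
    using p by (simp add: long_ideal_def basis_elt_eq_monomial P.monomial_carrier del: vwalk_length_simp)
qed

text \<open>The zeroth power is the whole algebra, the unit for products of ideals, so the square
  unfolds to a product of three ideals.\<close>

lemma ideals_set_pow:
  "J [^]\<^bsub>ideals_set (path_algebra K G)\<^esub> (0::nat) = carrier (path_algebra K G)"
  "J [^]\<^bsub>ideals_set (path_algebra K G)\<^esub> Suc n =
    ideal_prod (path_algebra K G) (J [^]\<^bsub>ideals_set (path_algebra K G)\<^esub> n) J"
  by (simp_all add: nat_pow_def) (simp_all add: ideals_set_def)

lemma arrow_ideal_pow_subset_long: "J [^]\<^bsub>ideals_set (path_algebra K G)\<^esub> n \<subseteq> long_ideal n"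
proof (induction n)
  case 0
  show ?case unfolding ideals_set_pow long_ideal_0 by (rule subset_refl)
next
  case (Suc n)
  show ?case
  proof
    fix f assume "f \<in> J [^]\<^bsub>ideals_set (path_algebra K G)\<^esub> Suc n"
    then have "f \<in> ideal_prod (path_algebra K G) (J [^]\<^bsub>ideals_set (path_algebra K G)\<^esub> n) J"
      by (simp only: ideals_set_pow)
    then show "f \<in> long_ideal (Suc n)"
    proof (induction rule: ideal_prod.induct)
      case (prod i j)
      then show ?case
        using long_ideal_mult[of i n j 1] Suc arrow_ideal_subset_long by auto
    next
      case (sum f g)
      then show ?case by (intro long_ideal_add)
    qed
  qed
qed

lemma basis_elt_in_arrow_ideal_square:
  assumes p: "p \<in> paths G" "vwalk_length p \<ge> 2"
  shows "basis_elt K p \<in> J [^]\<^bsub>ideals_set (path_algebra K G)\<^esub> (2::nat)"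
proof -
  obtain q where q: "vwalk_join [hd p, hd q] q = p" "q \<in> paths G" "[hd p, hd q] \<in> paths G"
    "joinable [hd p, hd q] q" "last q = last p" "vwalk_length p = Suc (vwalk_length q)"
    using path_split_first[OF p(1)] p(2) by (metis less_le_trans pos2)
  let ?r = "[hd p, hd q]"
  have rJ: "basis_elt K ?r \<in> J" and qJ: "basis_elt K q \<in> J"
    using q p(2) by (auto intro!: basis_elt_in_arrow_ideal)
  \<comment> \<open>The square of \<open>J\<close> unfolds to the algebra times \<open>J\<close>,
    times \<open>J\<close>; the factor one brings the first arrow into the inner product.\<close>
  have "\<one>\<^bsub>path_algebra K G\<^esub> \<otimes>\<^bsub>path_algebra K G\<^esub> basis_elt K ?r
      \<in> ideal_prod (path_algebra K G) (carrier (path_algebra K G)) J"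
    by (rule ideal_prod.prod[OF PR.one_closed rJ])
  then have "basis_elt K ?r \<in> ideal_prod (path_algebra K G) (carrier (path_algebra K G)) J"
    using ideal.Icarr[OF arrow_ideal_ideal rJ] by simp
  then have "basis_elt K ?r \<otimes>\<^bsub>path_algebra K G\<^esub> basis_elt K q
      \<in> J [^]\<^bsub>ideals_set (path_algebra K G)\<^esub> (2::nat)"
    unfolding numeral_2_eq_2 ideals_set_pow by (rule ideal_prod.prod[OF _ qJ])
  also have "basis_elt K ?r \<otimes>\<^bsub>path_algebra K G\<^esub> basis_elt K q = basis_elt K p"
    unfolding basis_elt_eq_monomial using q P.monomial_mult[of \<one> \<one> ?r q] by simp
  finally show ?thesis .
qed

theorem relation_ideal_admissible: "admissible K G R"
  unfolding admissible_def
proof (intro conjI)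
  show "ideal R (path_algebra K G)" by (rule relation_ideal_ideal)
  obtain n where n: "\<And>p. shortest G p \<Longrightarrow> vwalk_length p < n"
    using shortest_length_bound by blast
  \<comment> \<open>Every shortest path is shorter than \<open>n\<close>, so none occurs in such an
    element and \<open>\<pi>\<close> kills it.\<close>
  have "long_ideal n \<subseteq> R"
  proof
    fix f assume f: "f \<in> long_ideal n"
    have "\<pi>.\<tau> f r = \<zero>" for r
    proof (rule ccontr)
      assume "\<pi>.\<tau> f r \<noteq> \<zero>"
      then obtain p where p: "f p \<noteq> \<zero>" "ends p = Some r" by (rule \<pi>.map_coeff_nonzero)
      then have "n \<le> vwalk_length p" using f by (simp add: long_ideal_def del: vwalk_length_simp)
      moreover have "shortest G p" using p(2) by (simp add: ends_def split: if_splits)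
      ultimately show False using n by fastforce
    qed
    then have "\<pi>.\<tau> f = \<zero>\<^bsub>distance_algebra K G\<^esub>" by (auto simp: D.zero_apply)
    then show "f \<in> R"
      using f unfolding relation_ideal_eq_kernel a_kernel_def' long_ideal_def by auto
  qed
  moreover have "R \<subseteq> J [^]\<^bsub>ideals_set (path_algebra K G)\<^esub> (2::nat)"
  proof -
    have J2: "ideal (J [^]\<^bsub>ideals_set (path_algebra K G)\<^esub> (2::nat)) (path_algebra K G)"
      unfolding numeral_2_eq_2 ideals_set_pow
      by (intro PR.ideal_prod_is_ideal PR.oneideal arrow_ideal_ideal)
    then interpret J2: ideal "J [^]\<^bsub>ideals_set (path_algebra K G)\<^esub> (2::nat)" "path_algebra K G" .
    show ?thesis
      unfolding relation_ideal_def
    proof (rule PR.genideal_minimal[OF J2], safe)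
      fix p q assume pq: "shortest G p" "shortest G q" "p \<noteq> q" "hd p = hd q" "last p = last q"
      have paths: "p \<in> paths G" "q \<in> paths G" using pq by (simp_all add: shortest_paths)
      \<comment> \<open>Both lengths equal the distance of the common end points. Lengths zero and
        one are then excluded, since the paths would coincide.\<close>
      have eq: "vwalk_length p = vwalk_length q"
        using pq shortest_length by metis
      have "vwalk_length p \<noteq> 0"
        using path_length_0[OF paths(1)] path_length_0[OF paths(2)] eq pq(3,4) by metis
      moreover have "vwalk_length p \<noteq> 1"
        using path_length_1[OF paths(1)] path_length_1[OF paths(2)] eq pq(3,4,5) by metis
      ultimately have "vwalk_length p \<ge> 2" by linarith
      then have "basis_elt K p \<in> J [^]\<^bsub>ideals_set (path_algebra K G)\<^esub> (2::nat)"
        "basis_elt K q \<in> J [^]\<^bsub>ideals_set (path_algebra K G)\<^esub> (2::nat)"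
        using basis_elt_in_arrow_ideal_square paths eq by metis+
      then show "basis_elt K p \<ominus>\<^bsub>path_algebra K G\<^esub> basis_elt K q
          \<in> J [^]\<^bsub>ideals_set (path_algebra K G)\<^esub> (2::nat)"
        by (simp add: P.Alg.M.minus_eq)
    next
      fix p assume p: "p \<in> paths G" "\<not> shortest G p"
      then have "vwalk_length p \<ge> 2" using shortest_of_length_le_1[OF p(1)] by linarith
      then show "basis_elt K p \<in> J [^]\<^bsub>ideals_set (path_algebra K G)\<^esub> (2::nat)"
        by (rule basis_elt_in_arrow_ideal_square[OF p(1)])
    qed
  qed
  ultimately show "\<exists>n::nat. J [^]\<^bsub>ideals_set (path_algebra K G)\<^esub> n \<subseteq> R \<and>
      R \<subseteq> J [^]\<^bsub>ideals_set (path_algebra K G)\<^esub> (2::nat)"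
    using arrow_ideal_pow_subset_long[of n] by blast
qed

end


section \<open>Categories of vertex families\<close>

lemma (in graded_module) grade_carrier: "x \<in> grade M n \<Longrightarrow> x \<in> carrier M"
  using grade_submodule[of n] by (auto simp: submodule_def dest: subgroup.mem_carrier)

lemma graded_homI:
  assumes "\<And>n. grade M n \<subseteq> carrier M"
    and "\<And>x. x \<in> carrier M \<Longrightarrow> f x \<in> carrier N"
    and "\<And>x y. x \<in> carrier M \<Longrightarrow> y \<in> carrier M \<Longrightarrow> x \<oplus>\<^bsub>M\<^esub> y \<in> carrier M"
    and "\<And>a x. a \<in> carrier K \<Longrightarrow> x \<in> carrier M \<Longrightarrow> a \<odot>\<^bsub>M\<^esub> x \<in> carrier M"
    and "\<And>x y. x \<in> carrier M \<Longrightarrow> y \<in> carrier M \<Longrightarrow> f (x \<oplus>\<^bsub>M\<^esub> y) = f x \<oplus>\<^bsub>N\<^esub> f y"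
    and "\<And>a x. a \<in> carrier K \<Longrightarrow> x \<in> carrier M \<Longrightarrow> f (a \<odot>\<^bsub>M\<^esub> x) = a \<odot>\<^bsub>N\<^esub> f x"
    and "\<And>n x. x \<in> grade M n \<Longrightarrow> f x \<in> grade N (n + d)"
  shows "restrict f (carrier M) \<in> graded_hom K d M N"
proof -
  have "(\<lambda>x\<in>carrier M. f x) x = f x" if "x \<in> grade M n" for x n
    using assms(1) that by auto
  then show ?thesis using assms(2-) by (simp add: graded_hom_def)
qed

lemma graded_homD:
  assumes "f \<in> graded_hom K d M N"
  shows "x \<in> carrier M \<Longrightarrow> f x \<in> carrier N"
    and "x \<in> carrier M \<Longrightarrow> y \<in> carrier M \<Longrightarrow> f (x \<oplus>\<^bsub>M\<^esub> y) = f x \<oplus>\<^bsub>N\<^esub> f y"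
    and "a \<in> carrier K \<Longrightarrow> x \<in> carrier M \<Longrightarrow> f (a \<odot>\<^bsub>M\<^esub> x) = a \<odot>\<^bsub>N\<^esub> f x"
    and "x \<in> grade M n \<Longrightarrow> f x \<in> grade N (n + d)"
    and "x \<notin> carrier M \<Longrightarrow> f x = undefined"
    and "f \<in> extensional (carrier M)"
  using assms by (auto simp: graded_hom_def PiE_def extensional_def)

lemma graded_hom_id:
  assumes "graded_module K M"
  shows "(\<lambda>m\<in>carrier M. m) \<in> graded_hom K 0 M M"
proof -
  interpret graded_module K M by fact
  show ?thesis by (rule graded_homI) (auto simp: grade_carrier)
qed

lemma graded_hom_compose:
  assumes "graded_module K M" and f: "f \<in> graded_hom K d M N" and g: "g \<in> graded_hom K e N L"
  shows "compose (carrier M) g f \<in> graded_hom K (d + e) M L"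
proof -
  interpret graded_module K M by fact
  show ?thesis
    unfolding compose_def
  proof (rule graded_homI)
    show "g (f x) \<in> grade L (n + (d + e))" if "x \<in> grade M n" for x n
      using graded_homD(4)[OF g graded_homD(4)[OF f that]] by (simp add: add.assoc)
  qed (auto simp: grade_carrier graded_homD[OF f] graded_homD[OF g])
qed

lemma compose_extensional_id:
  assumes "f \<in> extensional S"
  shows "compose S f (\<lambda>x\<in>S. x) = f"
  using assms by (auto simp: compose_def fun_eq_iff extensional_def)

lemma compose_id_extensional:
  assumes "f \<in> extensional S" "\<And>x. x \<in> S \<Longrightarrow> f x \<in> T"
  shows "compose S (\<lambda>x\<in>T. x) f = f"
  using assms by (auto simp: compose_def fun_eq_iff extensional_def)

lemma family_homsD:
  assumes "\<phi> \<in> family_homs K G P M N"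
  shows "x \<in> pverts G \<Longrightarrow> \<phi> x \<in> graded_hom K 0 (vmod M x) (vmod N x)"
    and "x \<notin> pverts G \<Longrightarrow> \<phi> x = undefined"
    and "(x, y) \<in> P \<Longrightarrow> m \<in> carrier (vmod M x) \<Longrightarrow> vmap N (x, y) (\<phi> x m) = \<phi> y (vmap M (x, y) m)"
  using assms by (auto simp: family_homs_def PiE_def extensional_def)

lemma family_category_sel:
  "Obj (family_category K G P Ob) = Ob"
  "Arr (family_category K G P Ob) = family_homs K G P"
  "Ident (family_category K G P Ob) M = (\<lambda>x\<in>pverts G. \<lambda>m\<in>carrier (vmod M x). m)"
  "Cmp (family_category K G P Ob) L M N \<psi> \<phi> =
    (\<lambda>x\<in>pverts G. compose (carrier (vmod L x)) (\<psi> x) (\<phi> x))"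
  by (simp_all add: family_category_def)

text \<open>The two categories differ only in their objects and in the set \<open>P\<close> of
  pairs, so one proof serves both. The identity laws hold as equalities because families and maps
  are extensional.\<close>

lemma category_family:
  assumes mod: "\<And>M x. M \<in> Ob \<Longrightarrow> x \<in> pverts G \<Longrightarrow> graded_module K (vmod M x)"
    and verts: "\<And>x y. (x, y) \<in> P \<Longrightarrow> x \<in> pverts G \<and> y \<in> pverts G"
    and closed: "\<And>M x y m. M \<in> Ob \<Longrightarrow> (x, y) \<in> P \<Longrightarrow> m \<in> carrier (vmod M x) \<Longrightarrow>
      vmap M (x, y) m \<in> carrier (vmod M y)"
  shows "category (family_category K G P Ob)"
proof (rule category.intro; unfold family_category_sel)
  fix M assume M: "M \<in> Ob"
  show "(\<lambda>x\<in>pverts G. \<lambda>m\<in>carrier (vmod M x). m) \<in> family_homs K G P M M"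
    unfolding family_homs_def
    using graded_hom_id[OF mod[OF M]] verts closed[OF M] by (auto simp: PiE_def Pi_def)
next
  fix L M N \<phi> \<psi> assume ob: "L \<in> Ob" "M \<in> Ob" "N \<in> Ob"
    and \<phi>: "\<phi> \<in> family_homs K G P L M" and \<psi>: "\<psi> \<in> family_homs K G P M N"
  show "(\<lambda>x\<in>pverts G. compose (carrier (vmod L x)) (\<psi> x) (\<phi> x)) \<in> family_homs K G P L N"
    unfolding family_homs_def
  proof (intro CollectI conjI PiE_I ballI)
    fix x assume x: "x \<in> pverts G"
    show "(\<lambda>x\<in>pverts G. compose (carrier (vmod L x)) (\<psi> x) (\<phi> x)) x
        \<in> graded_hom K 0 (vmod L x) (vmod N x)"
      using graded_hom_compose[OF mod[OF ob(1) x] family_homsD(1)[OF \<phi> x] family_homsD(1)[OF \<psi> x]] x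
      by simp
  next
    fix xy assume "xy \<in> P"
    then obtain x y where xy: "xy = (x, y)" "(x, y) \<in> P" by (cases xy) auto
    then have v: "x \<in> pverts G" "y \<in> pverts G" using verts by auto
    have "vmap N (x, y) (\<psi> x (\<phi> x m)) = \<psi> y (\<phi> y (vmap L (x, y) m))"
      if "m \<in> carrier (vmod L x)" for m
      using that family_homsD(3)[OF \<psi> xy(2)] family_homsD(3)[OF \<phi> xy(2)]
        graded_homD(1)[OF family_homsD(1)[OF \<phi> v(1)]] by simp
    then show "case xy of (x, y) \<Rightarrow> \<forall>m\<in>carrier (vmod L x).
        vmap N (x, y) ((\<lambda>x\<in>pverts G. compose (carrier (vmod L x)) (\<psi> x) (\<phi> x)) x m) =
        (\<lambda>x\<in>pverts G. compose (carrier (vmod L x)) (\<psi> x) (\<phi> x)) y (vmap L (x, y) m)"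
      using xy v closed[OF ob(1) xy(2)] by (simp add: compose_eq)
  qed simp
next
  fix M N \<phi> assume ob: "M \<in> Ob" "N \<in> Ob" and \<phi>: "\<phi> \<in> family_homs K G P M N"
  show "(\<lambda>x\<in>pverts G. compose (carrier (vmod M x)) (\<phi> x)
      ((\<lambda>x\<in>pverts G. \<lambda>m\<in>carrier (vmod M x). m) x)) = \<phi>"
  proof
    fix x
    show "(\<lambda>x\<in>pverts G. compose (carrier (vmod M x)) (\<phi> x)
      ((\<lambda>x\<in>pverts G. \<lambda>m\<in>carrier (vmod M x). m) x)) x = \<phi> x"
    proof (cases "x \<in> pverts G")
      case True
      note h = family_homsD(1)[OF \<phi> True]
      show ?thesis using True compose_extensional_id[OF graded_homD(6)[OF h]] by simp
    qed (simp add: family_homsD(2)[OF \<phi>])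
  qed
  show "(\<lambda>x\<in>pverts G. compose (carrier (vmod M x))
      ((\<lambda>x\<in>pverts G. \<lambda>m\<in>carrier (vmod N x). m) x) (\<phi> x)) = \<phi>"
  proof
    fix x
    show "(\<lambda>x\<in>pverts G. compose (carrier (vmod M x))
      ((\<lambda>x\<in>pverts G. \<lambda>m\<in>carrier (vmod N x). m) x) (\<phi> x)) x = \<phi> x"
    proof (cases "x \<in> pverts G")
      case True
      note h = family_homsD(1)[OF \<phi> True]
      show ?thesis using True compose_id_extensional[OF graded_homD(6)[OF h] graded_homD(1)[OF h]] by simp
    qed (simp add: family_homsD(2)[OF \<phi>])
  qed
next
  fix W X Y Z f g h
  assume f: "f \<in> family_homs K G P W X"
  show "(\<lambda>x\<in>pverts G. compose (carrier (vmod W x)) (h x)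
        ((\<lambda>x\<in>pverts G. compose (carrier (vmod W x)) (g x) (f x)) x)) =
      (\<lambda>x\<in>pverts G. compose (carrier (vmod W x))
        ((\<lambda>x\<in>pverts G. compose (carrier (vmod X x)) (h x) (g x)) x) (f x))"
    using graded_homD(1)[OF family_homsD(1)[OF f]]
    by (intro restrict_ext) (auto simp: compose_def fun_eq_iff)
qed

text \<open>Identities and composites are computed from the vertex modules only, so a functor that
  keeps these may leave morphisms unchanged.\<close>

lemma family_functor:
  assumes C: "category (family_category K G P Ob)" and D: "category (family_category K G P' Ob')"
    and obj: "\<And>M. M \<in> Ob \<Longrightarrow> F M \<in> Ob'"
    and vmod: "\<And>M. M \<in> Ob \<Longrightarrow> vmod (F M) = vmod M"
    and homs: "\<And>M N. M \<in> Ob \<Longrightarrow> N \<in> Ob \<Longrightarrow> family_homs K G P M N \<subseteq> family_homs K G P' (F M) (F N)"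
  shows "cat_functor (family_category K G P Ob) (family_category K G P' Ob')
    \<lparr>on_obj = F, on_arr = (\<lambda>X Y f. f)\<rparr>"
  by (intro cat_functor.intro C D cat_functor_axioms.intro)
    (use obj homs in \<open>auto simp: family_category_sel vmod\<close>)

text \<open>The components are identities, and naturality becomes the two identity laws.\<close>

lemma naturally_isomorphic_identity:
  assumes "category C"
    and obj: "\<And>X. X \<in> Obj C \<Longrightarrow> on_obj F X = X"
    and arr: "\<And>X Y f. X \<in> Obj C \<Longrightarrow> Y \<in> Obj C \<Longrightarrow> f \<in> Arr C X Y \<Longrightarrow> on_arr F X Y f = f"
  shows "naturally_isomorphic C C F id_functor"
proof -
  interpret category C by fact
  show ?thesis
    unfolding naturally_isomorphic_def
  proof (intro exI[of _ "Ident C"] conjI ballI)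
    fix X assume X: "X \<in> Obj C"
    show "is_isomorphism C (on_obj F X) (on_obj id_functor X) (Ident C X)"
      unfolding is_isomorphism_def
      using X by (auto simp: id_functor_def obj Ident_Arr Cmp_Ident_left intro!: bexI[of _ "Ident C X"])
  next
    fix X Y f assume "X \<in> Obj C" "Y \<in> Obj C" "f \<in> Arr C X Y"
    then show "Cmp C (on_obj F X) (on_obj F Y) (on_obj id_functor Y) (Ident C Y) (on_arr F X Y f) =
      Cmp C (on_obj F X) (on_obj id_functor X) (on_obj id_functor Y) (on_arr id_functor X Y f) (Ident C X)"
      by (simp add: id_functor_def obj arr Cmp_Ident_left Cmp_Ident_right)
  qed
qed

lemma family_equivalence:
  assumes F: "cat_functor (family_category K G P Ob) (family_category K G P' Ob')
      \<lparr>on_obj = F, on_arr = (\<lambda>X Y f. f)\<rparr>"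
    and H: "cat_functor (family_category K G P' Ob') (family_category K G P Ob)
      \<lparr>on_obj = H, on_arr = (\<lambda>X Y f. f)\<rparr>"
    and inv: "\<And>M. M \<in> Ob \<Longrightarrow> H (F M) = M" "\<And>M. M \<in> Ob' \<Longrightarrow> F (H M) = M"
  shows "category_equivalence (family_category K G P Ob) (family_category K G P' Ob')
    \<lparr>on_obj = F, on_arr = (\<lambda>X Y f. f)\<rparr>"
  unfolding category_equivalence_def
proof (intro conjI exI)
  have "category (family_category K G P Ob)" "category (family_category K G P' Ob')"
    using F by (simp_all add: cat_functor_def)
  then show "naturally_isomorphic (family_category K G P Ob) (family_category K G P Ob)
      (comp_functor \<lparr>on_obj = H, on_arr = (\<lambda>X Y f. f)\<rparr> \<lparr>on_obj = F, on_arr = (\<lambda>X Y f. f)\<rparr>) id_functor"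
    and "naturally_isomorphic (family_category K G P' Ob') (family_category K G P' Ob')
      (comp_functor \<lparr>on_obj = F, on_arr = (\<lambda>X Y f. f)\<rparr> \<lparr>on_obj = H, on_arr = (\<lambda>X Y f. f)\<rparr>) id_functor"
    by (auto intro!: naturally_isomorphic_identity simp: comp_functor_def family_category_sel inv)
qed (fact F, fact H)

section \<open>Path maps\<close>

lemma path_map_singleton [simp]: "path_map V [x] m = m"
  by (simp add: path_map_def)

lemma path_map_Cons: "path_map V (x # y # xs) m = path_map V (y # xs) (vmap V (x, y) m)"
  by (simp add: path_map_def)

lemma path_map_vwalk_join:
  "joinable p q \<Longrightarrow> path_map V (vwalk_join p q) m = path_map V q (path_map V p m)"
  by (simp add: path_map_def vwalk_join_arcs)

lemma path_map_cong:
  assumes "p \<in> paths G" "\<And>x y. (x, y) \<in> parcs G \<Longrightarrow> vmap V (x, y) = vmap W (x, y)"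
  shows "path_map V p m = path_map W p m"
  unfolding path_map_def
proof (rule fold_cong[OF refl refl])
  fix a assume "a \<in> set (vwalk_arcs p)"
  then have "a \<in> parcs G" using assms(1) by (auto simp: paths_def vwalk_def)
  then show "vmap V a = vmap W a" using assms(2)[of "fst a" "snd a"] by simp
qed

context pair_digraph
begin

lemma finite_dist_pairs_verts: "(x, y) \<in> finite_dist_pairs G \<Longrightarrow> x \<in> pverts G \<and> y \<in> pverts G"
  by (auto simp: finite_dist_pairs_def)

text \<open>Each arrow raises the degree by one. The restriction makes the map extensional: along a
  trivial path, \<open>path_map\<close> is the identity of the whole type.\<close>

lemma path_map_graded_hom:
  assumes V: "graded_rep K G V"
  shows "p \<in> paths G \<Longrightarrow> restrict (path_map V p) (carrier (vmod V (hd p)))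
    \<in> graded_hom K (int (vwalk_length p)) (vmod V (hd p)) (vmod V (last p))"
proof (induction p rule: vwalk_arcs.induct)
  case 1
  then show ?case by simp
next
  case (2 x)
  then have "graded_module K (vmod V x)" using V by (simp add: graded_rep_def)
  then show ?case using graded_hom_id by (fastforce simp: restrict_def)
next
  case (3 x y xs)
  have arc: "(x, y) \<in> parcs G" and q: "y # xs \<in> paths G" using paths_Cons[OF 3(2)] by auto
  have vxy: "vmap V (x, y) \<in> graded_hom K 1 (vmod V x) (vmod V y)"
    using V arc by (auto simp: graded_rep_def)
  have mod: "graded_module K (vmod V x)"
    using V in_arcsD1[OF arc] by (simp add: graded_rep_def)
  have "restrict (path_map V (x # y # xs)) (carrier (vmod V x)) =
      compose (carrier (vmod V x)) (restrict (path_map V (y # xs)) (carrier (vmod V y))) (vmap V (x, y))"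
    using graded_homD(1)[OF vxy] by (auto simp: compose_def fun_eq_iff path_map_Cons)
  moreover have "int (vwalk_length (x # y # xs)) = 1 + int (vwalk_length (y # xs))" by simp
  moreover have "last (x # y # xs) = last (y # xs)" by simp
  ultimately show ?case
    using graded_hom_compose[OF mod vxy 3(1)[OF q, unfolded list.sel]] by (simp only: list.sel)
qed

lemma path_map_carrier:
  assumes "graded_rep K G V" "p \<in> paths G" "m \<in> carrier (vmod V (hd p))"
  shows "path_map V p m \<in> carrier (vmod V (last p))"
  using graded_homD(1)[OF path_map_graded_hom[OF assms(1,2)], of m] assms(3) by simp

text \<open>Commutation with arrows propagates along a path. Applied to the chosen paths, it turns
  morphisms of representations into morphisms of distance modules.\<close>

lemma path_map_natural:
  assumes \<phi>: "\<phi> \<in> family_homs K G (parcs G) V W" and V: "graded_rep K G V"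
  shows "p \<in> paths G \<Longrightarrow> m \<in> carrier (vmod V (hd p)) \<Longrightarrow>
    path_map W p (\<phi> (hd p) m) = \<phi> (last p) (path_map V p m)"
proof (induction p arbitrary: m rule: vwalk_arcs.induct)
  case (3 x y xs)
  have arc: "(x, y) \<in> parcs G" and q: "y # xs \<in> paths G" using paths_Cons[OF 3(2)] by auto
  have "vmap V (x, y) \<in> graded_hom K 1 (vmod V x) (vmod V y)"
    using V arc by (auto simp: graded_rep_def)
  then have "vmap V (x, y) m \<in> carrier (vmod V y)"
    using graded_homD(1) 3(3) by fastforce
  then show ?case
    using 3(1)[OF q] 3(3) family_homsD(3)[OF \<phi> arc] by (simp add: path_map_Cons)
qed simp_all

text \<open>Splitting off the first arrow, the composition law of distance modules and the criterion
  for a joined path to be shortest make the same case distinction.\<close>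

lemma distance_path_map:
  assumes M: "distance_module K G M"
  shows "p \<in> paths G \<Longrightarrow> m \<in> carrier (vmod M (hd p)) \<Longrightarrow>
    path_map M p m =
      (if shortest G p then vmap M (hd p, last p) m else \<zero>\<^bsub>vmod M (last p)\<^esub>)"
proof (induction p arbitrary: m rule: vwalk_arcs.induct)
  case (2 x)
  then show ?case using M shortest_singleton[of x G] by (simp add: distance_module_def)
next
  case (3 x y xs)
  let ?q = "y # xs" and ?z = "last (y # xs)"
  have arc: "(x, y) \<in> parcs G" and q: "?q \<in> paths G" using paths_Cons[OF 3(2)] by auto
  have pairs: "(x, y) \<in> finite_dist_pairs G" "(y, ?z) \<in> finite_dist_pairs G"
    using parcs_subset_finite_dist_pairs arc path_finite_dist_pairs[OF q] by auto
  have "vmap M (x, y) \<in> graded_hom K (int (the_enat (gdist G x y))) (vmod M x) (vmod M y)"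
    using M pairs(1) unfolding distance_module_def by blast
  then have xm: "vmap M (x, y) m \<in> carrier (vmod M y)"
    using graded_homD(1) 3(3) by fastforce
  \<comment> \<open>The arrow itself is shortest, so only the tail and betweenness remain as
    conditions.\<close>
  have "shortest G (vwalk_join [x, y] ?q) \<longleftrightarrow> shortest G ?q \<and> between G x y ?z"
    using shortest_vwalk_join_iff[OF arc_mem_paths[OF arc] q] shortest_arc[OF arc] by simp
  then have short: "shortest G (x # ?q) \<longleftrightarrow> shortest G ?q \<and> between G x y ?z"
    by (simp add: vwalk_join_def)
  have "vmap M (y, ?z) (vmap M (x, y) m) = (if between G x y ?z then vmap M (x, ?z) m else \<zero>\<^bsub>vmod M ?z\<^esub>)"
    using M pairs 3(3) by (simp add: distance_module_def)
  then show ?case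
    using 3(1)[OF q, of "vmap M (x, y) m"] xm short by (simp add: path_map_Cons)
qed simp

end

section \<open>Distance modules as representations\<close>

context digraph_algebras
begin

definition to_rep :: "('v, 'k, 'm) vertex_family \<Rightarrow> ('v, 'k, 'm) vertex_family" where
  "to_rep M = \<lparr>vmod = vmod M, vmap = restrict (vmap M) (parcs G)\<rparr>"

text \<open>For annihilated representations the choice of path is immaterial, by
  \<open>annihilated_path_map\<close>.\<close>

definition to_dist :: "('v, 'k, 'm) vertex_family \<Rightarrow> ('v, 'k, 'm) vertex_family" where
  "to_dist V = \<lparr>vmod = vmod V, vmap = (\<lambda>xy\<in>finite_dist_pairs G.
    restrict (path_map V (geodesic G (fst xy) (snd xy))) (carrier (vmod V (fst xy))))\<rparr>"

lemma vmod_to_rep [simp]: "vmod (to_rep M) = vmod M"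
  and vmod_to_dist [simp]: "vmod (to_dist V) = vmod V"
  by (simp_all add: to_rep_def to_dist_def)

lemma vmap_to_rep: "(x, y) \<in> parcs G \<Longrightarrow> vmap (to_rep M) (x, y) = vmap M (x, y)"
  by (simp add: to_rep_def)

lemma vmap_to_dist:
  "(x, y) \<in> finite_dist_pairs G \<Longrightarrow> vmap (to_dist V) (x, y) =
    restrict (path_map V (geodesic G x y)) (carrier (vmod V x))"
  by (simp add: to_dist_def)

lemma graded_rep_to_rep:
  assumes "distance_module K G M"
  shows "graded_rep K G (to_rep M)"
proof -
  have "vmap M (x, y) \<in> graded_hom K 1 (vmod M x) (vmod M y)" if arc: "(x, y) \<in> parcs G" for x y
  proof -
    have "vmap M (x, y) \<in> graded_hom K (int (the_enat (gdist G x y))) (vmod M x) (vmod M y)"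
      using assms parcs_subset_finite_dist_pairs arc unfolding distance_module_def by blast
    then show ?thesis by (simp add: gdist_arc[OF arc] one_enat_def)
  qed
  then show ?thesis
    using assms by (auto simp: graded_rep_def distance_module_def vmap_to_rep) (simp add: to_rep_def)
qed

lemma path_map_to_rep: "p \<in> paths G \<Longrightarrow> path_map (to_rep M) p m = path_map M p m"
  by (rule path_map_cong) (auto simp: vmap_to_rep)

section \<open>The action of the path algebra on a representation\<close>

context
  fixes V :: "('v, 'k, 'm) vertex_family"
  assumes V: "graded_rep K G V"
begin

lemma rep_module: "x \<in> pverts G \<Longrightarrow> Module.module K (vmod V x)"
  using V by (auto simp: graded_rep_def dest: graded_module.axioms)

lemma rep_act_superset:
  assumes f: "f \<in> carrier (path_algebra K G)" and v: "v \<in> rep_module_carrier G V"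
    and y: "y \<in> pverts G" and S: "finite S" "support K f \<subseteq> S" "S \<subseteq> paths G"
  shows "rep_act K G V v f y =
    (\<Oplus>\<^bsub>vmod V y\<^esub>p\<in>{p \<in> S. last p = y}. f p \<odot>\<^bsub>vmod V y\<^esub> path_map V p (v (hd p)))"
    and "p \<in> paths G \<Longrightarrow> path_map V p (v (hd p)) \<in> carrier (vmod V (last p))"
proof -
  interpret Module.module K "vmod V y" by (rule rep_module[OF y])
  show carr: "path_map V p (v (hd p)) \<in> carrier (vmod V (last p))" if "p \<in> paths G" for p
    using path_map_carrier[OF V that] v hd_mem_pverts[OF that]
    by (auto simp: rep_module_carrier_def)
  have "rep_act K G V v f y = (\<Oplus>\<^bsub>vmod V y\<^esub>p\<in>{p. f p \<noteq> \<zero> \<and> last p = y}.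
      f p \<odot>\<^bsub>vmod V y\<^esub> path_map V p (v (hd p)))"
    using y by (simp add: rep_act_def)
  also have "\<dots> = (\<Oplus>\<^bsub>vmod V y\<^esub>p\<in>{p \<in> S. last p = y}.
      f p \<odot>\<^bsub>vmod V y\<^esub> path_map V p (v (hd p)))"
  proof (rule M.finsum_superset)
    have carr': "path_map V p (v (hd p)) \<in> carrier (vmod V y)" if "p \<in> S" "last p = y" for p
      using carr[of p] S(3) that by auto
    have mem: "p \<in> S" if "f p \<noteq> \<zero>" for p using S(2) that by auto
    show "(\<lambda>p. f p \<odot>\<^bsub>vmod V y\<^esub> path_map V p (v (hd p)))
        \<in> {p. f p \<noteq> \<zero> \<and> last p = y} \<rightarrow> carrier (vmod V y)"
      by (rule Pi_I) (simp add: carr' mem P.carrier_coeff[OF f])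
    show "f p \<odot>\<^bsub>vmod V y\<^esub> path_map V p (v (hd p)) = \<zero>\<^bsub>vmod V y\<^esub>"
      if "p \<in> {p \<in> S. last p = y} - {p. f p \<noteq> \<zero> \<and> last p = y}" for p
    proof -
      have "f p = \<zero>" "p \<in> S" "last p = y" using that by auto
      then show ?thesis using carr'[of p] by simp
    qed
  qed (use S in auto)
  finally show "rep_act K G V v f y =
    (\<Oplus>\<^bsub>vmod V y\<^esub>p\<in>{p \<in> S. last p = y}. f p \<odot>\<^bsub>vmod V y\<^esub> path_map V p (v (hd p)))" .
qed

lemma rep_act_add:
  assumes f: "f \<in> carrier (path_algebra K G)" and g: "g \<in> carrier (path_algebra K G)"
    and v: "v \<in> rep_module_carrier G V" and y: "y \<in> pverts G"
  shows "rep_act K G V v (f \<oplus>\<^bsub>path_algebra K G\<^esub> g) y =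
    rep_act K G V v f y \<oplus>\<^bsub>vmod V y\<^esub> rep_act K G V v g y"
proof -
  interpret Module.module K "vmod V y" by (rule rep_module[OF y])
  let ?S = "support K f \<union> support K g"
  have S: "finite ?S" "?S \<subseteq> paths G"
    using P.carrier_finite P.carrier_support f g by auto
  have carr: "path_map V p (v (hd p)) \<in> carrier (vmod V y)" if "p \<in> ?S" "last p = y" for p
    using rep_act_superset(2)[OF f v y S(1) _ S(2), of p] that S(2) by auto
  have "rep_act K G V v (f \<oplus>\<^bsub>path_algebra K G\<^esub> g) y = (\<Oplus>\<^bsub>vmod V y\<^esub>p\<in>{p \<in> ?S. last p = y}.
      (f p \<oplus> g p) \<odot>\<^bsub>vmod V y\<^esub> path_map V p (v (hd p)))"
    unfolding P.add_apply[symmetric]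
    by (rule rep_act_superset(1)[OF P.add_carrier[OF f g] v y S(1) _ S(2)]) (auto simp: P.add_apply)
  also have "\<dots> = (\<Oplus>\<^bsub>vmod V y\<^esub>p\<in>{p \<in> ?S. last p = y}.
      f p \<odot>\<^bsub>vmod V y\<^esub> path_map V p (v (hd p)) \<oplus>\<^bsub>vmod V y\<^esub> g p \<odot>\<^bsub>vmod V y\<^esub> path_map V p (v (hd p)))"
    by (rule M.finsum_cong')
      (use carr in \<open>auto simp: P.carrier_coeff[OF f] P.carrier_coeff[OF g] smult_l_distr\<close>)
  also have "\<dots> = (\<Oplus>\<^bsub>vmod V y\<^esub>p\<in>{p \<in> ?S. last p = y}. f p \<odot>\<^bsub>vmod V y\<^esub> path_map V p (v (hd p)))
      \<oplus>\<^bsub>vmod V y\<^esub> (\<Oplus>\<^bsub>vmod V y\<^esub>p\<in>{p \<in> ?S. last p = y}. g p \<odot>\<^bsub>vmod V y\<^esub> path_map V p (v (hd p)))"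
    by (rule M.finsum_addf)
      (use carr in \<open>auto simp: P.carrier_coeff[OF f] P.carrier_coeff[OF g]\<close>)
  also have "\<dots> = rep_act K G V v f y \<oplus>\<^bsub>vmod V y\<^esub> rep_act K G V v g y"
    using rep_act_superset(1)[OF f v y S(1) _ S(2)] rep_act_superset(1)[OF g v y S(1) _ S(2)] by simp
  finally show ?thesis .
qed

lemma rep_act_zero:
  assumes "y \<in> pverts G"
  shows "rep_act K G V v \<zero>\<^bsub>path_algebra K G\<^esub> y = \<zero>\<^bsub>vmod V y\<^esub>"
proof -
  interpret Module.module K "vmod V y" by (rule rep_module[OF assms])
  have "{p. \<zero>\<^bsub>path_algebra K G\<^esub> p \<noteq> \<zero> \<and> last p = y} = {}" by (simp add: P.zero_apply)
  then show ?thesis using assms by (simp only: rep_act_def restrict_apply' M.finsum_empty)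
qed

lemma rep_act_monomial:
  assumes "a \<in> carrier K" "p \<in> paths G" and v: "v \<in> rep_module_carrier G V" and y: "y \<in> pverts G"
  shows "rep_act K G V v (monomial K a p) y =
    (if last p = y then a \<odot>\<^bsub>vmod V y\<^esub> path_map V p (v (hd p)) else \<zero>\<^bsub>vmod V y\<^esub>)"
proof -
  interpret Module.module K "vmod V y" by (rule rep_module[OF y])
  have m: "monomial K a p \<in> carrier (path_algebra K G)" using assms by (simp add: P.monomial_carrier)
  have S: "finite {p}" "support K (monomial K a p) \<subseteq> {p}" "{p} \<subseteq> paths G"
    using assms by (auto dest: P.support_monomial)
  let ?h = "\<lambda>q. monomial K a p q \<odot>\<^bsub>vmod V y\<^esub> path_map V q (v (hd q))"
  have act: "rep_act K G V v (monomial K a p) y = finsum (vmod V y) ?h {q \<in> {p}. last q = y}"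
    by (rule rep_act_superset(1)[OF m v y S])
  show ?thesis
  proof (cases "last p = y")
    case True
    then have single: "{q \<in> {p}. last q = y} = {p}" by auto
    have "?h p \<in> carrier (vmod V y)"
      using rep_act_superset(2)[OF m v y S assms(2)] assms(1) True by simp
    then have "rep_act K G V v (monomial K a p) y = ?h p" unfolding act single by simp
    then show ?thesis using True by simp
  next
    case False
    then have empty: "{q \<in> {p}. last q = y} = {}" by auto
    show ?thesis unfolding act empty using False by simp
  qed
qed

lemma annihilated_path_map:
  assumes ann: "annihilated_by K G R V" and p: "p \<in> paths G" and m: "m \<in> carrier (vmod V (hd p))"
  shows "\<not> shortest G p \<Longrightarrow> path_map V p m = \<zero>\<^bsub>vmod V (last p)\<^esub>"
    and "shortest G p \<Longrightarrow> shortest G q \<Longrightarrow> hd q = hd p \<Longrightarrow> last q = last p \<Longrightarrow>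
      path_map V p m = path_map V q m"
proof -
  \<comment> \<open>The element \<open>m\<close> placed at the start of \<open>p\<close> and zero
    elsewhere: a path from there acts on \<open>v\<close> by its path map on
    \<open>m\<close>.\<close>
  define v where "v = (\<lambda>x\<in>pverts G. if x = hd p then m else \<zero>\<^bsub>vmod V x\<^esub>)"
  let ?y = "last p"
  have y: "?y \<in> pverts G" by (rule last_mem_pverts[OF p])
  interpret Module.module K "vmod V ?y" by (rule rep_module[OF y])
  have v: "v \<in> rep_module_carrier G V"
  proof -
    have "\<zero>\<^bsub>vmod V x\<^esub> \<in> carrier (vmod V x)" if "x \<in> pverts G" for x
    proof -
      interpret Module.module K "vmod V x" by (rule rep_module[OF that])
      show ?thesis by simp
    qed
    then show ?thesis using m by (simp add: v_def rep_module_carrier_def)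
  qed
  have act0: "rep_act K G V v f ?y = \<zero>\<^bsub>vmod V ?y\<^esub>" if "f \<in> R" for f
    using ann v that y by (simp add: annihilated_by_def)
  have act: "rep_act K G V v (basis_elt K q) ?y = path_map V q m"
    if q: "q \<in> paths G" "hd q = hd p" "last q = ?y" for q
  proof -
    have "v (hd q) = m" using q hd_mem_pverts[OF p] by (simp add: v_def)
    then show ?thesis
      using rep_act_monomial[OF one_closed q(1) v y] path_map_carrier[OF V q(1), of m] q m
      by (simp add: basis_elt_eq_monomial)
  qed
  show "path_map V p m = \<zero>\<^bsub>vmod V ?y\<^esub>" if "\<not> shortest G p"
    using act[OF p refl refl] act0[OF non_shortest_in_relation_ideal[OF p that]] by simp
  show "path_map V p m = path_map V q m"
    if q: "shortest G p" "shortest G q" "hd q = hd p" "last q = last p"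
  proof -
    have qp: "q \<in> paths G" using q by (simp add: shortest_paths)
    let ?d = "basis_elt K p \<ominus>\<^bsub>path_algebra K G\<^esub> basis_elt K q"
    have d: "?d \<in> R" using q by (intro shortest_diff_in_relation_ideal) auto
    have e: "basis_elt K p \<in> carrier (path_algebra K G)" "basis_elt K q \<in> carrier (path_algebra K G)"
      using p qp by (simp_all add: basis_elt_eq_monomial P.monomial_carrier)
    \<comment> \<open>Written as a sum so that additivity of the action applies: the difference
      \<open>?d\<close> acts by zero.\<close>
    have "basis_elt K p = ?d \<oplus>\<^bsub>path_algebra K G\<^esub> basis_elt K q"
      unfolding P.Alg.M.minus_eq
      using e P.Alg.M.a_assoc[of "basis_elt K p" "\<ominus>\<^bsub>path_algebra K G\<^esub> basis_elt K q" "basis_elt K q"]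
        P.Alg.M.l_neg[OF e(2)] P.Alg.M.r_zero[OF e(1)] P.Alg.M.a_inv_closed[OF e(2)] by argo
    then have "rep_act K G V v (basis_elt K p) ?y =
        rep_act K G V v ?d ?y \<oplus>\<^bsub>vmod V ?y\<^esub> rep_act K G V v (basis_elt K q) ?y"
      using rep_act_add[OF ideal.Icarr[OF relation_ideal_ideal d] e(2) v y] by argo
    then show ?thesis
      using act[OF p refl refl] act[OF qp q(3,4)] act0[OF d] path_map_carrier[OF V qp, of m] q m by simp
  qed
qed

end

lemma annihilated_to_rep:
  assumes M: "distance_module K G M"
  shows "annihilated_by K G R (to_rep M)"
  unfolding annihilated_by_def
proof (intro ballI)
  fix v f assume v: "v \<in> rep_module_carrier G (to_rep M)" and fR: "f \<in> R"
  note rep = graded_rep_to_rep[OF M]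
  have path_map: "path_map (to_rep M) p (v (hd p)) =
      (if shortest G p then vmap M (hd p, last p) (v (hd p)) else \<zero>\<^bsub>vmod M (last p)\<^esub>)"
    if "p \<in> paths G" for p
  proof -
    have "v (hd p) \<in> carrier (vmod M (hd p))"
      using v hd_mem_pverts[OF that] unfolding rep_module_carrier_def vmod_to_rep by (rule PiE_mem)
    then show ?thesis
      using distance_path_map[OF M that, of "v (hd p)"] by (simp add: path_map_to_rep that)
  qed
  \<comment> \<open>Both sides are additive in \<open>f\<close>. A shortest path acts by the
    structure map of its end points, just as the chosen path does; a non-shortest one acts by
    zero.\<close>
  have act: "rep_act K G (to_rep M) v (\<sigma>.\<tau> (\<pi>.\<tau> f)) y = rep_act K G (to_rep M) v f y"
    if y: "y \<in> pverts G" and "f \<in> carrier (path_algebra K G)" for y f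
    using that(2)
  proof (induction rule: P.basis_induct)
    case zero
    then show ?case by (simp add: \<pi>.map_zero \<sigma>.map_zero)
  next
    case (add a p f)
    interpret Module.module K "vmod M y" using rep_module[OF rep y] by simp
    have m: "monomial K a p \<in> carrier (path_algebra K G)" using add by (simp add: P.monomial_carrier)
    have "rep_act K G (to_rep M) v (\<sigma>.\<tau> (\<pi>.\<tau> (monomial K a p))) y =
        rep_act K G (to_rep M) v (monomial K a p) y"
    proof (cases "shortest G p")
      case True
      note ends = path_finite_dist_pairs[OF add(2)]
      obtain q where q: "geodesic G (hd p) (last p) = q" by simp
      note g = geodesic[OF ends, unfolded q]
      show ?thesis
        using add True ends q g shortest_paths[OF g(1)] path_map[OF add(2)] path_map[OF shortest_paths[OF g(1)]]
        by (simp add: \<pi>_monomial \<sigma>_monomial rep_act_monomial[OF rep _ _ v y])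
    next
      case False
      then show ?thesis
        using add path_map[OF add(2)]
        by (simp add: \<pi>_monomial \<sigma>.map_zero rep_act_zero[OF rep y] rep_act_monomial[OF rep _ _ v y])
    qed
    then show ?case
      using add m
      by (simp add: \<pi>.map_add \<sigma>.map_add \<pi>.map_carrier \<sigma>.map_carrier rep_act_add[OF rep _ _ v y])
  qed
  have f: "f \<in> carrier (path_algebra K G)" "\<pi>.\<tau> f = \<zero>\<^bsub>distance_algebra K G\<^esub>"
    using fR unfolding relation_ideal_eq_kernel a_kernel_def' by auto
  have "rep_act K G (to_rep M) v f y = \<zero>\<^bsub>vmod (to_rep M) y\<^esub>" if "y \<in> pverts G" for y
    using act[OF that f(1)] rep_act_zero[OF rep that] by (simp add: f(2) \<sigma>.map_zero)
  then show "rep_act K G (to_rep M) v f = (\<lambda>y\<in>pverts G. \<zero>\<^bsub>vmod (to_rep M) y\<^esub>)"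
    by (auto simp: fun_eq_iff rep_act_def)
qed

lemma distance_module_to_dist:
  assumes V: "graded_rep K G V" and ann: "annihilated_by K G R V"
  shows "distance_module K G (to_dist V)"
proof -
  have hom: "vmap (to_dist V) (x, y) \<in> graded_hom K (int (the_enat (gdist G x y))) (vmod V x) (vmod V y)"
    if xy: "(x, y) \<in> finite_dist_pairs G" for x y
    using path_map_graded_hom[OF V shortest_paths[OF geodesic(1)[OF xy]]]
      shortest_length[OF geodesic(1)[OF xy]] geodesic(2,3)[OF xy]
    by (simp add: vmap_to_dist[OF xy] del: vwalk_length_simp)
  have ident: "vmap (to_dist V) (x, x) m = m" if x: "x \<in> pverts G" and m: "m \<in> carrier (vmod V x)" for x m
  proof -
    have xx: "(x, x) \<in> finite_dist_pairs G" using x path_finite_dist_pairs[of "[x]" G] by simp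
    \<comment> \<open>The chosen path from \<open>x\<close> to itself is shortest, so it acts like
      the trivial path.\<close>
    show ?thesis
      using annihilated_path_map(2)[OF V ann _ _ shortest_singleton[OF x] geodesic(1)[OF xx], of m]
        geodesic(2,3)[OF xx] x m by (simp add: vmap_to_dist[OF xx])
  qed
  have comp: "vmap (to_dist V) (y, z) (vmap (to_dist V) (x, y) m) =
      (if between G x y z then vmap (to_dist V) (x, z) m else \<zero>\<^bsub>vmod V z\<^esub>)"
    if xy: "(x, y) \<in> finite_dist_pairs G" and yz: "(y, z) \<in> finite_dist_pairs G"
      and m: "m \<in> carrier (vmod V x)" for x y z m
  proof -
    let ?p = "geodesic G x y" and ?q = "geodesic G y z"
    note p = geodesic[OF xy] note q = geodesic[OF yz]
    have pq: "?p \<in> paths G" "?q \<in> paths G" using p q by (simp_all add: shortest_paths)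
    have j: "joinable ?p ?q" using p q pq by (simp add: joinable_paths_iff)
    let ?r = "vwalk_join ?p ?q"
    have r: "?r \<in> paths G" "hd ?r = x" "last ?r = z"
      using vwalk_join_mem_paths[OF pq j] p q j by (simp_all add: vwalk_join_hd vwalk_join_last)
    have xz: "(x, z) \<in> finite_dist_pairs G" by (rule finite_dist_pairs_trans[OF xy yz])
    have "path_map V ?p m \<in> carrier (vmod V y)"
      using path_map_carrier[OF V pq(1)] p m by simp
    \<comment> \<open>Composing along two chosen paths is the path map of their concatenation: if
      that is shortest, it may be replaced by the chosen path from \<open>x\<close> to
      \<open>z\<close>; if not, annihilation makes it zero.\<close>
    then have lhs: "vmap (to_dist V) (y, z) (vmap (to_dist V) (x, y) m) = path_map V ?r m"
      using m by (simp add: vmap_to_dist[OF xy] vmap_to_dist[OF yz] path_map_vwalk_join[OF j])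
    have short: "shortest G ?r \<longleftrightarrow> between G x y z"
      using shortest_vwalk_join_iff[OF pq j] p q by simp
    show ?thesis
    proof (cases "between G x y z")
      case True
      then have "path_map V ?r m = path_map V (geodesic G x z) m"
        using annihilated_path_map(2)[OF V ann r(1), of m "geodesic G x z"] r m short geodesic[OF xz]
        by simp
      then show ?thesis using lhs True m by (simp add: vmap_to_dist[OF xz])
    next
      case False
      then show ?thesis
        using annihilated_path_map(1)[OF V ann r(1), of m] r m short lhs by simp
    qed
  qed
  have "vmap (to_dist V) \<in> extensional (finite_dist_pairs G)" by (simp add: to_dist_def)
  then show ?thesis
    using V hom ident comp by (auto simp: distance_module_def graded_rep_def)
qed

lemma to_dist_to_rep:
  assumes M: "distance_module K G M"
  shows "to_dist (to_rep M) = M"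
proof (rule vertex_family.equality)
  show "vmap (to_dist (to_rep M)) = vmap M"
  proof
    fix xy
    show "vmap (to_dist (to_rep M)) xy = vmap M xy"
    proof (cases "xy \<in> finite_dist_pairs G")
      case False
      have "vmap M \<in> extensional (finite_dist_pairs G)"
        using M by (simp add: distance_module_def)
      then have "vmap M xy = undefined" by (rule extensional_arb[OF _ False])
      then show ?thesis using False by (simp add: to_dist_def)
    next
      case True
      then obtain x y where xy: "xy = (x, y)" "(x, y) \<in> finite_dist_pairs G" by (cases xy) auto
      have hom: "vmap M (x, y) \<in> graded_hom K (int (the_enat (gdist G x y))) (vmod M x) (vmod M y)"
        using M xy(2) unfolding distance_module_def by blast
      have "path_map (to_rep M) (geodesic G x y) m = vmap M (x, y) m" if "m \<in> carrier (vmod M x)" for m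
        using geodesic[OF xy(2)] distance_path_map[OF M, of "geodesic G x y" m] that
        by (simp add: path_map_to_rep shortest_paths)
      then show ?thesis
        using graded_homD(5)[OF hom] xy by (auto simp: vmap_to_dist fun_eq_iff)
    qed
  qed
qed simp_all

lemma to_rep_to_dist:
  assumes V: "graded_rep K G V" and ann: "annihilated_by K G R V"
  shows "to_rep (to_dist V) = V"
proof (rule vertex_family.equality)
  show "vmap (to_rep (to_dist V)) = vmap V"
  proof
    fix xy
    show "vmap (to_rep (to_dist V)) xy = vmap V xy"
    proof (cases "xy \<in> parcs G")
      case False
      have "vmap V \<in> extensional (parcs G)" using V by (simp add: graded_rep_def)
      then have "vmap V xy = undefined" by (rule extensional_arb[OF _ False])
      then show ?thesis using False by (simp add: to_rep_def)
    next
      case True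
      then obtain x y where xy: "xy = (x, y)" "(x, y) \<in> parcs G" by (cases xy) auto
      then have fd: "(x, y) \<in> finite_dist_pairs G" using parcs_subset_finite_dist_pairs by blast
      have hom: "vmap V (x, y) \<in> graded_hom K 1 (vmod V x) (vmod V y)"
        using V xy by (auto simp: graded_rep_def)
      \<comment> \<open>The arrow and the chosen path are both shortest with the same ends, so
        annihilation equates their maps.\<close>
      have "path_map V (geodesic G x y) m = vmap V (x, y) m" if "m \<in> carrier (vmod V x)" for m
        using annihilated_path_map(2)[OF V ann arc_mem_paths[OF xy(2)], of m "geodesic G x y"]
          shortest_arc[OF xy(2)] geodesic[OF fd] that by (simp add: path_map_Cons)
      then show ?thesis
        using graded_homD(5)[OF hom] xy fd by (auto simp: vmap_to_rep vmap_to_dist fun_eq_iff)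
    qed
  qed
qed simp_all

lemma DistMod_eq: "DistMod K G = family_category K G (finite_dist_pairs G) {M. distance_module K G M}"
  by (simp add: DistMod_def)

lemma GrRep_eq:
  "GrRep K G R = family_category K G (parcs G) {V. graded_rep K G V \<and> annihilated_by K G R V}"
  by (simp add: GrRep_def full_subcategory_def family_category_def)

theorem DistMod_equivalence:
  "category_equivalence (DistMod K G) (GrRep K G R)
    (\<lparr>on_obj = to_rep, on_arr = (\<lambda>X Y f. f)\<rparr> :: (('v, 'k, 'm) vertex_family, 'v \<Rightarrow> 'm \<Rightarrow> 'm,
      ('v, 'k, 'm) vertex_family, 'v \<Rightarrow> 'm \<Rightarrow> 'm) cat_functor)"
  unfolding DistMod_eq GrRep_eq
proof (rule family_equivalence[where H = to_dist])
  let ?Ob = "{M :: ('v, 'k, 'm) vertex_family. distance_module K G M}"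
  let ?Ob' = "{V :: ('v, 'k, 'm) vertex_family. graded_rep K G V \<and> annihilated_by K G R V}"
  have C: "category (family_category K G (finite_dist_pairs G) ?Ob)"
  proof (rule category_family)
    fix M :: "('v, 'k, 'm) vertex_family" and x y m
    assume "M \<in> ?Ob" "(x, y) \<in> finite_dist_pairs G" and m: "m \<in> carrier (vmod M x)"
    then have "vmap M (x, y) \<in> graded_hom K (int (the_enat (gdist G x y))) (vmod M x) (vmod M y)"
      unfolding distance_module_def by blast
    then show "vmap M (x, y) m \<in> carrier (vmod M y)" by (rule graded_homD(1)) (rule m)
  qed (auto simp: distance_module_def finite_dist_pairs_verts)
  have D: "category (family_category K G (parcs G) ?Ob')"
  proof (rule category_family)
    fix V :: "('v, 'k, 'm) vertex_family" and x y m
    assume "V \<in> ?Ob'" "(x, y) \<in> parcs G" and m: "m \<in> carrier (vmod V x)"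
    then have "vmap V (x, y) \<in> graded_hom K 1 (vmod V x) (vmod V y)"
      unfolding graded_rep_def by blast
    then show "vmap V (x, y) m \<in> carrier (vmod V y)" by (rule graded_homD(1)) (rule m)
  qed (auto simp: graded_rep_def dest: in_arcsD1 in_arcsD2)
  show "cat_functor (family_category K G (finite_dist_pairs G) ?Ob) (family_category K G (parcs G) ?Ob')
      \<lparr>on_obj = to_rep, on_arr = (\<lambda>X Y f. f)\<rparr>"
  proof (rule family_functor[OF C D])
    fix M N :: "('v, 'k, 'm) vertex_family"
    show "family_homs K G (finite_dist_pairs G) M N \<subseteq> family_homs K G (parcs G) (to_rep M) (to_rep N)"
    proof
      fix \<phi> assume \<phi>: "\<phi> \<in> family_homs K G (finite_dist_pairs G) M N"
      have "vmap N (x, y) (\<phi> x m) = \<phi> y (vmap M (x, y) m)"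
        if "(x, y) \<in> parcs G" "m \<in> carrier (vmod M x)" for x y m
        using family_homsD(3)[OF \<phi>] parcs_subset_finite_dist_pairs that by blast
      then show "\<phi> \<in> family_homs K G (parcs G) (to_rep M) (to_rep N)"
        using \<phi> by (auto simp: family_homs_def vmap_to_rep)
    qed
  qed (auto simp: graded_rep_to_rep annihilated_to_rep)
  show "cat_functor (family_category K G (parcs G) ?Ob') (family_category K G (finite_dist_pairs G) ?Ob)
      \<lparr>on_obj = to_dist, on_arr = (\<lambda>X Y f. f)\<rparr>"
  proof (rule family_functor[OF D C])
    fix V W :: "('v, 'k, 'm) vertex_family" assume V: "V \<in> ?Ob'" and W: "W \<in> ?Ob'"
    show "family_homs K G (parcs G) V W \<subseteq> family_homs K G (finite_dist_pairs G) (to_dist V) (to_dist W)"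
    proof
      fix \<phi> assume \<phi>: "\<phi> \<in> family_homs K G (parcs G) V W"
      have "vmap (to_dist W) (x, y) (\<phi> x m) = \<phi> y (vmap (to_dist V) (x, y) m)"
        if xy: "(x, y) \<in> finite_dist_pairs G" and m: "m \<in> carrier (vmod V x)" for x y m
      proof -
        have "\<phi> x m \<in> carrier (vmod W x)"
          by (rule graded_homD(1)[OF family_homsD(1)[OF \<phi>] m]) (use finite_dist_pairs_verts[OF xy] in simp)
        then show ?thesis
          using path_map_natural[OF \<phi> _ shortest_paths[OF geodesic(1)[OF xy]], of m] V geodesic(2,3)[OF xy] m
          by (simp add: vmap_to_dist[OF xy])
      qed
      then show "\<phi> \<in> family_homs K G (finite_dist_pairs G) (to_dist V) (to_dist W)"
        using \<phi> by (auto simp: family_homs_def)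
    qed
  qed (auto simp: distance_module_to_dist)
qed (auto simp: to_dist_to_rep to_rep_to_dist)

end

theorem proposition6p1:
  fixes K :: "('k, 'r) ring_scheme"
    and G :: "'v pair_pre_digraph"
  assumes "cring K"
    and "pair_digraph G"
  shows "admissible K G (relation_ideal K G) \<and>
         graded_algebra_isomorphic K (distance_algebra K G)
           (quotient_algebra (path_algebra K G) (relation_ideal K G)) \<and>
         (\<exists>F :: (('v, 'k, 'm) vertex_family, 'v \<Rightarrow> 'm \<Rightarrow> 'm,
                 ('v, 'k, 'm) vertex_family, 'v \<Rightarrow> 'm \<Rightarrow> 'm) cat_functor.
           category_equivalence (DistMod K G) (GrRep K G (relation_ideal K G)) F \<and>
           (\<forall>M\<in>Obj (DistMod K G).
              (\<forall>x\<in>pverts G. vmod (on_obj F M) x = vmod M x) \<and>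
              (\<forall>(x, y)\<in>parcs G. vmap (on_obj F M) (x, y) = vmap M (x, y))))"
proof -
  interpret digraph_algebras K G
    using assms by (rule digraph_algebras.intro)
  let ?F = "\<lparr>on_obj = to_rep, on_arr = (\<lambda>X Y f. f)\<rparr>
    :: (('v, 'k, 'm) vertex_family, 'v \<Rightarrow> 'm \<Rightarrow> 'm, ('v, 'k, 'm) vertex_family, 'v \<Rightarrow> 'm \<Rightarrow> 'm) cat_functor"
  have "category_equivalence (DistMod K G) (GrRep K G (relation_ideal K G)) ?F"
    by (rule DistMod_equivalence)
  then show ?thesis
    using relation_ideal_admissible distance_algebra_isomorphic_quotient
    by (intro conjI exI[of _ ?F]) (auto simp: vmap_to_rep)
qed

end
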